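(* Let $q=2^r$ ($r\ge 1$). (a) Let $n$ be odd, and assume either $n\ge 3$ (and $q$ arbitrary) or $n=1$ and $q\ge 8$. Put $N^-(n,q)=|DC^-(n,q)|$; then $N^-(n,q)=A^-(n,q)B^-(n,q)$. The weight distribution $\{C_j^-(n,q)\}_{j=0}^{N^-(n,q)}$ of the binary code $C(DC^-(n,q))$ is given by $$C_j^-(n,q)=\sum \binom{q^{-1}A^-(n,q)(B^-(n,q)+1)}{\nu_0}\prod_{\beta\in\mathbb{F}_q^*,\ tr(\beta^{-1})=0}\binom{q^{-1}A^-(n,q)(B^-(n,q)+q+1)}{\nu_\beta}\prod_{\beta\in\mathbb{F}_q^*,\ tr(\beta^{-1})=1}\binom{q^{-1}A^-(n,q)(B^-(n,q)-q+1)}{\nu_\beta},$$ where the sum is over all families of nonnegative integers $\{\nu_\beta\}_{\beta\in\mathbb{F}_q}$ with $\sum_{\beta\in\mathbb{F}_q}\nu_\beta=j$ and $\sum_{\beta\in\mathbb{F}_q}\nu_\beta\beta=0$ (in $\mathbb{F}_q$). Moreover, for $h=1,2,\dots$, $$MK^h=\sum_{l=0}^{h-1}(-1)^{h+l+1}\binom{h}{l}B^-(n,q)^{h-l}MK^l+qA^-(n,q)^{-h}\sum_{j=0}^{\min\{N^-(n,q),h\}}(-1)^{h+j}C_j^-(n,q)\sum_{t=j}^{h}t!\,S(h,t)\,2^{h-t}\binom{N^-(n,q)-j}{N^-(n,q)-t}.$$ (b) Let $n\ge 2$ be even and $q\ge 4$. Put $N^+(n,q)=|DC^+(n,q)|$;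 then $N^+(n,q)=A^+(n,q)B^+(n,q)$. The weight distribution $\{C_j^+(n,q)\}_{j=0}^{N^+(n,q)}$ of the binary code $C(DC^+(n,q))$ is given by $$C_j^+(n,q)=\sum\binom{q^{-1}A^+(n,q)(B^+(n,q)+q^3-q^2-1)}{\nu_0}\prod_{\substack{\tau\in\mathbb{Z},\ |\tau|<2\sqrt q\\ \tau\equiv -1\ (\mathrm{mod}\ 4)}}\ \prod_{\beta\in\mathbb{F}_q^*,\ K(\lambda;\beta^{-1})=\tau}\binom{q^{-1}A^+(n,q)(B^+(n,q)+q\tau-q^2-1)}{\nu_\beta},$$ where the sum is over all families of nonnegative integers $\{\nu_\beta\}_{\beta\in\mathbb{F}_q}$ with $\sum_{\beta}\nu_\beta=j$ and $\sum_\beta\nu_\beta\beta=0$ (in $\mathbb{F}_q$). Moreover, for $h=1,2,\dots$, $$MK_2^h=\sum_{l=0}^{h-1}(-1)^{h+l+1}\binom{h}{l}(B^+(n,q)-q^2)^{h-l}MK_2^l+qA^+(n,q)^{-h}\sum_{j=0}^{\min\{N^+(n,q),h\}}(-1)^{h+j}C_j^+(n,q)\sum_{t=j}^{h}t!\,S(h,t)\,2^{h-t}\binom{N^+(n,q)-j}{N^+(n,q)-t},$$ and $$MK^{2h}=\sum_{l=0}^{h-1}(-1)^{h+l+1}\binom{h}{l}(B^+(n,q)-q^2+q)^{h-l}MK^{2l}+qA^+(n,q)^{-h}\sum_{j=0}^{\min\{N^+(n,q),h\}}(-1)^{h+j}C_j^+(n,q)\sum_{t=j}^{h}t!\,S(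h,t)\,2^{h-t}\binom{N^+(n,q)-j}{N^+(n,q)-t}.$$
   Context: $q=2^r$, $\mathbb{F}_q$ the field with $q$ elements; $\mathrm{Tr}\,w$ is the trace of a square matrix $w$; $tr:\mathbb{F}_q\to\mathbb{F}_2$, $tr(x)=x+x^2+\dots+x^{2^{r-1}}$; $\lambda(x)=(-1)^{tr(x)}$ is the canonical additive character. $Sp(2n,q)=\{w\in GL(2n,\mathbb{F}_q): {}^tw\,J\,w=J\}$ with $J=\begin{pmatrix}0&1_n\\1_n&0\end{pmatrix}$. $P=P(2n,q)$ is the subgroup of all $\begin{pmatrix}A&0\\0&{}^tA^{-1}\end{pmatrix}\begin{pmatrix}1_n&B\\0&1_n\end{pmatrix}$ with $A\in GL(n,\mathbb{F}_q)$ and $B$ a symmetric $n\times n$ matrix over $\mathbb{F}_q$. For $0\le s\le n$, $\sigma_s$ is the $2n\times 2n$ block matrix $\begin{pmatrix}0&0&1_s&0\\0&1_{n-s}&0&0\\1_s&0&0&0\\0&0&0&1_{n-s}\end{pmatrix}$ (block sizes $s,n-s,s,n-s$). For odd $n\ge1$, $DC^-(n,q)=P\sigma_{n-1}P$; for even $n\ge2$, $DC^+(n,q)=P\sigma_{n-2}P$. Gaussian binomial: $\left[\begin{smallmatrix}n\\ s\end{smallmatrix}\right]_q=\prod_{j=0}^{s-1}\frac{q^{n-j}-1}{q^{s-j}-1}$. Define $A^-(n,q)=q^{\frac14(5n^2-1)}\left[\begin{smallmatrix}n\\1\end{smallmatrix}\right]_q\prod_{j=1}^{(n-1)/2}(q^{2j-1}-1)$,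 $B^-(n,q)=q^{\frac14(n-1)^2}(q^n-1)\prod_{j=1}^{(n-1)/2}(q^{2j}-1)$ (n odd), $A^+(n,q)=q^{\frac14(5n^2-2n)}\left[\begin{smallmatrix}n\\2\end{smallmatrix}\right]_q\prod_{j=1}^{(n-2)/2}(q^{2j-1}-1)$, $B^+(n,q)=q^{\frac14(n-2)^2}(q^n-1)(q^{n-1}-1)\prod_{j=1}^{(n-2)/2}(q^{2j}-1)$ (n even); empty products are $1$. Codes: for $D=DC^\mp(n,q)$ with $N=|D|$, fix an ordering $g_1,\dots,g_N$ of the elements of $D$ and let $C(D)=\{u\in\mathbb{F}_2^N:\sum_{j=1}^N u_j\,\mathrm{Tr}\,g_j=0 \text{ in }\mathbb{F}_q\}$; its weight distribution $\{C_j\}$ is given by $C_j=$ the number of codewords of Hamming weight $j$. Kloosterman sums: $K(\lambda;a)=\sum_{\alpha\in\mathbb{F}_q^*}\lambda(\alpha+a\alpha^{-1})$, $K_2(\lambda;a)=\sum_{\alpha_1,\alpha_2\in\mathbb{F}_q^*}\lambda(\alpha_1+\alpha_2+a\alpha_1^{-1}\alpha_2^{-1})$ for $a\in\mathbb{F}_q^*$; $MK^h=\sum_{a\in\mathbb{F}_q^*}K(\lambda;a)^h$ and $MK_2^h=\sum_{a\in\mathbb{F}_q^*}K_2(\lambda;a)^h$ for integers $h\ge 0$. $S(h,t)=\frac1{t!}\sum_{j=0}^t(-1)^{t-j}\binom tj j^h$ is the Stirling number of the second kind. Convention: $\binom ba=0$ if $a>b$ or $a<0$. *)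

theory Defs
  imports
    Complex_Main
    "HOL-Library.Cardinality"
    "HOL-Library.Z2"
    "HOL-Number_Theory.Cong"
    "HOL-Combinatorics.Stirling"
    "Jordan_Normal_Form.Matrix"
begin

section \<open>Additive character and Kloosterman sums\<close>

text \<open>
  These definitions are used when \<open>'a\<close> is a field with $2^r$ elements. The absolute trace is kept as an
  element of \<open>'a\<close>; its values lie in the prime field \<open>{0, 1}\<close>.
\<close>

definition abs_tr :: "nat \<Rightarrow> 'a::field \<Rightarrow> 'a" where
  "abs_tr r x = (\<Sum>i<r. x ^ (2 ^ i))"

definition add_char :: "nat \<Rightarrow> 'a::field \<Rightarrow> int" where
  "add_char r x = (if abs_tr r x = 0 then 1 else -1)"

definition Kloost :: "nat \<Rightarrow> 'a::{finite,field} \<Rightarrow> int" where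
  "Kloost r a = (\<Sum>\<alpha>\<in>UNIV - {0}. add_char r (\<alpha> + a * inverse \<alpha>))"

definition Kloost2 :: "nat \<Rightarrow> 'a::{finite,field} \<Rightarrow> int" where
  "Kloost2 r a = (\<Sum>\<alpha>\<^sub>1\<in>UNIV - {0}. \<Sum>\<alpha>\<^sub>2\<in>UNIV - {0}.
     add_char r (\<alpha>\<^sub>1 + \<alpha>\<^sub>2 + a * inverse \<alpha>\<^sub>1 * inverse \<alpha>\<^sub>2))"

definition MK :: "'a::{finite,field} itself \<Rightarrow> nat \<Rightarrow> nat \<Rightarrow> int" where
  "MK _ r h = (\<Sum>a\<in>UNIV - {0::'a}. Kloost r a ^ h)"

definition MK2 :: "'a::{finite,field} itself \<Rightarrow> nat \<Rightarrow> nat \<Rightarrow> int" where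
  "MK2 _ r h = (\<Sum>a\<in>UNIV - {0::'a}. Kloost2 r a ^ h)"


section \<open>The parabolic subgroup and the double cosets\<close>

definition mat_trace :: "'a::comm_monoid_add mat \<Rightarrow> 'a" where
  "mat_trace w = (\<Sum>i<dim_row w. w $$ (i, i))"

text \<open>\<open>A'\<close> is the inverse of \<open>A\<close>, so that its existence says that \<open>A\<close> lies in $GL(n)$.\<close>

definition parabolic :: "nat \<Rightarrow> 'a::field mat set" where
  "parabolic n =
    {four_block_mat A (0\<^sub>m n n) (0\<^sub>m n n) (transpose_mat A')
       * four_block_mat (1\<^sub>m n) B (0\<^sub>m n n) (1\<^sub>m n) | A A' B.
      A \<in> carrier_mat n n \<and> A' \<in> carrier_mat n n \<and> inverts_mat A A' \<and> inverts_mat A' A \<and>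
      B \<in> carrier_mat n n \<and> transpose_mat B = B}"

text \<open>
  The $4 \times 4$ block matrix with block sizes \<open>s\<close>, \<open>n - s\<close>, \<open>s\<close>, \<open>n - s\<close>, assembled from its
  four $n \times n$ quadrants.
\<close>

definition sigma_mat :: "nat \<Rightarrow> nat \<Rightarrow> 'a::field mat" where
  "sigma_mat n s =
    (let D = four_block_mat (0\<^sub>m s s) (0\<^sub>m s (n - s)) (0\<^sub>m (n - s) s) (1\<^sub>m (n - s));
         E = four_block_mat (1\<^sub>m s) (0\<^sub>m s (n - s)) (0\<^sub>m (n - s) s) (0\<^sub>m (n - s) (n - s))
     in four_block_mat D E E D)"

definition double_coset :: "nat \<Rightarrow> nat \<Rightarrow> 'a::field mat set" where
  "double_coset n s = {p * sigma_mat n s * p' | p p'. p \<in> parabolic n \<and> p' \<in> parabolic n}"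

text \<open>Used for odd \<open>n\<close> and for even \<open>n \<ge> 2\<close>, respectively.\<close>

definition DC_minus :: "nat \<Rightarrow> 'a::field mat set" where
  "DC_minus n = double_coset n (n - 1)"

definition DC_plus :: "nat \<Rightarrow> 'a::field mat set" where
  "DC_plus n = double_coset n (n - 2)"


section \<open>The numerical parameters\<close>

definition gauss_binom :: "nat \<Rightarrow> nat \<Rightarrow> nat \<Rightarrow> real" where
  "gauss_binom q n s = (\<Prod>j<s. (real q ^ (n - j) - 1) / (real q ^ (s - j) - 1))"

text \<open>
  For odd \<open>n\<close> (in the minus case) and even \<open>n \<ge> 2\<close> (in the plus case) all the divisions and
  subtractions of natural numbers below are exact.
\<close>

definition A_minus :: "nat \<Rightarrow> nat \<Rightarrow> real" where
  "A_minus n q = real q ^ ((5 * n\<^sup>2 - 1) div 4) * gauss_binom q n 1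
     * (\<Prod>j = 1..(n - 1) div 2. (real q ^ (2 * j - 1) - 1))"

definition B_minus :: "nat \<Rightarrow> nat \<Rightarrow> real" where
  "B_minus n q = real q ^ ((n - 1)\<^sup>2 div 4) * (real q ^ n - 1)
     * (\<Prod>j = 1..(n - 1) div 2. (real q ^ (2 * j) - 1))"

definition A_plus :: "nat \<Rightarrow> nat \<Rightarrow> real" where
  "A_plus n q = real q ^ ((5 * n\<^sup>2 - 2 * n) div 4) * gauss_binom q n 2
     * (\<Prod>j = 1..(n - 2) div 2. (real q ^ (2 * j - 1) - 1))"

definition B_plus :: "nat \<Rightarrow> nat \<Rightarrow> real" where
  "B_plus n q = real q ^ ((n - 2)\<^sup>2 div 4) * (real q ^ n - 1) * (real q ^ (n - 1) - 1)
     * (\<Prod>j = 1..(n - 2) div 2. (real q ^ (2 * j) - 1))"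

text \<open>
  Binomial coefficients with the convention that $\binom{b}{a} = 0$ if $a > b$ or $a < 0$. The
  upper argument is real because the formulas for it involve divisions.
\<close>

definition binom :: "real \<Rightarrow> int \<Rightarrow> real" where
  "binom b a = (if a < 0 \<or> b < of_int a then 0 else b gchoose nat a)"


section \<open>The codes\<close>

text \<open>
  An ordering of a finite set of matrices is a list \<open>gs\<close> enumerating it without repetition.
  A bit acts on the field through the embedding of the prime field.
\<close>

definition ordering_of :: "'b list \<Rightarrow> 'b set \<Rightarrow> bool" where
  "ordering_of gs D \<longleftrightarrow> distinct gs \<and> set gs = D"

definition trace_code :: "'a::field mat list \<Rightarrow> bit vec set" where
  "trace_code gs = {u \<in> carrier_vec (length gs).
     (\<Sum>j<length gs. of_bool (u $ j = 1) * mat_trace (gs ! j)) = 0}"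

definition hamming_weight :: "bit vec \<Rightarrow> nat" where
  "hamming_weight u = card {j. j < dim_vec u \<and> u $ j \<noteq> 0}"

definition weight_count :: "'a::field mat list \<Rightarrow> nat \<Rightarrow> nat" where
  "weight_count gs j = card {u \<in> trace_code gs. hamming_weight u = j}"

definition families :: "nat \<Rightarrow> ('a::{finite,field} \<Rightarrow> nat) set" where
  "families j = {\<nu>. (\<Sum>\<beta>\<in>UNIV. \<nu> \<beta>) = j \<and> (\<Sum>\<beta>\<in>UNIV. of_nat (\<nu> \<beta>) * \<beta>) = 0}"

text \<open>
  The term involving the weight distribution \<open>C\<close>, common to all the recursions. Here
  \<open>N - t\<close> may be negative, in which case the binomial coefficient vanishes.
\<close>

definition moment_term :: "nat \<Rightarrow> real \<Rightarrow> nat \<Rightarrow> (nat \<Rightarrow> nat) \<Rightarrow> nat \<Rightarrow> real" where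
  "moment_term q A N C h = real q / A ^ h *
     (\<Sum>j = 0..min N h. (-1) ^ (h + j) * real (C j) *
        (\<Sum>t = j..h. fact t * real (Stirling h t) * 2 ^ (h - t)
           * binom (real N - real j) (int N - int t)))"

end

theory Submission
  imports
    Defs
    "HOL-Computational_Algebra.Polynomial_Factorial"
    "Jordan_Normal_Form.Determinant"
begin

text \<open>
  For \<open>p = para A B\<close> in \<open>P\<close> the trace of \<open>p * \<sigma>\<close> is an affine function of the symmetric matrix \<open>B\<close>. Its
  linear part vanishes exactly if the upper right block of \<open>A\<close> is zero and the upper left block is
  alternating; otherwise the trace is equidistributed when \<open>B\<close> varies. Since \<open>P \<times> P \<rightarrow> P \<sigma> P\<close> has fibres
  of constant size, the trace distribution on the double coset follows from the numbers of invertible and of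
  invertible alternating matrices, and from the distribution of \<open>Tr C + Tr C\<inverse>\<close> on \<open>GL(1)\<close> and \<open>GL(2)\<close>,
  which involves \<open>\<lambda>(1/\<beta>)\<close> and \<open>K(\<lambda>; 1/\<beta>)\<close>. Codewords of weight \<open>j\<close> are \<open>j\<close>-element subsets of the double coset
  whose traces sum to zero.

  For the recursions, let \<open>w(a)\<close> be the number of \<open>g\<close> in the double coset with \<open>\<lambda>(a Tr g) = -1\<close>. Writing
  \<open>w(a)^h\<close> through Stirling numbers and binomial coefficients, and expanding \<open>2^t (w(a) choose t)\<close> as
  a sum of products of factors \<open>1 - \<lambda>(a Tr g)\<close>, the sum over all \<open>a\<close> picks out the zero-sum subsets. So
  no knowledge of the dual code is needed. On the other side \<open>w(a)\<close> is an affine function of a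
  Kloosterman sum, and \<open>K\<^sup>2 = K\<^sub>2 + q\<close>.

  The product over \<open>|\<tau>| < 2 sqrt q\<close> requires the Weil bound, which is proved by a variant of
  Manin's argument for the curve \<open>y\<^sup>2 + x y = x\<^sup>3 + b\<^sup>2\<close> over \<open>F\<^sub>q(T)\<close>: the abscissae of
  \<open>Frobenius + n (T, y)\<close> are obtained from each other by Vieta jumping in the relation \<open>add_rel\<close>, their
  heights satisfy \<open>h (n + 1) + h (n - 1) = 2 h n + 2\<close>, and hence \<open>h n = n\<^sup>2 - K n + q\<close> is nonnegative for all integers \<open>n\<close>.
\<close>

section \<open>Finite fields of characteristic two\<close>

text \<open>In the coordinate \<open>w = (y + b) / x\<close> the curve becomes the Artin-Schreier
  curve \<open>w^2 + w = x + b / x\<close>. This is why Kloosterman sums count its points and why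
  the trace of \<open>x + b / x\<close> reappears as a polynomial in the first height. No points and
  no group law are formalised: an abscissa is a pair of coprime polynomials, and
  \<open>x(P + Q)\<close> and \<open>x(P - Q)\<close> enter only as the two roots of one quadratic,
  so that passing from one to the other is a factorisation. Negative \<open>n\<close> come from
  swapping the two starting fractions. Nonnegativity at integers is enough for the strict bound
  because \<open>K\<close> is odd and two consecutive integers rarely multiply to a power of two. On
  the matrix side both cases have one shape: the number of elements with trace \<beta> is
  \<open>A / q * (B + q * \<kappa> \<beta> - c)\<close>, where \<open>c\<close> is the sum of
  \<kappa> over the field. So the total is \<open>A * B\<close>, and the Fourier transform of
  \<kappa> is, up to a constant, the Kloosterman sum of the recursion. The block size
  \<open>s\<close> is even in both cases, which is what gives invertible alternating blocks to
  count.\<close>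

lemma even_card_involution:
  assumes "finite S" "\<And>x. x \<in> S \<Longrightarrow> f x \<in> S \<and> f x \<noteq> x \<and> f (f x) = x"
  shows "even (card S)"
  using assms
proof (induction S rule: finite_psubset_induct)
  case (psubset S)
  show ?case
  proof (cases "S = {}")
    case False
    then obtain x where x: "x \<in> S" by blast
    have fx: "f x \<in> S" "f x \<noteq> x" "f (f x) = x" using psubset.prems[OF x] by auto
    have "even (card (S - {x, f x}))"
    proof (rule psubset.IH)
      show "S - {x, f x} \<subset> S" using x by blast
      fix y assume "y \<in> S - {x, f x}"
      then show "f y \<in> S - {x, f x} \<and> f y \<noteq> y \<and> f (f y) = y"
        using psubset.prems[of y] fx by auto
    qed
    moreover have "card S = card {x, f x} + card (S - {x, f x})"
      using x fx(1) psubset.hyps card_Diff_subset[of "{x, f x}" S] card_mono[of S "{x, f x}"] by simp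
    ultimately show ?thesis using fx(2) by simp
  qed simp
qed

locale char2_field =
  fixes F :: "'a::{finite,field} itself" and r :: nat
  assumes card_F: "CARD('a) = 2 ^ r" and r_pos: "r \<ge> 1"
begin

text \<open>The shift by 1 permutes the field, so it does not change the sum of all elements. Hence
  \<open>CARD('a)\<close>, a power of two, vanishes in the field.\<close>

lemma two_eq_zero: "(2::'a) = 0"
proof -
  have "(\<Sum>x\<in>UNIV. x) = (\<Sum>x\<in>UNIV. x + (1::'a))"
    by (rule sum.reindex_bij_witness[of _ "\<lambda>x. x + 1" "\<lambda>x. x - 1"]) auto
  then have "of_nat (CARD('a)) = (0::'a)" by (simp add: sum.distrib)
  then show ?thesis by (simp add: card_F)
qed

lemma add_self: "x + x = (0::'a)"
  using two_eq_zero mult_2[of x] by simp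

lemma uminus_eq: "- x = (x::'a)"
  using add_self[of x] by (simp add: neg_eq_iff_add_eq_0)

lemma minus_eq: "x - y = x + (y::'a)"
  by (metis uminus_eq diff_conv_add_uminus)

lemma add_eq_0_iff2: "x + y = 0 \<longleftrightarrow> x = (y::'a)"
  by (metis uminus_eq add_eq_0_iff)

lemma add_left_self: "x + (x + y) = (y::'a)"
  by (metis add_self add.assoc add_0)

lemma square_add: "(x + y)\<^sup>2 = x\<^sup>2 + (y::'a)\<^sup>2"
  by (simp add: power2_sum two_eq_zero)

lemma pow2_add: "(x + y) ^ (2 ^ i) = x ^ (2 ^ i) + (y::'a) ^ (2 ^ i)"
  by (induction i) (simp_all add: power_mult square_add mult.commute[of 2])

lemma inj_square: "inj (\<lambda>x::'a. x\<^sup>2)"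
proof (rule injI)
  fix x y :: 'a assume "x\<^sup>2 = y\<^sup>2"
  then have "(x + y)\<^sup>2 = 0" by (simp add: square_add add_self)
  then show "x = y" by (simp add: add_eq_0_iff2)
qed

lemma bij_square: "bij (\<lambda>x::'a. x\<^sup>2)"
  unfolding bij_def using inj_square finite_UNIV_inj_surj[OF _ inj_square] by simp

lemma ex_sqrt: "\<exists>y. y\<^sup>2 = (x::'a)"
  using bij_square by (metis bij_pointE)

text \<open>Multiplication by a nonzero \<open>x\<close> permutes the nonzero elements; comparing
  their products gives \<open>x ^ (CARD('a) - 1) = 1\<close>.\<close>

lemma pow_card: "(x::'a) ^ (2 ^ r) = x"
proof (cases "x = 0")
  case False
  have "(\<Prod>y\<in>UNIV - {0}. y) = (\<Prod>y\<in>UNIV - {0}. x * y)"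
    using False by (intro prod.reindex_bij_witness[of _ "\<lambda>y. x * y" "\<lambda>y. y / x"]) auto
  then have "x ^ (CARD('a) - 1) = 1" by (simp add: prod.distrib)
  then have "x * x ^ (CARD('a) - 1) = x" by simp
  moreover have "x * x ^ (CARD('a) - 1) = x ^ Suc (CARD('a) - 1)" by (simp only: power_Suc)
  moreover have "Suc (CARD('a) - 1) = 2 ^ r" using card_F by simp
  ultimately show ?thesis by metis
qed simp

section \<open>Absolute trace, canonical character and Artin-Schreier equations\<close>

definition tr :: "'a \<Rightarrow> 'a" where "tr = abs_tr r"

definition lam :: "'a \<Rightarrow> int" where "lam = add_char r"

lemma tr_def': "tr x = (\<Sum>i<r. x ^ (2 ^ i))"
  by (simp add: tr_def abs_tr_def)

lemma tr_add: "tr (x + y) = tr x + tr y"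
  by (simp add: tr_def' pow2_add sum.distrib)

lemma tr_0 [simp]: "tr 0 = 0"
  by (simp add: tr_def' power_0_left)

lemma tr_power2: "tr x ^ 2 = tr (x\<^sup>2)"
proof -
  have "(\<Sum>i<m. x ^ (2 ^ i)) ^ 2 = (\<Sum>i<m. (x\<^sup>2) ^ (2 ^ i))" for m
    by (induction m) (simp_all add: square_add flip: power_mult, simp add: mult.commute)
  then show ?thesis by (simp add: tr_def')
qed

lemma tr_square: "tr (x\<^sup>2) = tr x"
proof -
  obtain m where m: "r = Suc m" using r_pos by (cases r) auto
  have "tr (x\<^sup>2) = (\<Sum>i<r. x ^ (2 ^ Suc i))"
    by (simp add: tr_def' flip: power_mult)
  also have "\<dots> = (\<Sum>i<m. x ^ (2 ^ Suc i)) + x ^ (2 ^ r)"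
    by (simp add: m)
  also have "\<dots> = x ^ (2 ^ 0) + (\<Sum>i<m. x ^ (2 ^ Suc i))"
    by (simp add: pow_card)
  also have "\<dots> = tr x"
    unfolding tr_def' by (simp only: m sum.lessThan_Suc_shift)
  finally show ?thesis .
qed

lemma tr_cases: "tr x = 0 \<or> tr x = 1"
proof -
  have "tr x * (tr x - 1) = 0"
    using tr_power2[of x] tr_square[of x] by (simp add: power2_eq_square algebra_simps)
  then show ?thesis by auto
qed

text \<open>The trace is a polynomial function of degree at most half the field size, so it has too
  few roots to vanish identically. This is the only source of an element of trace 1.\<close>

lemma card_tr_kernel: "card {x. tr x = 0} \<le> 2 ^ (r - 1)"
proof -
  define p :: "'a poly" where "p = (\<Sum>i<r. monom 1 (2 ^ i))"
  have poly_p: "poly p x = tr x" for x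
    by (simp add: p_def tr_def' poly_sum poly_monom)
  \<comment> \<open>The linear coefficient shows that \<open>p\<close> is not the zero polynomial;
    it comes from \<open>i = 0\<close> alone.\<close>
  have "coeff p 1 = (\<Sum>i<r. if i = 0 then 1 else 0)"
    unfolding p_def coeff_sum by (intro sum.cong) auto
  then have "coeff p 1 = 1" using r_pos by simp
  then have "p \<noteq> 0" by auto
  have "degree p \<le> 2 ^ (r - 1)"
    unfolding p_def by (intro degree_sum_le)
      (auto intro!: order.trans[OF degree_monom_le] power_increasing)
  moreover have "card {x. poly p x = 0} \<le> degree p"
    by (rule card_poly_roots_bound) fact
  ultimately show ?thesis by (simp add: poly_p)
qed

lemma card_eq: "CARD('a) = 2 * 2 ^ (r - 1)"
  using card_F r_pos by (metis Suc_diff_1 less_eq_Suc_le One_nat_def power_Suc)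

lemma ex_tr_1: "\<exists>x. tr x = 1"
proof (rule ccontr)
  assume "\<nexists>x. tr x = 1"
  then have "{x. tr x = 0} = UNIV" using tr_cases by auto
  then show False using card_tr_kernel card_eq by simp
qed

lemma lam_eq: "lam x = (if tr x = 0 then 1 else -1)"
  by (simp add: lam_def add_char_def tr_def)

lemma lam_cases: "lam x = 1 \<or> lam x = -1"
  by (simp add: lam_eq)

lemma lam_add: "lam (x + y) = lam x * lam y"
  using tr_cases[of x] tr_cases[of y] by (auto simp: lam_eq tr_add add_self)

lemma lam_0 [simp]: "lam 0 = 1"
  by (simp add: lam_eq)

lemma lam_square: "lam (x\<^sup>2) = lam x"
  by (simp add: lam_eq tr_square)

lemma lam_sum: "lam (\<Sum>i\<in>I. f i) = (\<Prod>i\<in>I. lam (f i))"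
  by (induction I rule: infinite_finite_induct) (auto simp: lam_add)

lemma sum_lam: "(\<Sum>x\<in>UNIV. lam x) = 0"
proof -
  obtain z where "tr z = 1" using ex_tr_1 by blast
  then obtain y where y: "lam y = -1" using lam_eq[of z] by auto
  have "(\<Sum>x\<in>UNIV. lam x) = (\<Sum>x\<in>UNIV. lam (x + y))"
    by (rule sum.reindex_bij_witness[of _ "\<lambda>x. x + y" "\<lambda>x. x - y"]) auto
  also have "\<dots> = - (\<Sum>x\<in>UNIV. lam x)"
    by (simp add: lam_add y sum_negf)
  finally show ?thesis by simp
qed

lemma sum_lam_mult: "(\<Sum>x\<in>UNIV. lam (a * x)) = (if a = 0 then int CARD('a) else 0)"
proof (cases "a = 0")
  case False
  then have "(\<Sum>x\<in>UNIV. lam (a * x)) = (\<Sum>x\<in>UNIV. lam x)"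
    by (intro sum.reindex_bij_witness[of _ "\<lambda>x. x / a" "\<lambda>x. a * x"]) auto
  then show ?thesis using False by (simp add: sum_lam)
qed simp

lemma sum_lam_nonzero: "(\<Sum>x\<in>UNIV - {0}. lam x) = -1"
  using sum_lam by (simp add: sum_diff1)

lemma card_tr_kernel_eq: "card {x. tr x = 0} = 2 ^ (r - 1)"
proof -
  have "{x. tr x = 0} \<inter> {x. lam x = -1} = {}" "{x. tr x = 0} \<union> {x. lam x = -1} = UNIV"
    by (auto simp: lam_eq)
  then have "card {x. tr x = 0} + card {x. lam x = -1} = CARD('a)"
    by (metis card_Un_disjoint finite)
  moreover have "(\<Sum>x\<in>UNIV. lam x) = int (card {x. tr x = 0}) - int (card {x. lam x = -1})"
    by (simp add: lam_eq sum.If_cases Collect_neg_eq[symmetric])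
  ultimately show ?thesis using sum_lam card_eq by simp
qed

lemma artin_schreier_zero: "y\<^sup>2 + y = 0 \<longleftrightarrow> y = 0 \<or> y = (1::'a)"
proof -
  have "y\<^sup>2 + y = y * (y + 1)" by (simp add: power2_eq_square algebra_simps)
  then show ?thesis by (simp add: add_eq_0_iff2)
qed

lemma artin_schreier_eq: "y\<^sup>2 + y = z\<^sup>2 + z \<longleftrightarrow> y = z \<or> y = z + (1::'a)"
proof -
  have "y\<^sup>2 + y = z\<^sup>2 + z \<longleftrightarrow> (y\<^sup>2 + y) + (z\<^sup>2 + z) = 0"
    by (simp add: add_eq_0_iff2)
  also have "(y\<^sup>2 + y) + (z\<^sup>2 + z) = (y + z)\<^sup>2 + (y + z)"
    by (simp add: square_add algebra_simps)
  also have "\<dots> = 0 \<longleftrightarrow> y + z = 0 \<or> y + z = 1" by (rule artin_schreier_zero)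
  also have "\<dots> \<longleftrightarrow> y = z \<or> y = z + 1"
    by (metis add_eq_0_iff2 add_left_self add.commute)
  finally show ?thesis .
qed

lemma artin_schreier_fibre: "card {y. y\<^sup>2 + y = w\<^sup>2 + (w::'a)} = 2"
proof -
  have "{y. y\<^sup>2 + y = w\<^sup>2 + w} = {w, w + 1}"
    by (auto simp: artin_schreier_eq)
  then show ?thesis by simp
qed

text \<open>Additive Hilbert 90 by counting: \<open>y^2 + y\<close> is two-to-one, so its range has
  half the size of the field, which is also the size of the trace kernel that contains it.\<close>

lemma artin_schreier_range: "range (\<lambda>y::'a. y\<^sup>2 + y) = {x. tr x = 0}"
proof (rule card_subset_eq)
  show sub: "range (\<lambda>y::'a. y\<^sup>2 + y) \<subseteq> {x. tr x = 0}"
    by (auto simp: tr_add tr_square add_self)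
  have "CARD('a) = (\<Sum>x\<in>range (\<lambda>y::'a. y\<^sup>2 + y). card {y. y\<^sup>2 + y = x})"
    by (subst card_UN_disjoint[symmetric]) (auto intro: arg_cong[of _ _ card])
  also have "\<dots> = (\<Sum>x\<in>range (\<lambda>y::'a. y\<^sup>2 + y). 2)"
    by (intro sum.cong) (auto simp: artin_schreier_fibre)
  finally have "2 * card (range (\<lambda>y::'a. y\<^sup>2 + y)) = CARD('a)" by simp
  then show "card (range (\<lambda>y::'a. y\<^sup>2 + y)) = card {x. tr x = 0}"
    by (simp add: card_tr_kernel_eq card_eq)
qed simp

lemma card_artin_schreier: "int (card {y. y\<^sup>2 + y = x}) = 1 + lam x"
proof (cases "tr x = 0")
  case True
  then obtain w where "x = w\<^sup>2 + w" using artin_schreier_range by (metis (mono_tags) imageE mem_Collect_eq)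
  with True show ?thesis by (simp add: artin_schreier_fibre lam_eq)
next
  case False
  then have "{y. y\<^sup>2 + y = x} = {}" using artin_schreier_range by auto
  with False show ?thesis by (simp add: lam_eq)
qed

text \<open>The substitution \<open>x = t * y\<close> reduces to the Artin-Schreier equation with
  right-hand side \<open>d / t^2\<close>. All later passages from counting solutions to the
  character go through this.\<close>

lemma card_quadratic:
  assumes "t \<noteq> (0::'a)"
  shows "int (card {x. x\<^sup>2 + t * x = d}) = 1 + lam (d / t\<^sup>2)"
proof -
  have "bij_betw (\<lambda>y. t * y) {y. y\<^sup>2 + y = d / t\<^sup>2} {x. x\<^sup>2 + t * x = d}"
  proof (rule bij_betw_byWitness[of _ "\<lambda>x. x / t"])
    have eq: "(t * y)\<^sup>2 + t * (t * y) = (y\<^sup>2 + y) * t\<^sup>2" for y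
      by (simp add: power2_eq_square algebra_simps)
    then show "(\<lambda>y. t * y) ` {y. y\<^sup>2 + y = d / t\<^sup>2} \<subseteq> {x. x\<^sup>2 + t * x = d}"
      using assms by auto
    show "(\<lambda>x. x / t) ` {x. x\<^sup>2 + t * x = d} \<subseteq> {y. y\<^sup>2 + y = d / t\<^sup>2}"
      using assms eq[of "x / t" for x] by (auto simp: eq_divide_eq)
  qed (use assms in auto)
  from bij_betw_same_card[OF this] show ?thesis using card_artin_schreier[of "d / t\<^sup>2"] by simp
qed

lemma card_square_root: "card {x. x\<^sup>2 = (d::'a)} = 1"
proof -
  obtain y where "y\<^sup>2 = d" using ex_sqrt by blast
  then have "{x. x\<^sup>2 = d} = {y}" using inj_square by (auto simp: inj_def)
  then show ?thesis by simp
qed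

section \<open>Identities and congruences for Kloosterman sums\<close>

lemma Kloost_eq: "Kloost r a = (\<Sum>x\<in>UNIV - {0}. lam (x + a * inverse x))"
  by (simp add: Kloost_def lam_def)

lemma Kloost2_eq: "Kloost2 r a = (\<Sum>x\<in>UNIV - {0}. \<Sum>y\<in>UNIV - {0}. lam (x + y + a * inverse x * inverse y))"
  by (simp add: Kloost2_def lam_def)

lemma Kloost_scale:
  assumes "c \<noteq> 0"
  shows "(\<Sum>x\<in>UNIV - {0}. lam (c * x + b * inverse x)) = Kloost r (b * c)"
  unfolding Kloost_eq using assms
  by (intro sum.reindex_bij_witness[of _ "\<lambda>x. x / c" "\<lambda>x. c * x"]) (auto simp: field_simps)

lemma sum_square: "(\<Sum>x\<in>UNIV - {0}. f (x\<^sup>2)) = (\<Sum>x\<in>UNIV - {0::'a}. f x)"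
proof (rule sum.reindex_bij_betw)
  show "bij_betw (\<lambda>x. x\<^sup>2) (UNIV - {0}) (UNIV - {0::'a})"
    using bij_square bij_betw_DiffI[of "\<lambda>x. x\<^sup>2" UNIV UNIV "{0::'a}" "{0}"] by auto
qed

text \<open>The character is Frobenius invariant and squaring permutes the nonzero elements. This
  later turns parameters that come out as squares, such as the square of
  \<open>inverse \<beta>\<close>, into the parameters of the theorem.\<close>

lemma Kloost_square: "Kloost r (a\<^sup>2) = Kloost r (a::'a)"
proof -
  have "Kloost r (a\<^sup>2) = (\<Sum>x\<in>UNIV - {0}. lam (x\<^sup>2 + a\<^sup>2 * inverse (x\<^sup>2)))"
    unfolding Kloost_eq by (rule sum_square[symmetric])
  also have "\<dots> = (\<Sum>x\<in>UNIV - {0}. lam ((x + a * inverse x)\<^sup>2))"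
    by (simp add: square_add power_mult_distrib power_inverse)
  finally show ?thesis by (simp add: lam_square Kloost_eq)
qed

lemma Kloost_at_0: "Kloost r (0::'a) = -1"
  by (simp add: Kloost_eq sum_lam_nonzero)

lemma lam_scaled_Kloost:
  assumes "b \<noteq> 0"
  shows "(\<Sum>x\<in>UNIV - {0}. lam (b * (x + inverse x))) = Kloost r (b::'a)"
proof -
  have "(\<Sum>x\<in>UNIV - {0}. lam (b * (x + inverse x))) = (\<Sum>x\<in>UNIV - {0}. lam (b * x + b * inverse x))"
    by (simp add: distrib_left)
  also have "\<dots> = Kloost r (b * b)" by (rule Kloost_scale[OF assms])
  finally show ?thesis using Kloost_square[of b] by (simp add: power2_eq_square)
qed

text \<open>Substituting \<open>y = x * u\<close> in the double sum leaves, for each fixed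
  \<open>u\<close>, a Kloosterman sum with parameter \<open>a * (1 + u) * (1 + 1/u)\<close>, which
  is \<open>a * (u + 1/u)\<close> in characteristic 2. Summing these over \<open>u\<close> after
  opening the sum again gives \<open>K_2\<close>.\<close>

lemma Kloost_sq_eq_Kloost2:
  assumes a: "a \<noteq> (0::'a)"
  shows "Kloost r a ^ 2 = Kloost2 r a + int CARD('a)"
proof -
  let ?U = "UNIV - {0::'a}"
  have "Kloost r a ^ 2 = (\<Sum>x\<in>?U. \<Sum>y\<in>?U. lam (x + a * inverse x + (y + a * inverse y)))"
    by (simp add: Kloost_eq power2_eq_square sum_product lam_add)
  also have "\<dots> = (\<Sum>x\<in>?U. \<Sum>u\<in>?U. lam (x * (1 + u) + a * inverse x * (1 + inverse u)))"
  proof (rule sum.cong[OF refl])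
    fix x assume "x \<in> ?U"
    then have "(\<Sum>y\<in>?U. lam (x + a * inverse x + (y + a * inverse y))) =
        (\<Sum>u\<in>?U. lam (x + a * inverse x + (x * u + a * inverse (x * u))))"
      by (intro sum.reindex_bij_witness[of _ "\<lambda>u. x * u" "\<lambda>y. y / x"]) auto
    then show "(\<Sum>y\<in>?U. lam (x + a * inverse x + (y + a * inverse y))) =
        (\<Sum>u\<in>?U. lam (x * (1 + u) + a * inverse x * (1 + inverse u)))"
      by (simp add: algebra_simps)
  qed
  also have "\<dots> = (\<Sum>u\<in>?U. \<Sum>x\<in>?U. lam ((1 + u) * x + a * (1 + inverse u) * inverse x))"
    by (subst sum.swap) (simp add: algebra_simps)
  also have "\<dots> = (\<Sum>u\<in>?U. Kloost r (a * (u + inverse u)) + (if u = 1 then int CARD('a) else 0))"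
  proof (rule sum.cong[OF refl])
    fix u assume u: "u \<in> ?U"
    show "(\<Sum>x\<in>?U. lam ((1 + u) * x + a * (1 + inverse u) * inverse x)) =
      Kloost r (a * (u + inverse u)) + (if u = 1 then int CARD('a) else 0)"
    proof (cases "u = 1")
      \<comment> \<open>For \<open>u = 1\<close> every term is 1 and the sum is
        \<open>q - 1\<close>, while the Kloosterman sum at parameter 0 is -1; the difference is the
        additional \<open>q\<close> of the identity.\<close>
      case True
      then show ?thesis by (simp add: add_self Kloost_at_0 card_Diff_singleton of_nat_diff)
    next
      case False
      then have "1 + u \<noteq> 0" by (simp add: add_eq_0_iff2)
      moreover have "(1 + inverse u) * (1 + u) = u + inverse u"
      proof -
        have "(1 + inverse u) * (1 + u) = u + inverse u + (1 + 1)"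
          using u by (simp add: distrib_left distrib_right add_ac)
        then show ?thesis by (simp only: add_self add_0_right)
      qed
      ultimately show ?thesis using False Kloost_scale[of "1 + u" "a * (1 + inverse u)"]
        by (simp add: mult.assoc)
    qed
  qed
  also have "\<dots> = (\<Sum>u\<in>?U. Kloost r (a * (u + inverse u))) + int CARD('a)"
    by (simp add: sum.distrib)
  also have "(\<Sum>u\<in>?U. Kloost r (a * (u + inverse u))) =
      (\<Sum>u\<in>?U. \<Sum>x\<in>?U. lam (x + a * inverse x * (u + inverse u)))"
    by (simp add: Kloost_eq algebra_simps)
  also have "\<dots> = (\<Sum>x\<in>?U. \<Sum>u\<in>?U. lam (x + a * inverse x * (u + inverse u)))"
    by (rule sum.swap)
  also have "\<dots> = (\<Sum>x\<in>?U. lam x * (\<Sum>u\<in>?U. lam (a * inverse x * (u + inverse u))))"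
    by (simp add: lam_add sum_distrib_left)
  also have "\<dots> = (\<Sum>x\<in>?U. lam x * Kloost r (a * inverse x))"
    using a by (intro sum.cong) (auto simp: lam_scaled_Kloost)
  also have "\<dots> = Kloost2 r a"
    by (simp add: Kloost_eq Kloost2_eq sum_distrib_left add.assoc flip: lam_add)
  finally show ?thesis .
qed

text \<open>The involution sending \<open>x\<close> to \<open>a / x\<close> preserves the argument
  of the character, and at a fixed point that argument is \<open>x + x = 0\<close>. So the terms
  equal to -1 pair up, and \<open>K = q - 1 - 2 * card (N (-1))\<close> with
  \<open>4 dvd q\<close>.\<close>

lemma Kloost_mod_4:
  assumes a: "a \<noteq> (0::'a)" and r: "r \<ge> 2"
  shows "[Kloost r a = -1] (mod 4)"
proof -
  define N where "N e = {x. x \<noteq> 0 \<and> lam (x + a * inverse x) = e}" for e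
  have "Kloost r a = int (card (N 1)) - int (card (N (-1)))"
  proof -
    have "Kloost r a = (\<Sum>x\<in>UNIV - {0}. if lam (x + a * inverse x) = 1 then 1 else -1)"
      unfolding Kloost_eq using lam_cases by (intro sum.cong) auto
    also have "\<dots> = int (card (N 1)) - int (card (N (-1)))"
    proof -
      have "(UNIV - {0}) \<inter> {x. lam (x + a * inverse x) = 1} = N 1"
        "(UNIV - {0}) \<inter> - {x. lam (x + a * inverse x) = 1} = N (-1)"
        using lam_cases by (auto simp: N_def)
      then show ?thesis by (simp add: sum.If_cases)
    qed
    finally show ?thesis .
  qed
  moreover have "card (N 1) + card (N (-1)) = CARD('a) - 1"
  proof -
    have "N 1 \<inter> N (-1) = {}" "N 1 \<union> N (-1) = UNIV - {0}"
      using lam_cases by (auto simp: N_def)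
    then show ?thesis by (metis card_Un_disjoint finite card_Diff_singleton UNIV_I)
  qed
  moreover have "even (card (N (-1)))"
  proof -
    have "\<And>x. x \<in> N (-1) \<Longrightarrow> a * inverse x \<in> N (-1) \<and> a * inverse x \<noteq> x \<and> a * inverse (a * inverse x) = x"
    proof -
      fix x assume x: "x \<in> N (-1)"
      then have x0: "x \<noteq> 0" by (simp add: N_def)
      have "a * inverse x \<noteq> x"
      proof
        assume "a * inverse x = x"
        then have "x + a * inverse x = 0" by (simp add: add_self)
        then show False using x by (simp add: N_def)
      qed
      moreover have "a * inverse (a * inverse x) = x" using x0 a by simp
      ultimately show "a * inverse x \<in> N (-1) \<and> a * inverse x \<noteq> x \<and> a * inverse (a * inverse x) = x"
        using x x0 a by (simp add: N_def add.commute del: inverse_mult_distrib)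
    qed
    then show ?thesis by (intro even_card_involution[of _ "\<lambda>x. a * inverse x"]) auto
  qed
  moreover have "4 dvd CARD('a)"
    unfolding card_F using le_imp_power_dvd[OF r, of "2::nat"] by simp
  moreover have "CARD('a) > 0" by simp
  ultimately have "\<exists>m k. int (card (N 1)) + 2 * k + 1 = 4 * m \<and> Kloost r a = int (card (N 1)) - 2 * k"
  proof (elim evenE dvdE)
    fix k m
    assume "Kloost r a = int (card (N 1)) - int (card (N (-1)))"
      and "card (N 1) + card (N (-1)) = CARD('a) - 1" "card (N (-1)) = 2 * k" "CARD('a) = 4 * m" "CARD('a) > 0"
    then show ?thesis by (intro exI[of _ "int k"] exI[of _ "int m"]) linarith
  qed
  then obtain m k where "int (card (N 1)) + 2 * k + 1 = 4 * m" "Kloost r a = int (card (N 1)) - 2 * k"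
    by blast
  then have "Kloost r a - (-1) = 4 * (m - k)" by (simp add: algebra_simps)
  then show ?thesis unfolding cong_iff_dvd_diff by (metis dvd_triv_left)
qed

end

section \<open>The Weil bound for Kloosterman sums\<close>

text \<open>The identity is kept as the definition because its two uses, cancelling a factor in a
  divisibility and excluding a common prime, read off it directly. It also rules out the pair (0,
  0), so a coprime pair is a point of the projective line over the rational functions.\<close>

definition bezout_coprime :: "'a::field poly \<Rightarrow> 'a poly \<Rightarrow> bool" where
  "bezout_coprime p q \<longleftrightarrow> (\<exists>u v. u * p + v * q = 1)"

lemma ex_irreducible_dvd:
  fixes p :: "'a::field poly"
  assumes "degree p > 0"
  shows "\<exists>s. irreducible s \<and> s dvd p"
  using assms
proof (induction "degree p" arbitrary: p rule: less_induct)
  case less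
  show ?case
  proof (cases "irreducible p")
    case False
    have "p \<noteq> 0" using less.prems by auto
    moreover have "\<not> is_unit p" using less.prems is_unit_iff_degree[OF \<open>p \<noteq> 0\<close>] by simp
    moreover note False
    ultimately obtain a b where ab: "p = a * b" "\<not> is_unit a" "\<not> is_unit b"
      by (auto simp: irreducible_def)
    with \<open>p \<noteq> 0\<close> have "a \<noteq> 0" "b \<noteq> 0" by auto
    with ab have "degree a > 0" "degree b > 0" by (auto simp: is_unit_iff_degree)
    moreover have "degree p = degree a + degree b"
      using ab \<open>a \<noteq> 0\<close> \<open>b \<noteq> 0\<close> by (simp add: degree_mult_eq)
    ultimately obtain s where "irreducible s" "s dvd a" using less.hyps[of a] by auto
    then show ?thesis using ab by auto
  qed auto
qed

lemma ex_bezout: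
  fixes p q :: "'a::field poly"
  shows "\<exists>d u v. d dvd p \<and> d dvd q \<and> d = u * p + v * q"
\<comment> \<open>The case split in the measure separates \<open>q = 0\<close> from nonzero
  constants, which have the same degree 0.\<close>
proof (induction "if q = 0 then 0 else Suc (degree q)" arbitrary: p q rule: less_induct)
  case less
  show ?case
  proof (cases "q = 0")
    case True
    then show ?thesis by (intro exI[of _ p] exI[of _ 1]) auto
  next
    case False
    have "\<exists>d u v. d dvd q \<and> d dvd (p mod q) \<and> d = u * q + v * (p mod q)"
      using False degree_mod_less[of q p] by (intro less.hyps) auto
    then obtain d u v where d: "d dvd q" "d dvd (p mod q)" "d = u * q + v * (p mod q)" by blast
    then have "d dvd p" using dvd_mod_iff by blast
    moreover have "d = v * p + (u - v * (p div q)) * q"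
      unfolding d(3) minus_div_mult_eq_mod[symmetric] by (simp add: algebra_simps)
    ultimately show ?thesis using d(1) by blast
  qed
qed

lemma not_bezout_coprimeD:
  fixes p q :: "'a::field poly"
  assumes "\<not> bezout_coprime p q"
  shows "\<exists>s. prime_elem s \<and> s dvd p \<and> s dvd q"
proof -
  obtain d u v where d: "d dvd p" "d dvd q" "d = u * p + v * q" using ex_bezout by blast
  have "\<not> is_unit d"
  proof
    assume "is_unit d"
    then obtain e where "e * (u * p + v * q) = 1" using d(3) by (metis dvdE mult.commute)
    then have "(e * u) * p + (e * v) * q = 1" by (simp add: algebra_simps)
    then show False using assms by (auto simp: bezout_coprime_def)
  qed
  then have "\<exists>s. irreducible s \<and> s dvd d"
  proof (cases "d = 0")
    \<comment> \<open>Here both polynomials vanish, so every prime is a common divisor; the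
      indeterminate is taken.\<close>
    case True
    then show ?thesis using irreducible_linear_field_poly[of 1 "0::'a"] by auto
  next
    case False
    with \<open>\<not> is_unit d\<close> show ?thesis by (intro ex_irreducible_dvd) (simp add: is_unit_iff_degree)
  qed
  then show ?thesis using d field_poly_irreducible_imp_prime dvd_trans by blast
qed

lemma bezout_coprime_dvd_mult:
  assumes "bezout_coprime p q" "p dvd q * s"
  shows "p dvd s"
proof -
  obtain u v where uv: "u * p + v * q = 1" using assms by (auto simp: bezout_coprime_def)
  have "s = s * (u * p + v * q)" by (simp add: uv)
  also have "\<dots> = (s * u) * p + v * (q * s)" by (simp add: algebra_simps)
  finally have s: "s = (s * u) * p + v * (q * s)" .
  show ?thesis by (subst s, rule dvd_add) (use assms(2) in simp_all)
qed

lemma bezout_coprime_commute: "bezout_coprime p q \<longleftrightarrow> bezout_coprime q p"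
  unfolding bezout_coprime_def by (metis add.commute)

lemma bezout_coprime_not_prime:
  assumes "bezout_coprime p q" "prime_elem s" "s dvd p" "s dvd q"
  shows False
proof -
  obtain u v where "u * p + v * q = 1" using assms by (auto simp: bezout_coprime_def)
  moreover have "s dvd u * p + v * q" using assms by simp
  ultimately have "s dvd 1" by simp
  then show False using assms by (simp add: prime_elem_def)
qed

lemma prod_linear_dvd:
  fixes p :: "'a::field poly"
  assumes "finite S" "\<And>x. x \<in> S \<Longrightarrow> poly p x = 0"
  shows "(\<Prod>x\<in>S. [:- x, 1:]) dvd p"
  using assms
proof (induction S rule: finite_induct)
  case (insert x S)
  then obtain w where w: "p = (\<Prod>x\<in>S. [:- x, 1:]) * w" by (metis dvdE insertCI)
  have "poly (\<Prod>x\<in>S. [:- x, 1:]) x \<noteq> 0" using insert.hyps by (auto simp: poly_prod)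
  moreover have "poly p x = 0" using insert.prems by auto
  ultimately have "[:- x, 1:] dvd w" by (simp add: w poly_eq_0_iff_dvd)
  then have "[:- x, 1:] * (\<Prod>x\<in>S. [:- x, 1:]) dvd w * (\<Prod>x\<in>S. [:- x, 1:])"
    by (rule mult_dvd_mono) simp
  then show ?case unfolding w prod.insert[OF insert.hyps] by (simp only: mult.commute)
qed simp

lemma lead_coeff_prod_linear: "lead_coeff (\<Prod>x\<in>S. [:- x, 1::'a::field:]) = 1"
  by (simp add: lead_coeff_prod)

lemma degree_prod_linear: "degree (\<Prod>x\<in>S. [:- x, 1::'a::field:]) = card S"
  by (subst degree_prod_eq_sum_degree) auto

lemma prime_elem_dvd_linear:
  fixes s :: "'a::field poly"
  assumes "prime_elem s" "s dvd [:- x, 1:]"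
  shows "poly s x = 0"
proof (rule ccontr)
  assume s: "poly s x \<noteq> 0"
  obtain c where c: "[:- x, 1:] = s * c" using assms by (auto elim: dvdE)
  then have "poly (s * c) x = 0" by (metis poly_eq_0_iff_dvd dvd_refl)
  then have "[:- x, 1:] dvd c" using s by (simp add: poly_eq_0_iff_dvd)
  then obtain e where "c = [:- x, 1:] * e" by (auto elim: dvdE)
  then have "[:- x, 1:] * 1 = [:- x, 1:] * (s * e)" using c by (simp only: mult.left_commute mult_1_right)
  then have "1 = s * e" by (subst (asm) mult_cancel_left) auto
  then show False using assms(1) by (metis dvd_triv_left prime_elem_def)
qed

lemma prime_elem_dvd_prod:
  assumes "prime_elem s" "s dvd (\<Prod>x\<in>S. f x)"
  shows "\<exists>x\<in>S. s dvd f x"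
  using assms(2)
proof (induction S rule: infinite_finite_induct)
  case (insert x S)
  then show ?case using prime_elem_dvd_multD[OF assms(1)] by auto
qed (use assms(1) in \<open>auto simp: prime_elem_def\<close>)

text \<open>Degree bounds instead of exact degrees: in a fraction whose height is \<open>m\<close>
  one of numerator and denominator may have smaller degree, and then its coefficient at
  \<open>m\<close> is simply 0.\<close>

lemma coeff_mult_bounded:
  fixes p q :: "'a::idom poly"
  assumes "degree p \<le> m" "degree q \<le> n"
  shows "coeff (p * q) (m + n) = coeff p m * coeff q n"
proof (cases "degree p = m \<and> degree q = n")
  case True
  then show ?thesis using coeff_mult_degree_sum by blast
next
  case False
  then have "coeff p m = 0 \<or> coeff q n = 0"
    using assms by (metis coeff_eq_0 le_neq_implies_less)
  moreover have "degree (p * q) < m + n"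
    using False assms degree_mult_le[of p q] by linarith
  ultimately show ?thesis by (auto simp: coeff_eq_0)
qed

text \<open>For coprime arguments this is the degree of the rational function \<open>p / q\<close>,
  that is, its naive height over the rational function field.\<close>

definition height :: "'a::zero poly \<Rightarrow> 'a poly \<Rightarrow> nat" where
  "height p q = max (degree p) (degree q)"

lemma degree_le_height: "degree p \<le> height p q" "degree q \<le> height p q"
  by (simp_all add: height_def)

lemma coeff_height:
  assumes "p \<noteq> 0 \<or> q \<noteq> 0"
  shows "coeff p (height p q) \<noteq> 0 \<or> coeff q (height p q) \<noteq> 0"
proof (cases "degree q \<le> degree p")
  case True
  then show ?thesis using assms leading_coeff_0_iff[of q]
    by (cases "p = 0") (auto simp: height_def max_def)
next
  case False
  then show ?thesis using leading_coeff_0_iff[of q]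
    by (cases "q = 0") (auto simp: height_def max_def)
qed

lemma bezout_coprime_nonzero: "bezout_coprime p q \<Longrightarrow> p \<noteq> 0 \<or> q \<noteq> 0"
  by (auto simp: bezout_coprime_def)

section \<open>Vieta jumping on abscissae and the growth of their heights\<close>

context char2_field
begin

lemma poly_two_eq_zero: "(2::'a poly) = 0"
  by (simp add: numeral_poly two_eq_zero)

lemma poly_add_self: "p + p = (0::'a poly)"
  using poly_two_eq_zero mult_2[of p] by simp

lemma poly_add_eq_0_iff: "p + p' = 0 \<longleftrightarrow> p = (p'::'a poly)"
  by (metis poly_add_self add_left_cancel)

lemma poly_square_add: "(p + p')\<^sup>2 = p\<^sup>2 + (p'::'a poly)\<^sup>2"
  by (simp add: power2_sum poly_two_eq_zero)

text \<open>
  The abscissae $x_1, x_2$ of two points of $y^2 + xy = x^3 + b^2$ and $x_3$ of their sum or difference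
  satisfy an equation that is symmetric in $x_1, x_2, x_3$. Here $x_1 = p/q$, $x_3 = p'/q'$ and $x_2 = T$.
\<close>

definition add_rel :: "'a \<Rightarrow> 'a poly \<Rightarrow> 'a poly \<Rightarrow> 'a poly \<Rightarrow> 'a poly \<Rightarrow> bool" where
  "add_rel b p q p' q' \<longleftrightarrow>
     (p\<^sup>2 + [:0, 1:]\<^sup>2 * q\<^sup>2) * p'\<^sup>2 + [:0, 1:] * p * q * p' * q'
       + ([:0, 1:]\<^sup>2 * p\<^sup>2 + [:b:]\<^sup>2 * q\<^sup>2) * q'\<^sup>2 = 0"

lemma add_rel_commute: "add_rel b p q p' q' \<longleftrightarrow> add_rel b p' q' p q"
  unfolding add_rel_def by (simp add: algebra_simps)

text \<open>A form of Gauss's lemma: a quadratic with root \<open>p / q\<close> in lowest terms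
  splits as \<open>(q X + p) (q' X + p')\<close> with polynomial coefficients, signs being
  irrelevant. The second root is then \<open>p' / q'\<close>, with no denominators
  introduced.\<close>

lemma split_quadratic:
  fixes p q c0 c1 c2 :: "'a poly"
  assumes "bezout_coprime p q" "c2 * p\<^sup>2 + c1 * p * q + c0 * q\<^sup>2 = 0"
  shows "\<exists>p' q'. c2 = q * q' \<and> c1 = q * p' + p * q' \<and> c0 = p * p'"
proof -
  have pq: "p \<noteq> 0 \<or> q \<noteq> 0" using assms(1) by (rule bezout_coprime_nonzero)
  have unit: "\<exists>e. e * p = 1" if "q = 0"
    using assms(1) that by (auto simp: bezout_coprime_def)
  have unit': "\<exists>e. e * q = 1" if "p = 0"
    using assms(1) that by (auto simp: bezout_coprime_def)
  \<comment> \<open>The roots infinity and 0 are treated apart: there the other entry is a unit and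
    the cofactor is written down, whereas the general argument divides by both \<open>p\<close> and
    \<open>q\<close>.\<close>
  consider "q = 0" | "p = 0" | "p \<noteq> 0" "q \<noteq> 0" by blast
  then show ?thesis
  proof cases
    case 1
    then obtain e where e: "e * p = 1" using unit by blast
    then have "c2 = 0" using assms(2) 1 by auto
    then show ?thesis using e 1
      by (intro exI[of _ "c0 * e"] exI[of _ "c1 * e"]) (auto simp: algebra_simps)
  next
    case 2
    then obtain e where e: "e * q = 1" using unit' by blast
    then have "c0 = 0" using assms(2) 2 by auto
    then show ?thesis using e 2
      by (intro exI[of _ "c1 * e"] exI[of _ "c2 * e"]) (auto simp: algebra_simps)
  next
    case 3
    have "p * (p * c2) = q * (- (c1 * p + c0 * q))"
      using assms(2) by (simp add: algebra_simps power2_eq_square eq_neg_iff_add_eq_0)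
    then have "q dvd p * (p * c2)" by (metis dvd_triv_left)
    then have "q dvd c2" using assms(1) bezout_coprime_commute bezout_coprime_dvd_mult by blast
    moreover have "q * (q * c0) = p * (- (c1 * q + c2 * p))"
      using assms(2) by (simp add: algebra_simps power2_eq_square eq_neg_iff_add_eq_0)
    then have "p dvd q * (q * c0)" by (metis dvd_triv_left)
    then have "p dvd c0" using assms(1) bezout_coprime_dvd_mult by blast
    ultimately obtain q' p' where *: "c2 = q * q'" "c0 = p * p'" by (auto elim!: dvdE)
    then have "p * (q * (c1 + (q * p' + p * q'))) = 0"
      using assms(2) by (simp add: algebra_simps power2_eq_square)
    then have "c1 = q * p' + p * q'" using 3 by (simp add: poly_add_eq_0_iff)
    with * show ?thesis by blast
  qed
qed

text \<open>With \<open>P\<close> the point of abscissa \<open>p1 / q1\<close> and \<open>Q\<close>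
  the point of abscissa \<open>T\<close>, the relation is the quadratic whose roots are
  \<open>x(P + Q)\<close> and \<open>x(P - Q)\<close>. One root \<open>p0 / q0\<close> is known and
  the other one is split off. The height identity is the parallelogram law for a summand
  \<open>Q\<close> of height 1.\<close>

lemma add_rel_step:
  assumes b: "b \<noteq> 0" and c0: "bezout_coprime p0 q0" and c1: "bezout_coprime p1 q1"
    and rel: "add_rel b p0 q0 p1 q1"
  shows "\<exists>p2 q2. bezout_coprime p2 q2 \<and> add_rel b p1 q1 p2 q2
           \<and> height p2 q2 + height p0 q0 = 2 * height p1 q1 + 2"
proof -
  define T :: "'a poly" where "T = [:0, 1:]"
  define B where "B = [:b:]"
  define e2 where "e2 = p1\<^sup>2 + T\<^sup>2 * q1\<^sup>2"
  define e1 where "e1 = T * p1 * q1"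
  define e0 where "e0 = T\<^sup>2 * p1\<^sup>2 + B\<^sup>2 * q1\<^sup>2"
  \<comment> \<open>By symmetry of \<open>add_rel\<close> the known fraction \<open>p0 / q0\<close>
    may be read as a root of the quadratic with coefficients built from
    \<open>p1 / q1\<close>.\<close>
  have "e2 * p0\<^sup>2 + e1 * p0 * q0 + e0 * q0\<^sup>2 = 0"
    using rel add_rel_commute unfolding add_rel_def e2_def e1_def e0_def T_def B_def
    by (simp add: algebra_simps)
  then obtain p2 q2 where e: "e2 = q0 * q2" "e1 = q0 * p2 + p0 * q2" "e0 = p0 * p2"
    using split_quadratic[OF c0] by blast
  have prime_T: "prime_elem T" unfolding T_def using prime_elem_linear_field_poly[of 1 "0::'a"] by simp
  \<comment> \<open>A common prime of \<open>p2\<close> and \<open>q2\<close> would divide all three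
    coefficients \<open>e0\<close>, \<open>e1\<close>, \<open>e2\<close>, and these force it to
    divide both \<open>p1\<close> and \<open>q1\<close>. The constant \<open>b\<close> must be a
    unit for the last step.\<close>
  have "bezout_coprime p2 q2"
  proof (rule ccontr)
    assume "\<not> bezout_coprime p2 q2"
    then obtain s where s: "prime_elem s" "s dvd p2" "s dvd q2" using not_bezout_coprimeD by blast
    then have d: "s dvd e0" "s dvd e1" "s dvd e2" by (simp_all add: e)
    have B_unit: "is_unit (B\<^sup>2)" using b by (simp add: B_def is_unit_power_iff is_unit_const_poly_iff dvd_field_iff)
    have "s dvd p1"
    proof -
      have "s dvd T \<or> s dvd p1 \<or> s dvd q1"
        using d(2) s(1) by (auto simp: e1_def prime_elem_dvd_mult_iff)
      moreover have "s dvd p1" if "s dvd T \<or> s dvd q1"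
      proof -
        have "s dvd T\<^sup>2 * q1\<^sup>2" using that by (auto simp: power2_eq_square)
        then have "s dvd p1\<^sup>2" using d(3) by (simp add: e2_def dvd_add_left_iff)
        then show ?thesis using s(1) prime_elem_dvd_power by blast
      qed
      ultimately show ?thesis by blast
    qed
    moreover have "s dvd q1"
    proof -
      have "s dvd T\<^sup>2 * p1\<^sup>2" using \<open>s dvd p1\<close> by (auto simp: power2_eq_square)
      then have "s dvd B\<^sup>2 * q1\<^sup>2" using d(1) by (simp add: e0_def dvd_add_right_iff)
      then have "s dvd q1\<^sup>2" using B_unit by (simp add: dvd_mult_unit_iff')
      then show ?thesis using s(1) prime_elem_dvd_power by blast
    qed
    ultimately show False using bezout_coprime_not_prime[OF c1 s(1)] by blast
  qed
  moreover have "add_rel b p1 q1 p2 q2"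
  proof -
    have "e2 * p2\<^sup>2 + e1 * p2 * q2 + e0 * q2\<^sup>2 = 2 * (q0 * q2 * p2\<^sup>2 + p0 * p2 * q2\<^sup>2)"
      by (simp add: e algebra_simps power2_eq_square)
    then show ?thesis
      by (simp add: add_rel_def e2_def e1_def e0_def T_def B_def poly_two_eq_zero algebra_simps)
  qed
  \<comment> \<open>The largest degree among \<open>e0\<close>, \<open>e1\<close>, \<open>e2\<close>
    is computed twice. The factorisation gives \<open>?h0 + ?h2\<close>; the definitions give
    \<open>2 * ?h1 + 2\<close>, attained through the terms with \<open>T^2\<close>, which cannot be
    cancelled by the others.\<close>
  moreover have "height p2 q2 + height p0 q0 = 2 * height p1 q1 + 2"
  proof -
    let ?h0 = "height p0 q0" and ?h1 = "height p1 q1" and ?h2 = "height p2 q2"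
    have bound: "degree e \<le> ?h0 + ?h2" if "e \<in> {e0, e1, e2}" for e
      using that unfolding e
      by (auto intro!: degree_add_le degree_mult_le[THEN order.trans] add_mono degree_le_height)
    have nz: "\<exists>e\<in>{e0, e1, e2}. coeff e (?h0 + ?h2) \<noteq> 0"
    proof -
      have "coeff e0 (?h0 + ?h2) = coeff p0 ?h0 * coeff p2 ?h2"
        "coeff e2 (?h0 + ?h2) = coeff q0 ?h0 * coeff q2 ?h2"
        "coeff e1 (?h0 + ?h2) = coeff q0 ?h0 * coeff p2 ?h2 + coeff p0 ?h0 * coeff q2 ?h2"
        unfolding e coeff_add by (subst coeff_mult_bounded; simp add: degree_le_height)+
      then show ?thesis
        using coeff_height[OF bezout_coprime_nonzero[OF c0]]
          coeff_height[OF bezout_coprime_nonzero[OF \<open>bezout_coprime p2 q2\<close>]] by auto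
    qed
    have degT: "degree T = 1" "coeff T 1 = 1" by (simp_all add: T_def)
    have deg2: "degree (p\<^sup>2) \<le> 2 * m" "coeff (p\<^sup>2) (2 * m) = (coeff p m)\<^sup>2" if "degree p \<le> m" for p :: "'a poly" and m
      using that degree_mult_le[of p p] coeff_mult_bounded[of p m p m]
      by (simp_all add: power2_eq_square mult_2)
    have dT2: "degree (T\<^sup>2 * p\<^sup>2) \<le> 2 * m + 2 \<and> coeff (T\<^sup>2 * p\<^sup>2) (2 * m + 2) = (coeff p m)\<^sup>2"
      if "degree p \<le> m" for p :: "'a poly" and m
    proof -
      have "degree (T\<^sup>2) \<le> 2" "coeff (T\<^sup>2) 2 = 1" using deg2[of T 1] degT by simp_all
      moreover have "degree (T\<^sup>2 * p\<^sup>2) \<le> degree (T\<^sup>2) + degree (p\<^sup>2)" by (rule degree_mult_le)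
      ultimately show ?thesis
        using deg2[OF that] coeff_mult_bounded[of "T\<^sup>2" 2 "p\<^sup>2" "2 * m"] by (simp add: add.commute)
    qed
    have p1: "degree p1 \<le> ?h1" and q1: "degree q1 \<le> ?h1" by (rule degree_le_height)+
    have lowB: "degree (B\<^sup>2 * q1\<^sup>2) \<le> 2 * ?h1"
      using degree_mult_le[of "B\<^sup>2" "q1\<^sup>2"] deg2(1)[of B 0] deg2(1)[OF q1] by (simp add: B_def)
    have lowp: "degree (p1\<^sup>2) \<le> 2 * ?h1" using deg2(1)[OF p1] .
    have low1: "degree e1 \<le> 2 * ?h1 + 1"
      unfolding e1_def using degree_mult_le[of "T * p1" q1] degree_mult_le[of T p1] degT p1 q1 by linarith
    have bound': "degree e \<le> 2 * ?h1 + 2" if "e \<in> {e0, e1, e2}" for e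
      using that dT2[OF p1] dT2[OF q1] lowB lowp low1 unfolding e0_def e2_def
      by (auto intro!: degree_add_le)
    have nz': "\<exists>e\<in>{e0, e1, e2}. coeff e (2 * ?h1 + 2) \<noteq> 0"
    proof -
      have "coeff (B\<^sup>2 * q1\<^sup>2) (2 * ?h1 + 2) = 0" "coeff (p1\<^sup>2) (2 * ?h1 + 2) = 0"
        using lowB lowp by (auto intro!: coeff_eq_0)
      then have "coeff e0 (2 * ?h1 + 2) = (coeff p1 ?h1)\<^sup>2" "coeff e2 (2 * ?h1 + 2) = (coeff q1 ?h1)\<^sup>2"
        unfolding e0_def e2_def coeff_add using dT2[OF p1] dT2[OF q1] by auto
      then show ?thesis using coeff_height[OF bezout_coprime_nonzero[OF c1]] by auto
    qed
    have "?h0 + ?h2 \<le> 2 * ?h1 + 2" using nz bound' by (meson le_degree order.trans)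
    moreover have "2 * ?h1 + 2 \<le> ?h0 + ?h2" using nz' bound by (meson le_degree order.trans)
    ultimately show ?thesis by simp
  qed
  ultimately show ?thesis by blast
qed

text \<open>The height sequence has constant second difference 2, so it is the quadratic polynomial
  fixed by its first two values; being a sequence of degrees it is nonnegative. Only forward steps
  are taken here.\<close>

lemma height_quadratic_nonneg:
  assumes b: "b \<noteq> 0" and "bezout_coprime p0 q0" "bezout_coprime p1 q1" "add_rel b p0 q0 p1 q1"
  shows "0 \<le> (int n)\<^sup>2 + (int (height p1 q1) - int (height p0 q0) - 1) * int n + int (height p0 q0)"
proof -
  define f where "f m = m\<^sup>2 + (int (height p1 q1) - int (height p0 q0) - 1) * m + int (height p0 q0)" for m
  have "\<exists>p q p' q'. bezout_coprime p q \<and> bezout_coprime p' q' \<and> add_rel b p q p' q'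
        \<and> int (height p q) = f (int n) \<and> int (height p' q') = f (int n + 1)"
  proof (induction n)
    case 0
    then show ?case using assms by (intro exI[of _ p0] exI[of _ q0] exI[of _ p1] exI[of _ q1]) (simp add: f_def)
  next
    case (Suc n)
    then obtain p q p' q' where *: "bezout_coprime p q" "bezout_coprime p' q'" "add_rel b p q p' q'"
      "int (height p q) = f (int n)" "int (height p' q') = f (int n + 1)" by blast
    obtain p2 q2 where p2: "bezout_coprime p2 q2" "add_rel b p' q' p2 q2"
        "height p2 q2 + height p q = 2 * height p' q' + 2"
      using add_rel_step[OF b *(1-3)] by blast
    have "int (height p2 q2) = 2 * f (int n + 1) + 2 - f (int n)" using p2(3) * by linarith
    also have "\<dots> = f (int (Suc n) + 1)" by (simp add: f_def power2_eq_square algebra_simps)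
    finally show ?case using p2 * by (intro exI[of _ p'] exI[of _ q'] exI[of _ p2] exI[of _ q2]) (auto simp: add.commute)
  qed
  then have "0 \<le> f (int n)" by (metis of_nat_0_le_iff)
  then show ?thesis by (simp add: f_def)
qed


text \<open>The indices are not trace values: \<open>S0\<close> is where the character is -1 and
  \<open>S1\<close> where it is 1. The names follow the polynomials \<open>Z0\<close> and
  \<open>Z1\<close> that will have these sets as roots.\<close>

lemma card_lam_sets:
  assumes b: "b \<noteq> (0::'a)"
  defines "S0 \<equiv> {x. x \<noteq> 0 \<and> tr (x + b * inverse x) = 1}"
    and "S1 \<equiv> {x. x \<noteq> 0 \<and> tr (x + b * inverse x) = 0}"
  shows "S0 \<inter> S1 = {}" "S0 \<union> S1 = UNIV - {0}" "card S0 + card S1 + 1 = CARD('a)"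
    "Kloost r b = int (card S1) - int (card S0)"
proof -
  show d: "S0 \<inter> S1 = {}" by (auto simp: S0_def S1_def)
  show u: "S0 \<union> S1 = UNIV - {0}" using tr_cases by (auto simp: S0_def S1_def)
  have "card (UNIV - {0::'a}) = CARD('a) - 1" by (simp add: card_Diff_singleton)
  moreover have "CARD('a) > 0" by simp
  ultimately show "card S0 + card S1 + 1 = CARD('a)" using card_Un_disjoint[OF _ _ d] u
    by (metis Suc_eq_plus1 Suc_diff_1 finite)
  have "Kloost r b = (\<Sum>x\<in>S0. lam (x + b * inverse x)) + (\<Sum>x\<in>S1. lam (x + b * inverse x))"
    unfolding Kloost_eq u[symmetric] by (rule sum.union_disjoint) (use d in auto)
  also have "(\<Sum>x\<in>S0. lam (x + b * inverse x)) = (\<Sum>x\<in>S0. -1)"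
    by (intro sum.cong) (auto simp: S0_def lam_eq)
  also have "(\<Sum>x\<in>S1. lam (x + b * inverse x)) = (\<Sum>x\<in>S1. 1)"
    by (intro sum.cong) (auto simp: S1_def lam_eq)
  finally show "Kloost r b = int (card S1) - int (card S0)" by simp
qed

text \<open>In terms of \<open>w = (y + b) / x\<close> the addition formula reads
  \<open>x3 = x1 * x2 * ((w1 + w2) / (x1 + x2))^2\<close>. For the generic point and its Frobenius
  image, \<open>w1 + w2 = w^q + w\<close> is the formal trace of \<open>T + b / T\<close>, so the
  abscissa is \<open>T^(q+1) * (w^q + w)^2 / (T^q + T)^2\<close>. The work consists in reducing this
  fraction to lowest terms; exactly the \<open>x\<close> of trace 0 cancel.\<close>

lemma frobenius_start:
  assumes b: "b \<noteq> (0::'a)"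
  shows "\<exists>p q. bezout_coprime p q \<and> add_rel b ([:0, 1:] ^ (2 ^ r)) 1 p q
           \<and> int (height p q) = int CARD('a) + 1 - Kloost r b"
proof -
  define T :: "'a poly" where "T = [:0, 1:]"
  define B where "B = [:b:]"
  define Q :: nat where "Q = 2 ^ (r - 1)"
  have Q: "2 ^ r = 2 * Q" "Q > 0" "CARD('a) = 2 * Q" using card_eq card_F by (simp_all add: Q_def)
  have Qle: "2 ^ i \<le> Q" if "i < r" for i using that by (auto simp: Q_def intro: power_increasing)
  \<comment> \<open>This is \<open>T ^ Q\<close> times the formal trace of \<open>T + b / T\<close>;
    the exponent \<open>Q = q / 2\<close> is the least one that clears the denominators.\<close>
  define M where "M = (\<Sum>i<r. T ^ (Q + 2 ^ i) + B ^ (2 ^ i) * T ^ (Q - 2 ^ i))"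
  define S0 where "S0 = {x. x \<noteq> 0 \<and> tr (x + b * inverse x) = 1}"
  define S1 where "S1 = {x. x \<noteq> 0 \<and> tr (x + b * inverse x) = 0}"
  note S = card_lam_sets[OF b, folded S0_def S1_def]
  define Z0 where "Z0 = (\<Prod>x\<in>S0. [:- x, 1:])"
  define Z1 where "Z1 = (\<Prod>x\<in>S1. [:- x, 1:])"
  have degT: "degree (T ^ n) = n" for n by (simp add: T_def degree_power_eq)
  have polyT: "poly T x = x" for x by (simp add: T_def)
  have B_pow: "B ^ n = [:b ^ n:]" for n by (simp add: B_def poly_const_pow)
  have monomT: "T ^ n = monom 1 n" for n by (simp add: T_def monom_altdef)

  \<comment> \<open>Both sides are monic of degree \<open>q - 1\<close> and vanish at all nonzero
    elements, so the cofactor \<open>w\<close> has to be 1.\<close>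
  have ZZ: "Z0 * Z1 = T ^ (2 * Q - 1) + 1"
  proof -
    have "Z0 * Z1 = (\<Prod>x\<in>UNIV - {0}. [:- x, 1:])"
      unfolding Z0_def Z1_def S(2)[symmetric] by (rule prod.union_disjoint[symmetric]) (use S in auto)
    moreover have "(\<Prod>x\<in>UNIV - {0}. [:- x, 1:]) dvd T ^ (2 * Q - 1) + 1"
    proof (rule prod_linear_dvd)
      fix x :: 'a assume "x \<in> UNIV - {0}"
      then have "x * x ^ (2 * Q - 1) = x * 1"
        using pow_card[of x] Q by (simp flip: power_Suc)
      then have "x ^ (2 * Q - 1) = 1" using \<open>x \<in> UNIV - {0}\<close> by simp
      then show "poly (T ^ (2 * Q - 1) + 1) x = 0" by (simp add: polyT add_self)
    qed simp
    ultimately obtain w where w: "T ^ (2 * Q - 1) + 1 = Z0 * Z1 * w" by (auto elim: dvdE)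
    have c: "coeff (T ^ (2 * Q - 1) + 1) (2 * Q - 1) = 1" using Q(2) by (simp add: monomT)
    moreover have "degree (T ^ (2 * Q - 1) + 1) = 2 * Q - 1"
    proof (rule antisym)
      show "degree (T ^ (2 * Q - 1) + 1) \<le> 2 * Q - 1"
        using degT by (intro degree_add_le) auto
      show "2 * Q - 1 \<le> degree (T ^ (2 * Q - 1) + 1)"
        by (rule le_degree) (simp only: c one_neq_zero not_False_eq_True)
    qed
    ultimately have l: "lead_coeff (T ^ (2 * Q - 1) + 1) = 1" "degree (T ^ (2 * Q - 1) + 1) = 2 * Q - 1"
      by simp_all
    have "w \<noteq> 0"
    proof
      assume "w = 0"
      then have "lead_coeff (T ^ (2 * Q - 1) + 1) = 0" unfolding w by simp
      then show False using l(1) by simp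
    qed
    have lZ: "lead_coeff Z0 = 1" "lead_coeff Z1 = 1" "degree Z0 = card S0" "degree Z1 = card S1"
      unfolding Z0_def Z1_def by (rule lead_coeff_prod_linear degree_prod_linear)+
    then have "Z0 \<noteq> 0" "Z1 \<noteq> 0" by auto
    then have "degree (Z0 * Z1 * w) = card S0 + card S1 + degree w"
      using \<open>w \<noteq> 0\<close> lZ by (simp add: degree_mult_eq)
    then have "degree w = 0" using l w S(3) Q by simp
    then obtain c where c: "w = [:c:]" by (rule degree_eq_zeroE)
    have "lead_coeff (Z0 * Z1 * w) = lead_coeff w" by (simp only: lead_coeff_mult lZ(1,2) mult_1)
    then have "lead_coeff w = 1" using l(1) unfolding w by simp
    then have "w = 1" by (simp add: c one_pCons)
    then show ?thesis using w by simp
  qed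

  \<comment> \<open>For the formal trace \<open>S\<close> of \<open>u\<close>, the sum
    \<open>S^2 + S\<close> telescopes to \<open>u^q + u\<close>. With \<open>u = T + b / T\<close>
    and after multiplication by \<open>T^q\<close> this is the stated factorisation, since
    \<open>b^q = b\<close>.\<close>
  have M_eq: "M\<^sup>2 + T ^ Q * M = (T ^ (2 * Q + 1) + B) * (T ^ (2 * Q - 1) + 1)"
  proof -
    define g where "g i = T ^ (2 * Q + 2 ^ i) + B ^ (2 ^ i) * T ^ (2 * Q - 2 ^ i)" for i
    have sq: "(\<Sum>i<m. h i)\<^sup>2 = (\<Sum>i<m. (h i)\<^sup>2)" for h :: "nat \<Rightarrow> 'a poly" and m
      by (induction m) (auto simp: poly_square_add)
    have "M\<^sup>2 = (\<Sum>i<r. g (Suc i))"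
      unfolding M_def sq
      by (intro sum.cong refl) (simp add: g_def poly_square_add power_mult_distrib
        flip: power_mult, simp add: algebra_simps diff_mult_distrib)
    moreover have "T ^ Q * M = (\<Sum>i<r. g i)"
      unfolding M_def sum_distrib_left
    proof (intro sum.cong refl)
      fix i assume "i \<in> {..<r}"
      then have "Q + (Q - 2 ^ i) = 2 * Q - 2 ^ i" using Qle[of i] by simp
      then have "T ^ Q * T ^ (Q - 2 ^ i) = T ^ (2 * Q - 2 ^ i)" by (simp flip: power_add)
      moreover have "T ^ Q * T ^ (Q + 2 ^ i) = T ^ (2 * Q + 2 ^ i)" by (simp flip: power_add add: mult_2 add.assoc)
      ultimately show "T ^ Q * (T ^ (Q + 2 ^ i) + B ^ 2 ^ i * T ^ (Q - 2 ^ i)) = g i"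
        unfolding g_def by (simp add: distrib_left mult.left_commute)
    qed
    moreover have "(\<Sum>i<m. g (Suc i)) + (\<Sum>i<m. g i) = g m + g 0" for m
    proof (induction m)
      case 0
      then show ?case by (simp add: poly_add_self)
    next
      case (Suc m)
      have "(\<Sum>i<Suc m. g (Suc i)) + (\<Sum>i<Suc m. g i)
        = ((\<Sum>i<m. g (Suc i)) + (\<Sum>i<m. g i)) + g (Suc m) + g m" by (simp add: add_ac)
      also have "\<dots> = g (Suc m) + g 0 + (g m + g m)" unfolding Suc.IH by (simp add: add_ac)
      finally show ?case by (simp add: poly_add_self)
    qed
    ultimately have "M\<^sup>2 + T ^ Q * M = g r + g 0" by simp
    also have "g r = T ^ (2 * Q + 2 * Q) + B"
      unfolding g_def Q(1) B_pow using pow_card[of b] by (simp add: Q B_def)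
    also have "g 0 = T ^ (2 * Q + 1) + B * T ^ (2 * Q - 1)" by (simp add: g_def)
    also have "T ^ (2 * Q + 2 * Q) = T ^ (2 * Q + 1) * T ^ (2 * Q - 1)"
    proof -
      have "2 * Q + 2 * Q = (2 * Q + 1) + (2 * Q - 1)" using Q(2) by simp
      then show ?thesis by (metis power_add)
    qed
    finally show ?thesis by (simp add: algebra_simps)
  qed

  have poly_M: "poly M x = x ^ Q * tr (x + b * inverse x)" if "x \<noteq> 0" for x
  proof -
    have "poly M x = (\<Sum>i<r. x ^ (Q + 2 ^ i) + b ^ (2 ^ i) * x ^ (Q - 2 ^ i))"
      by (simp add: M_def poly_sum polyT B_pow)
    also have "\<dots> = (\<Sum>i<r. x ^ Q * (x + b * inverse x) ^ (2 ^ i))"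
    proof (intro sum.cong refl)
      fix i assume "i \<in> {..<r}"
      then have "x ^ Q = x ^ (Q - 2 ^ i) * x ^ (2 ^ i)" using Qle[of i] by (simp flip: power_add)
      then have "x ^ Q * inverse x ^ (2 ^ i) = x ^ (Q - 2 ^ i)" using that by (simp add: field_simps)
      then show "x ^ (Q + 2 ^ i) + b ^ (2 ^ i) * x ^ (Q - 2 ^ i) = x ^ Q * (x + b * inverse x) ^ (2 ^ i)"
        by (simp add: pow2_add distrib_left power_mult_distrib power_add mult.left_commute)
    qed
    finally show ?thesis by (simp add: tr_def' sum_distrib_left)
  qed
  \<comment> \<open>Only the term \<open>i = r - 1\<close>, where \<open>2 ^ i = Q\<close>, survives
    at 0 and contributes a power of \<open>b\<close>. So the factor \<open>T\<close> of the
    denominator does not cancel.\<close>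
  have poly_M_0: "poly M 0 \<noteq> 0"
  proof -
    have "poly M 0 = (\<Sum>i<r. b ^ (2 ^ i) * 0 ^ (Q - 2 ^ i))"
      using Q(2) by (simp add: M_def poly_sum polyT B_pow power_0_left)
    also have "\<dots> = (\<Sum>i<r. if i = r - 1 then b ^ Q else 0)"
    proof (intro sum.cong refl)
      fix i assume "i \<in> {..<r}"
      then have "i = r - 1 \<or> 2 ^ i < Q" by (auto simp: Q_def intro: power_strict_increasing)
      then show "b ^ (2 ^ i) * 0 ^ (Q - 2 ^ i) = (if i = r - 1 then b ^ Q else 0)"
        by (auto simp: Q_def power_0_left)
    qed
    finally show ?thesis using b r_pos by simp
  qed
  have deg_M: "degree M = 2 * Q"
  proof (rule antisym)
    show "degree M \<le> 2 * Q" unfolding M_def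
    proof (intro degree_sum_le degree_add_le)
      fix i assume i: "i \<in> {..<r}"
      show "degree (T ^ (Q + 2 ^ i)) \<le> 2 * Q" using Qle[of i] i by (simp add: degT)
      show "degree (B ^ 2 ^ i * T ^ (Q - 2 ^ i)) \<le> 2 * Q"
        using degree_mult_le[of "B ^ 2 ^ i" "T ^ (Q - 2 ^ i)"] by (simp add: degT B_pow)
    qed simp
    have "coeff M (2 * Q) = (\<Sum>i<r. if i = r - 1 then 1 else 0)"
      unfolding M_def coeff_sum
    proof (intro sum.cong refl)
      fix i assume "i \<in> {..<r}"
      then have "i = r - 1 \<and> 2 ^ i = Q \<or> i \<noteq> r - 1 \<and> 2 ^ i < Q"
        by (auto simp: Q_def intro: power_strict_increasing)
      moreover have "Q - 2 ^ i \<noteq> 2 * Q" using Q(2) diff_le_self[of Q "2 ^ i"] by linarith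
      ultimately show "coeff (T ^ (Q + 2 ^ i) + B ^ 2 ^ i * T ^ (Q - 2 ^ i)) (2 * Q) = (if i = r - 1 then 1 else 0)"
        by (auto simp: monomT B_pow)
    qed
    then have "coeff M (2 * Q) \<noteq> 0" using r_pos by simp
    then show "2 * Q \<le> degree M" by (rule le_degree)
  qed

  have "Z1 dvd M"
    unfolding Z1_def by (rule prod_linear_dvd) (auto simp: S1_def poly_M)
  then obtain V where V: "M = Z1 * V" by (auto elim: dvdE)
  have "M \<noteq> 0" using deg_M Q(2) by auto
  then have "Z1 \<noteq> 0" "V \<noteq> 0" using V by auto
  have "Z0 \<noteq> 0" by (simp add: Z0_def)
  have TZ: "T ^ (2 * Q) + T = T * Z0 * Z1"
  proof -
    have "T * T ^ (2 * Q - 1) = T ^ (2 * Q)" using Q(2) by (simp flip: power_Suc)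
    then show ?thesis using ZZ by (simp add: mult.assoc distrib_left)
  qed

  \<comment> \<open>The denominator has only linear prime factors, with roots 0 and the elements of
    trace 1; \<open>M\<close>, and with it \<open>V\<close>, is nonzero at each of them.\<close>
  have "bezout_coprime (V\<^sup>2) (T * Z0\<^sup>2)"
  proof (rule ccontr)
    assume "\<not> bezout_coprime (V\<^sup>2) (T * Z0\<^sup>2)"
    then obtain s where s: "prime_elem s" "s dvd V\<^sup>2" "s dvd T * Z0\<^sup>2" using not_bezout_coprimeD by blast
    have sV: "s dvd V" using s prime_elem_dvd_power by blast
    have "s dvd T \<or> s dvd Z0" using s prime_elem_dvd_multD prime_elem_dvd_power by blast
    then have "\<exists>x\<in>insert 0 S0. s dvd [:- x, 1:]"
      using prime_elem_dvd_prod[OF s(1), of "\<lambda>x. [:- x, 1:]" S0] by (auto simp: T_def Z0_def)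
    then obtain x where x: "x = 0 \<or> x \<in> S0" "poly s x = 0" using prime_elem_dvd_linear[OF s(1)] by blast
    then have "poly M x = 0" using sV V by (auto elim!: dvdE)
    then show False using x(1) poly_M_0 poly_M[of x] by (auto simp: S0_def)
  qed
  moreover have "add_rel b (T ^ (2 ^ r)) 1 (V\<^sup>2) (T * Z0\<^sup>2)"
  proof -
    \<comment> \<open>\<open>E\<close> is the equation \<open>M_eq\<close> divided by
      \<open>Z1\<close>. The left-hand side of \<open>add_rel\<close> turns out to be the perfect
      square of \<open>T * Z0 * E\<close>, so it vanishes.\<close>
    define E where "E = Z1 * V\<^sup>2 + T ^ Q * V + (T ^ (2 * Q + 1) + B) * Z0"
    have "Z1 * E = M\<^sup>2 + T ^ Q * M + (T ^ (2 * Q + 1) + B) * (Z0 * Z1)"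
      by (simp add: E_def V power2_eq_square algebra_simps)
    also have "\<dots> = 0" by (simp add: M_eq ZZ poly_add_self)
    finally have "E = 0" using \<open>Z1 \<noteq> 0\<close> by simp
    have TQ: "T ^ (2 * Q) = (T ^ Q)\<^sup>2" by (simp add: power_mult mult.commute flip: power_mult)
    have "((T ^ (2 * Q))\<^sup>2 + T\<^sup>2 * 1\<^sup>2) * (V\<^sup>2)\<^sup>2 + T * T ^ (2 * Q) * 1 * V\<^sup>2 * (T * Z0\<^sup>2)
        + (T\<^sup>2 * (T ^ (2 * Q))\<^sup>2 + B\<^sup>2 * 1\<^sup>2) * (T * Z0\<^sup>2)\<^sup>2
        = (T * Z0)\<^sup>2 * E\<^sup>2"
    proof -
      have "(T ^ (2 * Q))\<^sup>2 + T\<^sup>2 * 1\<^sup>2 = (T * Z0 * Z1)\<^sup>2"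
        unfolding TZ[symmetric] by (simp add: poly_square_add)
      moreover have "E\<^sup>2 = (Z1 * V\<^sup>2)\<^sup>2 + (T ^ Q * V)\<^sup>2 + ((T * T ^ (2 * Q))\<^sup>2 + B\<^sup>2) * Z0\<^sup>2"
        by (simp add: E_def poly_square_add power_mult_distrib)
      ultimately show ?thesis unfolding TQ
        by (simp add: power_mult_distrib) (simp add: power2_eq_square power4_eq_xxxx algebra_simps)
    qed
    then show ?thesis unfolding add_rel_def Q(1) T_def[symmetric] B_def[symmetric] using \<open>E = 0\<close> by simp
  qed
  moreover have "int (height (V\<^sup>2) (T * Z0\<^sup>2)) = int CARD('a) + 1 - Kloost r b"
  proof -
    have dZ: "degree Z0 = card S0" "degree Z1 = card S1"
      unfolding Z0_def Z1_def by (simp_all only: degree_prod_linear)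
    have "degree M = card S1 + degree V"
      using \<open>Z1 \<noteq> 0\<close> \<open>V \<noteq> 0\<close> unfolding V by (simp add: degree_mult_eq dZ)
    \<comment> \<open>The numerator thus has degree \<open>2 * card S0 + 2\<close>, one more than
      the denominator, and it determines the height.\<close>
    then have "degree V = card S0 + 1" using deg_M S(3) Q(3) by simp
    moreover have "degree (V\<^sup>2) = 2 * degree V" using \<open>V \<noteq> 0\<close> by (simp add: degree_power_eq)
    moreover have "degree (T * Z0\<^sup>2) = 1 + 2 * card S0"
      using \<open>Z0 \<noteq> 0\<close> degT[of 1] by (simp add: degree_mult_eq degree_power_eq dZ T_def)
    ultimately have "height (V\<^sup>2) (T * Z0\<^sup>2) = 2 * card S0 + 2" by (simp add: height_def)
    then show ?thesis using S(3,4) by simp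
  qed
  ultimately show ?thesis unfolding T_def by blast
qed

text \<open>The heights have the form \<open>n^2 - K n + q\<close>. Their nonnegativity at all
  integers would give a nonpositive discriminant if the vertex \<open>K / 2\<close> were an integer;
  as \<open>K\<close> is odd, the nearest integers still give the bound, and arithmetic of powers of
  two makes it strict.\<close>

theorem Kloost_Weil_bound:
  assumes b: "b \<noteq> (0::'a)" and r: "r \<ge> 2"
  shows "(Kloost r b)\<^sup>2 < 4 * int CARD('a)"
proof -
  define q where "q = int CARD('a)"
  define K where "K = Kloost r b"
  obtain p1 q1 where s: "bezout_coprime p1 q1" "add_rel b ([:0, 1:] ^ (2 ^ r)) 1 p1 q1"
    "int (height p1 q1) = q + 1 - K" using frobenius_start[OF b] unfolding q_def K_def by blast
  have s0: "bezout_coprime ([:0, 1:] ^ (2 ^ r)) (1::'a poly)"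
    unfolding bezout_coprime_def by (intro exI[of _ 0] exI[of _ 1]) simp
  have h0: "int (height ([:0, 1:] ^ (2 ^ r)) (1::'a poly)) = q"
    by (simp add: height_def degree_power_eq q_def card_F)
  have pos: "0 \<le> (int n)\<^sup>2 - K * int n + q" for n
    using height_quadratic_nonneg[OF b s0 s(1,2), of n] by (simp add: s(3) h0)
  \<comment> \<open>The same sequence run backwards: after swapping the starting fractions index 0
    of the new sequence is index 1 of the old one, so old index \<open>-n\<close> is reached after
    \<open>Suc n\<close> steps.\<close>
  have neg: "0 \<le> (int n)\<^sup>2 + K * int n + q" for n
  proof -
    have "add_rel b p1 q1 ([:0, 1:] ^ (2 ^ r)) 1" using s(2) add_rel_commute by blast
    from height_quadratic_nonneg[OF b s(1) s0 this, of "Suc n"]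
    have "0 \<le> (int (Suc n))\<^sup>2 + (q - (q + 1 - K) - 1) * int (Suc n) + (q + 1 - K)"
      by (simp only: s(3) h0)
    then show ?thesis by (simp add: power2_eq_square algebra_simps)
  qed
  have both: "0 \<le> (int n)\<^sup>2 - \<bar>K\<bar> * int n + q" for n
    using pos[of n] neg[of n] by (cases "K \<ge> 0") auto
  have "odd K"
  proof -
    have "4 dvd K + 1" using Kloost_mod_4[OF b r] by (simp add: K_def cong_iff_dvd_diff)
    then have "2 dvd K + 1" by (meson dvd_trans even_numeral)
    then show ?thesis by simp
  qed
  \<comment> \<open>The integers \<open>k\<close> and \<open>k + 1\<close> are the ones closest to
    the vertex; evaluating at \<open>k\<close> gives \<open>k * (k + 1) \<le> q\<close>.\<close>
  then obtain k where k: "\<bar>K\<bar> = 2 * k + 1" using oddE[of "\<bar>K\<bar>"] by auto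
  then have "k \<ge> 0" by linarith
  have "0 \<le> k\<^sup>2 - \<bar>K\<bar> * k + q" using both[of "nat k"] \<open>k \<ge> 0\<close> by simp
  then have le: "k * (k + 1) \<le> q" by (simp add: k power2_eq_square algebra_simps)
  \<comment> \<open>One of two consecutive integers is odd, and an odd nonnegative divisor of a
    power of two is 1. This leaves the products 0 and 2, both below 4.\<close>
  have "k * (k + 1) \<noteq> q"
  proof
    assume eq: "k * (k + 1) = q"
    have q: "q = 2 ^ r" by (simp add: q_def card_F)
    have only: "d = 1" if "odd d" "d dvd q" "d \<ge> 0" for d :: int
    proof -
      have "coprime d (2 ^ r)" using that(1) by (simp add: coprime_commute)
      then have "is_unit d" using that(2) q by (metis coprime_common_divisor dvd_refl)
      then show ?thesis using that(3) by simp
    qed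
    have "k = 1 \<or> k + 1 = 1"
      using only[of k] only[of "k + 1"] \<open>k \<ge> 0\<close> eq by (metis add_increasing dvd_triv_left dvd_triv_right even_plus_one_iff zero_le_one)
    moreover have "q \<ge> 4" using power_increasing[OF r, of "2::int"] q by simp
    ultimately show False using eq by auto
  qed
  with le have "k * (k + 1) + 1 \<le> q" by simp
  moreover have "K\<^sup>2 = \<bar>K\<bar>\<^sup>2" by simp
  then have "K\<^sup>2 = 4 * (k * (k + 1)) + 1" unfolding k by (simp add: power2_eq_square algebra_simps)
  ultimately show ?thesis unfolding K_def q_def by simp
qed

end

section \<open>Weight distributions and power moments\<close>

text \<open>The induction step is the rule \<open>w * (w)_t = (w)_(t+1) + t * (w)_t\<close> for the
  falling factorials \<open>(w)_t = fact t * (w choose t)\<close>, matched with the recurrence of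
  the Stirling numbers.\<close>

lemma power_eq_sum_Stirling:
  "w ^ h = (\<Sum>t\<le>h. Stirling h t * fact t * (w choose t))"
proof (induction h)
  case (Suc h)
  let ?f = "\<lambda>t. fact t * (w choose t)"
  have step: "w * ?f t = ?f (Suc t) + t * ?f t" for t
  proof (cases "t \<le> w")
    case True
    have eq: "(w - t) * (w choose t) = Suc t * (w choose Suc t)"
      by (cases w) (simp_all only: binomial_absorb_comp Suc_times_binomial diff_Suc_1, simp)
    have "w * ?f t = (w - t) * ?f t + t * ?f t" using True by (simp flip: distrib_right)
    also have "(w - t) * ?f t = fact t * ((w - t) * (w choose t))" by (simp only: mult_ac)
    also have "\<dots> = ?f (Suc t)" unfolding eq by (simp only: fact_Suc mult_ac of_nat_id)
    finally show ?thesis .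
  qed (simp add: binomial_eq_0)
  have "w ^ Suc h = (\<Sum>t\<le>h. Stirling h t * (w * ?f t))"
    by (simp add: Suc.IH sum_distrib_left mult_ac)
  also have "\<dots> = (\<Sum>t\<le>h. Stirling h t * ?f (Suc t)) + (\<Sum>t\<le>h. t * Stirling h t * ?f t)"
    by (simp only: step distrib_left sum.distrib mult_ac)
  also have "(\<Sum>t\<le>h. t * Stirling h t * ?f t) = (\<Sum>t\<le>h. Suc t * Stirling h (Suc t) * ?f (Suc t))"
  proof -
    have "(\<Sum>t\<le>h. t * Stirling h t * ?f t) = (\<Sum>t\<le>Suc h. t * Stirling h t * ?f t)" by simp
    also have "\<dots> = (\<Sum>t\<le>h. Suc t * Stirling h (Suc t) * ?f (Suc t))"
      by (subst sum.atMost_Suc_shift) simp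
    finally show ?thesis .
  qed
  also have "(\<Sum>t\<le>h. Stirling h t * ?f (Suc t)) + \<dots> = (\<Sum>t\<le>h. Stirling (Suc h) (Suc t) * ?f (Suc t))"
    by (simp add: algebra_simps flip: sum.distrib)
  also have "\<dots> = (\<Sum>t\<le>Suc h. Stirling (Suc h) t * ?f t)"
    by (subst sum.atMost_Suc_shift) simp
  finally show ?case by (simp add: mult.assoc)
qed simp

lemma card_supersets:
  assumes "finite I" "U \<subseteq> I"
  shows "card {T. U \<subseteq> T \<and> T \<subseteq> I \<and> card T = t} =
    (if card U \<le> t then (card I - card U) choose (t - card U) else 0)"
proof (cases "card U \<le> t")
  case True
  have "bij_betw (\<lambda>T. T - U) {T. U \<subseteq> T \<and> T \<subseteq> I \<and> card T = t} {T. T \<subseteq> I - U \<and> card T = t - card U}"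
    using assms True finite_subset[OF _ assms(1)]
    by (intro bij_betw_byWitness[of _ "\<lambda>T. T \<union> U"])
      (auto simp: card_Diff_subset card_Un_disjoint Int_commute intro!: card_Un_disjoint[THEN trans])
  then show ?thesis
    using True assms by (simp add: bij_betw_same_card n_subsets card_Diff_subset finite_subset)
next
  case False
  have "card U \<le> card T" if "U \<subseteq> T" "T \<subseteq> I" for T
    using that assms card_mono finite_subset by metis
  with False have e: "{T. U \<subseteq> T \<and> T \<subseteq> I \<and> card T = t} = {}" by auto
  show ?thesis unfolding e using False by simp
qed

section \<open>Codewords as zero-sum subsets of the index set\<close>

definition zero_sum_subsets :: "nat \<Rightarrow> (nat \<Rightarrow> 'a::ab_group_add) \<Rightarrow> nat \<Rightarrow> nat set set" where
  "zero_sum_subsets N x j = {S. S \<subseteq> {..<N} \<and> card S = j \<and> (\<Sum>i\<in>S. x i) = 0}"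

lemma finite_zero_sum_subsets: "finite (zero_sum_subsets N x j)"
  by (rule finite_subset[of _ "Pow {..<N}"]) (auto simp: zero_sum_subsets_def)

text \<open>A binary word is determined by its support, its weight is the size of the support, and
  the defining equation of the code is a sum over the support.\<close>

lemma weight_count_eq:
  "weight_count gs j = card (zero_sum_subsets (length gs) (\<lambda>i. mat_trace (gs ! i)) j)"
proof -
  let ?N = "length gs"
  let ?f = "\<lambda>u::bit vec. {i. i < ?N \<and> u $ i \<noteq> 0}"
  have "bij_betw ?f {u \<in> trace_code gs. hamming_weight u = j}
    (zero_sum_subsets ?N (\<lambda>i. mat_trace (gs ! i)) j)"
  proof (rule bij_betw_byWitness[of _ "\<lambda>S. vec ?N (\<lambda>i. of_bool (i \<in> S))"])
    have sum: "(\<Sum>i<?N. of_bool (u $ i = 1) * mat_trace (gs ! i)) = (\<Sum>i\<in>?f u. mat_trace (gs ! i))"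
      for u :: "bit vec"
    proof -
      have "(\<Sum>i<?N. of_bool (u $ i = 1) * mat_trace (gs ! i)) = (\<Sum>i<?N. if u $ i \<noteq> 0 then mat_trace (gs ! i) else 0)"
        by (intro sum.cong) auto
      also have "\<dots> = (\<Sum>i\<in>{..<?N} \<inter> {i. u $ i \<noteq> 0}. mat_trace (gs ! i))"
        by (simp add: sum.inter_restrict)
      also have "{..<?N} \<inter> {i. u $ i \<noteq> 0} = ?f u" by auto
      finally show ?thesis .
    qed
    show "\<forall>u\<in>{u \<in> trace_code gs. hamming_weight u = j}. vec ?N (\<lambda>i. of_bool (i \<in> ?f u)) = u"
      by (auto simp: trace_code_def of_bool_def)
    show "\<forall>S\<in>zero_sum_subsets ?N (\<lambda>i. mat_trace (gs ! i)) j. ?f (vec ?N (\<lambda>i. of_bool (i \<in> S))) = S"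
      by (auto simp: zero_sum_subsets_def)
    show "?f ` {u \<in> trace_code gs. hamming_weight u = j} \<subseteq> zero_sum_subsets ?N (\<lambda>i. mat_trace (gs ! i)) j"
      by (auto simp: trace_code_def zero_sum_subsets_def hamming_weight_def sum)
    show "(\<lambda>S. vec ?N (\<lambda>i. of_bool (i \<in> S))) ` zero_sum_subsets ?N (\<lambda>i. mat_trace (gs ! i)) j
        \<subseteq> {u \<in> trace_code gs. hamming_weight u = j}"
    proof
      fix u :: "bit vec" assume "u \<in> (\<lambda>S. vec ?N (\<lambda>i. of_bool (i \<in> S))) ` zero_sum_subsets ?N (\<lambda>i. mat_trace (gs ! i)) j"
      then obtain S where S: "S \<in> zero_sum_subsets ?N (\<lambda>i. mat_trace (gs ! i)) j"
        and u: "u = vec ?N (\<lambda>i. of_bool (i \<in> S))" by blast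
      have fu: "?f u = S" using S u by (auto simp: zero_sum_subsets_def)
      have d: "dim_vec u = ?N" by (simp add: u)
      have S': "card S = j" "(\<Sum>i\<in>S. mat_trace (gs ! i)) = 0"
        using S unfolding zero_sum_subsets_def by blast+
      have "hamming_weight u = j"
        by (simp only: hamming_weight_def d fu S'(1))
      moreover have "u \<in> carrier_vec ?N" by (rule carrier_vecI) (rule d)
      moreover have "(\<Sum>i<?N. of_bool (u $ i = 1) * mat_trace (gs ! i)) = 0"
        unfolding sum fu by (rule S'(2))
      ultimately show "u \<in> {u \<in> trace_code gs. hamming_weight u = j}"
        unfolding trace_code_def by blast
    qed
  qed
  then show ?thesis unfolding weight_count_def by (rule bij_betw_same_card)
qed

lemma finite_families: "finite (families j :: ('a::{finite,field} \<Rightarrow> nat) set)"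
proof (rule finite_subset)
  show "families j \<subseteq> {\<nu>::'a \<Rightarrow> nat. \<forall>\<beta>. \<nu> \<beta> \<in> {..j}}"
    by (auto simp: families_def intro: member_le_sum)
  have "{\<nu>::'a \<Rightarrow> nat. \<forall>\<beta>. \<nu> \<beta> \<in> {..j}} = (\<Pi>\<^sub>E \<beta>\<in>UNIV. {..j})" by (auto simp: PiE_def Pi_def extensional_def)
  then show "finite {\<nu>::'a \<Rightarrow> nat. \<forall>\<beta>. \<nu> \<beta> \<in> {..j}}" by (simp add: finite_PiE)
qed

lemma card_subsets_with_profile:
  fixes x :: "nat \<Rightarrow> 'a::finite"
  assumes "finite I"
  shows "card {S. S \<subseteq> I \<and> (\<forall>\<beta>. card {i \<in> S. x i = \<beta>} = \<nu> \<beta>)}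
    = (\<Prod>\<beta>\<in>UNIV. card {i \<in> I. x i = \<beta>} choose \<nu> \<beta>)"
proof -
  let ?I = "\<lambda>\<beta>. {i \<in> I. x i = \<beta>}"
  let ?P = "\<lambda>\<beta>. {T. T \<subseteq> ?I \<beta> \<and> card T = \<nu> \<beta>}"
  have "bij_betw (\<lambda>S \<beta>. {i \<in> S. x i = \<beta>}) {S. S \<subseteq> I \<and> (\<forall>\<beta>. card {i \<in> S. x i = \<beta>} = \<nu> \<beta>)}
      (\<Pi>\<^sub>E \<beta>\<in>UNIV. ?P \<beta>)"
  proof (rule bij_betw_byWitness[of _ "\<lambda>f. \<Union>\<beta>. f \<beta>"])
    have *: "{i \<in> (\<Union>\<beta>. f \<beta>). x i = \<beta>} = f \<beta>" if "f \<in> (\<Pi>\<^sub>E \<beta>\<in>UNIV. ?P \<beta>)" for f \<beta>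
      using that unfolding PiE_iff by blast
    then show "\<forall>f\<in>\<Pi>\<^sub>E \<beta>\<in>UNIV. ?P \<beta>. (\<lambda>\<beta>. {i \<in> (\<Union>\<beta>. f \<beta>). x i = \<beta>}) = f" by blast
    show "(\<lambda>f. \<Union>\<beta>. f \<beta>) ` (\<Pi>\<^sub>E \<beta>\<in>UNIV. ?P \<beta>) \<subseteq> {S. S \<subseteq> I \<and> (\<forall>\<beta>. card {i \<in> S. x i = \<beta>} = \<nu> \<beta>)}"
    proof clarify
      fix f assume f: "f \<in> (\<Pi>\<^sub>E \<beta>\<in>UNIV. ?P \<beta>)"
      then have "f \<beta> \<in> ?P \<beta>" for \<beta> unfolding PiE_iff by blast
      then show "(\<Union>\<beta>. f \<beta>) \<subseteq> I \<and> (\<forall>\<beta>. card {i \<in> (\<Union>\<beta>. f \<beta>). x i = \<beta>} = \<nu> \<beta>)"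
        unfolding *[OF f] by blast
    qed
  qed auto
  then have "card {S. S \<subseteq> I \<and> (\<forall>\<beta>. card {i \<in> S. x i = \<beta>} = \<nu> \<beta>)} = card (\<Pi>\<^sub>E \<beta>\<in>UNIV. ?P \<beta>)"
    by (rule bij_betw_same_card)
  also have "\<dots> = (\<Prod>\<beta>\<in>UNIV. card {i \<in> I. x i = \<beta>} choose \<nu> \<beta>)"
    using assms by (simp add: card_PiE n_subsets)
  finally show ?thesis .
qed

text \<open>Size and sum of an index set depend only on how many of its members take each value
  \<beta>. For a prescribed profile \<open>\<nu>\<close> the choices inside the different value
  classes are independent.\<close>

lemma card_zero_sum_subsets:
  fixes x :: "nat \<Rightarrow> 'a::{finite,field}"
  shows "card (zero_sum_subsets N x j) = (\<Sum>\<nu>\<in>families j. \<Prod>\<beta>\<in>UNIV. card {i. i < N \<and> x i = \<beta>} choose \<nu> \<beta>)"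
proof -
  let ?prof = "\<lambda>S \<beta>. card {i \<in> S. x i = \<beta>}"
  have fin: "finite S" if "S \<subseteq> {..<N}" for S using that finite_subset by blast
  have prof: "card S = (\<Sum>\<beta>\<in>UNIV. ?prof S \<beta>)" "(\<Sum>i\<in>S. x i) = (\<Sum>\<beta>\<in>UNIV. of_nat (?prof S \<beta>) * \<beta>)"
    if "finite S" for S
  proof -
    have "card S = (\<Sum>\<beta>\<in>UNIV. \<Sum>i\<in>{i \<in> S. x i = \<beta>}. 1)"
      using that by (subst sum.group) auto
    then show "card S = (\<Sum>\<beta>\<in>UNIV. ?prof S \<beta>)" by simp
    have "(\<Sum>i\<in>S. x i) = (\<Sum>\<beta>\<in>UNIV. \<Sum>i\<in>{i \<in> S. x i = \<beta>}. x i)"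
      using that by (subst sum.group) auto
    also have "\<dots> = (\<Sum>\<beta>\<in>UNIV. \<Sum>i\<in>{i \<in> S. x i = \<beta>}. \<beta>)" by (intro sum.cong) auto
    finally show "(\<Sum>i\<in>S. x i) = (\<Sum>\<beta>\<in>UNIV. of_nat (?prof S \<beta>) * \<beta>)" by simp
  qed
  have "zero_sum_subsets N x j = (\<Union>\<nu>\<in>families j. {S. S \<subseteq> {..<N} \<and> (\<forall>\<beta>. ?prof S \<beta> = \<nu> \<beta>)})"
  proof (rule equalityI; rule subsetI)
    fix S assume "S \<in> zero_sum_subsets N x j"
    then show "S \<in> (\<Union>\<nu>\<in>families j. {S. S \<subseteq> {..<N} \<and> (\<forall>\<beta>. ?prof S \<beta> = \<nu> \<beta>)})"
      using prof[OF fin, of S] by (auto simp: zero_sum_subsets_def families_def)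
  next
    fix S assume "S \<in> (\<Union>\<nu>\<in>families j. {S. S \<subseteq> {..<N} \<and> (\<forall>\<beta>. ?prof S \<beta> = \<nu> \<beta>)})"
    then show "S \<in> zero_sum_subsets N x j"
      using prof[OF fin, of S] by (auto simp: zero_sum_subsets_def families_def)
  qed
  also have "card \<dots> = (\<Sum>\<nu>\<in>families j. card {S. S \<subseteq> {..<N} \<and> (\<forall>\<beta>. ?prof S \<beta> = \<nu> \<beta>)})"
  proof (rule card_UN_disjoint)
    show "\<forall>\<nu>\<in>families j. finite {S. S \<subseteq> {..<N} \<and> (\<forall>\<beta>. ?prof S \<beta> = \<nu> \<beta>)}"
      by (auto intro: finite_subset[of _ "Pow {..<N}"])
    show "\<forall>\<nu>\<in>families j. \<forall>\<mu>\<in>families j. \<nu> \<noteq> \<mu> \<longrightarrow>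
        {S. S \<subseteq> {..<N} \<and> (\<forall>\<beta>. ?prof S \<beta> = \<nu> \<beta>)} \<inter> {S. S \<subseteq> {..<N} \<and> (\<forall>\<beta>. ?prof S \<beta> = \<mu> \<beta>)} = {}"
      by (auto simp: fun_eq_iff)
  qed (rule finite_families)
  also have "\<dots> = (\<Sum>\<nu>\<in>families j. \<Prod>\<beta>\<in>UNIV. card {i. i < N \<and> x i = \<beta>} choose \<nu> \<beta>)"
    by (subst card_subsets_with_profile) simp_all
  finally show ?thesis .
qed

lemma binom_of_nat: "binom (real b) (int a) = real (b choose a)"
  by (cases "a \<le> b") (auto simp: binom_def binomial_gbinomial[symmetric] binomial_eq_0)

section \<open>Power moments from binomial moments\<close>

context char2_field
begin

text \<open>After expansion over subsets \<open>U\<close> of \<open>t\<close>-element sets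
  \<open>T\<close>, the order of summation is exchanged; orthogonality in \<open>a\<close> leaves
  the zero-sum \<open>U\<close> with weight \<open>CARD('a)\<close>. The binomial coefficient on the
  right is the number of \<open>t\<close>-element sets \<open>T\<close> that contain a given
  \<open>U\<close> of size \<open>j\<close>.\<close>

lemma sum_choose_weights:
  fixes x :: "nat \<Rightarrow> 'a"
  shows "2 ^ t * (\<Sum>a\<in>UNIV. int (card {i. i < N \<and> lam (a * x i) = -1} choose t))
    = int CARD('a) * (\<Sum>j\<le>t. (-1) ^ j * int (card (zero_sum_subsets N x j)) * int ((N - j) choose (t - j)))"
proof -
  define I where "I = {..<N}"
  have fin: "finite I" by (simp add: I_def)
  have finS: "finite S" if "S \<subseteq> I" for S using that fin finite_subset by blast
  have choose: "2 ^ t * int (card {i. i < N \<and> lam (a * x i) = -1} choose t)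
      = (\<Sum>T | T \<subseteq> I \<and> card T = t. \<Sum>U\<in>Pow T. (-1) ^ card U * lam (a * (\<Sum>i\<in>U. x i)))" for a
  proof -
    let ?W = "{i. i < N \<and> lam (a * x i) = -1}"
    have "(\<Sum>U\<in>Pow T. (-1) ^ card U * lam (a * (\<Sum>i\<in>U. x i))) = (if T \<subseteq> ?W then 2 ^ t else 0)"
      if T: "T \<subseteq> I" "card T = t" for T
    proof -
      have "(\<Sum>U\<in>Pow T. (-1) ^ card U * lam (a * (\<Sum>i\<in>U. x i)))
          = (\<Sum>U\<in>Pow T. (\<Prod>i\<in>U. - lam (a * x i)) * (\<Prod>i\<in>T - U. 1))"
        by (simp add: sum_distrib_left lam_sum prod_uminus)
      also have "\<dots> = (\<Prod>i\<in>T. - lam (a * x i) + 1)"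
        by (rule prod_add[symmetric]) (rule finS[OF T(1)])
      also have "\<dots> = (if T \<subseteq> ?W then 2 ^ t else 0)"
      proof (cases "T \<subseteq> ?W")
        case True
        then have "(\<Prod>i\<in>T. - lam (a * x i) + 1) = (\<Prod>i\<in>T. 2)" by (intro prod.cong) auto
        then show ?thesis using True T by simp
      next
        case False
        then obtain i where "i \<in> T" "lam (a * x i) \<noteq> -1" using T by (auto simp: I_def)
        then have "i \<in> T" "- lam (a * x i) + 1 = 0" using lam_cases[of "a * x i"] by auto
        then show ?thesis using False finS[OF T(1)] by (auto intro!: prod_zero)
      qed
      finally show ?thesis .
    qed
    then have "(\<Sum>T | T \<subseteq> I \<and> card T = t. \<Sum>U\<in>Pow T. (-1) ^ card U * lam (a * (\<Sum>i\<in>U. x i)))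
        = (\<Sum>T | T \<subseteq> I \<and> card T = t. if T \<subseteq> ?W then 2 ^ t else 0)"
      by (intro sum.cong) auto
    also have "\<dots> = (\<Sum>T\<in>{T. T \<subseteq> I \<and> card T = t} \<inter> {T. T \<subseteq> ?W}. 2 ^ t)"
      using fin by (subst sum.inter_restrict) auto
    also have "{T. T \<subseteq> I \<and> card T = t} \<inter> {T. T \<subseteq> ?W} = {T. T \<subseteq> ?W \<and> card T = t}"
      by (auto simp: I_def)
    finally show ?thesis by (simp add: n_subsets)
  qed
  have "2 ^ t * (\<Sum>a\<in>UNIV. int (card {i. i < N \<and> lam (a * x i) = -1} choose t))
      = (\<Sum>a\<in>UNIV. \<Sum>T | T \<subseteq> I \<and> card T = t. \<Sum>U\<in>Pow T. (-1) ^ card U * lam (a * (\<Sum>i\<in>U. x i)))"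
    by (simp add: sum_distrib_left choose)
  also have "\<dots> = (\<Sum>T | T \<subseteq> I \<and> card T = t. \<Sum>U\<in>Pow T. (-1) ^ card U * (\<Sum>a\<in>UNIV. lam (a * (\<Sum>i\<in>U. x i))))"
    by (subst sum.swap, intro sum.cong refl, subst sum.swap) (simp add: sum_distrib_left)
  also have "\<dots> = (\<Sum>T | T \<subseteq> I \<and> card T = t. \<Sum>U | U \<in> Pow I \<and> U \<subseteq> T. (-1) ^ card U * (\<Sum>a\<in>UNIV. lam (a * (\<Sum>i\<in>U. x i))))"
    by (intro sum.cong refl) auto
  also have "\<dots> = (\<Sum>U\<in>Pow I. \<Sum>T | T \<in> {T. T \<subseteq> I \<and> card T = t} \<and> U \<subseteq> T. (-1) ^ card U * (\<Sum>a\<in>UNIV. lam (a * (\<Sum>i\<in>U. x i))))"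
    by (rule sum.swap_restrict) (use fin in auto)
  also have "\<dots> = (\<Sum>U\<in>Pow I. (if (\<Sum>i\<in>U. x i) = 0 \<and> card U \<le> t
      then int CARD('a) * ((-1) ^ card U * int ((N - card U) choose (t - card U))) else 0))"
  proof (intro sum.cong refl)
    fix U assume U: "U \<in> Pow I"
    have "{T. T \<in> {T. T \<subseteq> I \<and> card T = t} \<and> U \<subseteq> T} = {T. U \<subseteq> T \<and> T \<subseteq> I \<and> card T = t}" by auto
    then have "card {T. T \<in> {T. T \<subseteq> I \<and> card T = t} \<and> U \<subseteq> T} =
        (if card U \<le> t then (N - card U) choose (t - card U) else 0)"
      using card_supersets[OF fin, of U t] U by (simp add: I_def)
    then show "(\<Sum>T | T \<in> {T. T \<subseteq> I \<and> card T = t} \<and> U \<subseteq> T. (-1) ^ card U * (\<Sum>a\<in>UNIV. lam (a * (\<Sum>i\<in>U. x i))))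
      = (if (\<Sum>i\<in>U. x i) = 0 \<and> card U \<le> t then int CARD('a) * ((-1) ^ card U * int ((N - card U) choose (t - card U))) else 0)"
      using sum_lam_mult[of "\<Sum>i\<in>U. x i"] by (simp add: mult.commute)
  qed
  also have "\<dots> = (\<Sum>U\<in>(\<Union>j\<in>{..t}. zero_sum_subsets N x j). int CARD('a) * ((-1) ^ card U * int ((N - card U) choose (t - card U))))"
    using fin by (intro sum.mono_neutral_cong_right) (auto simp: zero_sum_subsets_def I_def)
  also have "\<dots> = (\<Sum>j\<le>t. \<Sum>U\<in>zero_sum_subsets N x j. int CARD('a) * ((-1) ^ card U * int ((N - card U) choose (t - card U))))"
    by (rule sum.UNION_disjoint) (simp_all add: finite_zero_sum_subsets, auto simp: zero_sum_subsets_def)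
  also have "\<dots> = (\<Sum>j\<le>t. \<Sum>U\<in>zero_sum_subsets N x j. int CARD('a) * ((-1) ^ j * int ((N - j) choose (t - j))))"
    by (intro sum.cong refl) (auto simp: zero_sum_subsets_def)
  finally show ?thesis by (simp add: sum_distrib_left mult_ac)
qed

text \<open>One statement serves all three recursions: \<open>\<kappa>\<close> is \<open>K\<close>
  with \<open>c = 0\<close>, or \<open>K_2\<close> with \<open>c = q^2\<close>, or the square of
  \<open>K\<close> with \<open>c = q^2 - q\<close>. The recursion is the binomial expansion of
  \<open>(B - c - \<kappa> a) ^ h\<close>, solved for the term \<open>l = h\<close>.\<close>

lemma moment_recursion:
  fixes gs :: "'a mat list" and \<kappa> :: "'a \<Rightarrow> real" and A B c :: real
  defines "N \<equiv> length gs"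
  assumes N: "real N = A * B" and A: "A \<noteq> 0" and h: "h \<ge> 1"
    and char_sum: "\<And>a. a \<noteq> 0 \<Longrightarrow> (\<Sum>i<N. real_of_int (lam (a * mat_trace (gs ! i)))) = A * (c + \<kappa> a)"
  shows "(\<Sum>a\<in>UNIV - {0}. \<kappa> a ^ h) =
     (\<Sum>l<h. (-1) ^ (h + l + 1) * real (h choose l) * (B - c) ^ (h - l) * (\<Sum>a\<in>UNIV - {0}. \<kappa> a ^ l))
       + moment_term CARD('a) A N (weight_count gs) h"
proof -
  define x where "x i = mat_trace (gs ! i)" for i
  define C where "C = weight_count gs"
  define w where "w a = card {i. i < N \<and> lam (a * x i) = -1}" for a
  define D where "D = B - c"
  define q where "q = real CARD('a)"
  have C: "C j = card (zero_sum_subsets N x j)" for j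
    by (simp add: C_def weight_count_eq N_def x_def[abs_def])
  \<comment> \<open>The character takes only the values 1 and -1, so its sum over the list is
    \<open>N - 2 * w a\<close>.\<close>
  have w: "real (w a) = A / 2 * (D - \<kappa> a)" if "a \<noteq> 0" for a
  proof -
    have "(\<Sum>i<N. real_of_int (lam (a * x i))) = (\<Sum>i<N. 1 - 2 * of_bool (lam (a * x i) = -1))"
      using lam_cases by (intro sum.cong) (auto simp: of_bool_def)
    also have "\<dots> = real N - 2 * (\<Sum>i<N. of_bool (lam (a * x i) = -1))"
      by (simp add: sum_subtractf sum_distrib_left)
    also have "(\<Sum>i<N. of_bool (lam (a * x i) = -1)) = real (w a)"
      by (simp add: of_bool_def sum.If_cases w_def Int_def)
    finally have "A * (c + \<kappa> a) = A * B - 2 * real (w a)" using char_sum[OF that] N by (simp add: x_def)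
    then show ?thesis by (simp add: D_def field_simps)
  qed
  \<comment> \<open>Orthogonality needs the sum over all \<open>a\<close>, the moments only nonzero
    \<open>a\<close>. For \<open>h \<ge> 1\<close> the term at 0 vanishes, so the two sums
    agree.\<close>
  have w0: "w 0 = 0" by (simp add: w_def)
  have "(\<Sum>a\<in>UNIV. real (w a) ^ h) = (\<Sum>a\<in>UNIV. real (w a ^ h))" by simp
  also have "\<dots> = (\<Sum>a\<in>UNIV. \<Sum>t\<le>h. real (Stirling h t) * fact t * real (w a choose t))"
    unfolding power_eq_sum_Stirling by simp
  also have "\<dots> = (\<Sum>t\<le>h. real (Stirling h t) * fact t * (\<Sum>a\<in>UNIV. real (w a choose t)))"
    by (subst sum.swap) (simp add: sum_distrib_left)
  also have "\<dots> = (\<Sum>t\<le>h. \<Sum>j\<le>t. q * ((-1) ^ j * real (C j) * (fact t * real (Stirling h t) / 2 ^ t * real ((N - j) choose (t - j)))))"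
  proof (intro sum.cong refl)
    fix t
    have "real_of_int (2 ^ t * (\<Sum>a\<in>UNIV. int (w a choose t))) = real_of_int (int CARD('a) * (\<Sum>j\<le>t. (-1) ^ j * int (C j) * int ((N - j) choose (t - j))))"
      unfolding w_def C by (subst sum_choose_weights) (rule refl)
    then have "(\<Sum>a\<in>UNIV. real (w a choose t)) = q * (\<Sum>j\<le>t. (-1) ^ j * real (C j) * real ((N - j) choose (t - j))) / 2 ^ t"
      by (simp add: q_def field_simps)
    then show "real (Stirling h t) * fact t * (\<Sum>a\<in>UNIV. real (w a choose t))
      = (\<Sum>j\<le>t. q * ((-1) ^ j * real (C j) * (fact t * real (Stirling h t) / 2 ^ t * real ((N - j) choose (t - j)))))"
      by (simp add: sum_distrib_left sum_divide_distrib mult_ac)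
  qed
  also have "\<dots> = (\<Sum>j\<le>h. \<Sum>t=j..h. q * ((-1) ^ j * real (C j) * (fact t * real (Stirling h t) / 2 ^ t * real ((N - j) choose (t - j)))))"
  proof -
    have "(\<Sum>t\<le>h. \<Sum>j\<le>t. f t j) = (\<Sum>j\<le>h. \<Sum>t=j..h. f t j)" for f :: "nat \<Rightarrow> nat \<Rightarrow> real"
    proof -
      have "(\<Sum>t\<le>h. \<Sum>j\<le>t. f t j) = (\<Sum>t\<in>{..h}. \<Sum>j | j \<in> {..h} \<and> j \<le> t. f t j)"
        by (intro sum.cong refl) auto
      also have "\<dots> = (\<Sum>j\<in>{..h}. \<Sum>t | t \<in> {..h} \<and> j \<le> t. f t j)"
        by (rule sum.swap_restrict) auto
      also have "\<dots> = (\<Sum>j\<le>h. \<Sum>t=j..h. f t j)"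
        by (intro sum.cong refl) auto
      finally show ?thesis .
    qed
    then show ?thesis .
  qed
  also have "\<dots> = (\<Sum>j = 0..min N h. q * ((-1) ^ j * real (C j) * (\<Sum>t=j..h. fact t * real (Stirling h t) / 2 ^ t * real ((N - j) choose (t - j)))))"
  proof (rule sum.mono_neutral_cong_right)
    have "C j = 0" if "j > N" for j
    proof -
      have "zero_sum_subsets N x j = {}"
      proof (rule equals0I)
        fix S assume "S \<in> zero_sum_subsets N x j"
        then have "S \<subseteq> {..<N}" "card S = j" unfolding zero_sum_subsets_def by blast+
        then show False using card_mono[of "{..<N}" S] that by simp
      qed
      then show ?thesis by (simp add: C)
    qed
    then show "\<forall>j\<in>{..h} - {0..min N h}. (\<Sum>t=j..h. q * ((-1) ^ j * real (C j) * (fact t * real (Stirling h t) / 2 ^ t * real ((N - j) choose (t - j))))) = 0"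
      by auto
  qed (auto simp: sum_distrib_left)
  also have "\<dots> = (-1) ^ h * (A / 2) ^ h * moment_term CARD('a) A N C h"
    unfolding moment_term_def sum_distrib_left[where A = "{0..min N h}"]
  proof (intro sum.cong refl)
    fix j assume j: "j \<in> {0..min N h}"
    \<comment> \<open>For \<open>t \<le> N\<close> this is the symmetry of binomial coefficients.
      For \<open>t > N\<close> the left side is 0 by the convention for negative lower arguments,
      the right side because \<open>t - j\<close> exceeds \<open>N - j\<close>.\<close>
    have b: "binom (real N - real j) (int N - int t) = real ((N - j) choose (t - j))" if "t \<ge> j" for t
    proof (cases "t \<le> N")
      case True
      have "binom (real (N - j)) (int (N - t)) = real ((N - j) choose (N - t))" by (rule binom_of_nat)
      moreover have "(N - j) choose (N - t) = (N - j) choose (t - j)"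
        using True that j by (subst binomial_symmetric) auto
      ultimately show ?thesis using True j by (simp add: of_nat_diff)
    next
      case False
      then have "(N - j) choose (t - j) = 0" using that j by (intro binomial_eq_0) auto
      with False show ?thesis by (simp add: binom_def)
    qed
    have "(\<Sum>t=j..h. fact t * real (Stirling h t) / 2 ^ t * real ((N - j) choose (t - j)))
        = (\<Sum>t=j..h. fact t * real (Stirling h t) * 2 ^ (h - t) * binom (real N - real j) (int N - int t)) / 2 ^ h"
      unfolding sum_divide_distrib by (intro sum.cong refl) (auto simp: b power_diff)
    moreover have "q * ((-1) ^ j * c * (R / 2 ^ h)) = (-1) ^ h * (A / 2) ^ h * (real CARD('a) / A ^ h * ((-1) ^ (h + j) * c * R))"
      for c R :: real
    proof -
      have "(-1) ^ h * (-1) ^ (h + j) = ((-1) ^ j :: real)" by (simp add: power_add flip: mult.assoc power_mult_distrib)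
      moreover have "(A / 2) ^ h * (real CARD('a) / A ^ h) = q / 2 ^ h" using A by (simp add: power_divide q_def)
      moreover have "(-1) ^ h * (A / 2) ^ h * (real CARD('a) / A ^ h * ((-1) ^ (h + j) * c * R))
          = ((-1) ^ h * (-1) ^ (h + j)) * ((A / 2) ^ h * (real CARD('a) / A ^ h)) * (c * R)"
        by (simp only: mult_ac)
      ultimately show ?thesis by simp
    qed
    ultimately show "q * ((-1) ^ j * real (C j) * (\<Sum>t=j..h. fact t * real (Stirling h t) / 2 ^ t * real ((N - j) choose (t - j))))
       = (-1) ^ h * (A / 2) ^ h * (real CARD('a) / A ^ h * ((-1) ^ (h + j) * real (C j) *
           (\<Sum>t=j..h. fact t * real (Stirling h t) * 2 ^ (h - t) * binom (real N - real j) (int N - int t))))"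
      by (simp only:)
  qed
  finally have 1: "(\<Sum>a\<in>UNIV. real (w a) ^ h) = (-1) ^ h * (A / 2) ^ h * moment_term CARD('a) A N C h" .
  have "(\<Sum>a\<in>UNIV. real (w a) ^ h) = (\<Sum>a\<in>UNIV - {0}. real (w a) ^ h)"
    using w0 h by (subst sum.remove[of _ 0]) auto
  also have "\<dots> = (A / 2) ^ h * (\<Sum>a\<in>UNIV - {0}. (D - \<kappa> a) ^ h)"
    unfolding sum_distrib_left
  proof (intro sum.cong refl)
    fix a :: 'a assume "a \<in> UNIV - {0}"
    then have "real (w a) = A / 2 * (D - \<kappa> a)" by (intro w) simp
    then show "real (w a) ^ h = (A / 2) ^ h * (D - \<kappa> a) ^ h" by (simp only: power_mult_distrib)
  qed
  finally have "(\<Sum>a\<in>UNIV - {0}. (D - \<kappa> a) ^ h) = (-1) ^ h * moment_term CARD('a) A N C h"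
    using 1 A by simp
  moreover have "(\<Sum>a\<in>UNIV - {0}. (D - \<kappa> a) ^ h)
      = (\<Sum>l\<le>h. real (h choose l) * (-1) ^ l * D ^ (h - l) * (\<Sum>a\<in>UNIV - {0}. \<kappa> a ^ l))"
  proof -
    have "(D - \<kappa> a) ^ h = (\<Sum>l\<le>h. real (h choose l) * (-1) ^ l * D ^ (h - l) * \<kappa> a ^ l)" for a
      using binomial_ring[of "- \<kappa> a" D h] by (simp add: power_minus[of "\<kappa> a"] mult_ac)
    then show ?thesis by (simp add: sum_distrib_left) (rule sum.swap)
  qed
  moreover have "{..h} = insert h {..<h}" by auto
  ultimately have "(-1) ^ h * (\<Sum>a\<in>UNIV - {0}. \<kappa> a ^ h)
      + (\<Sum>l<h. real (h choose l) * (-1) ^ l * D ^ (h - l) * (\<Sum>a\<in>UNIV - {0}. \<kappa> a ^ l))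
      = (-1) ^ h * moment_term CARD('a) A N C h" by simp
  then have "(-1) ^ h * ((-1) ^ h * (\<Sum>a\<in>UNIV - {0}. \<kappa> a ^ h))
      + (-1) ^ h * (\<Sum>l<h. real (h choose l) * (-1) ^ l * D ^ (h - l) * (\<Sum>a\<in>UNIV - {0}. \<kappa> a ^ l))
      = (-1) ^ h * ((-1) ^ h * moment_term CARD('a) A N C h)" by (simp only: distrib_left[symmetric])
  moreover have sgn: "(-1) ^ h * ((-1) ^ h * y) = y" for y :: real by (simp flip: mult.assoc power_mult_distrib)
  moreover have "(-1) ^ h * (\<Sum>l<h. real (h choose l) * (-1) ^ l * D ^ (h - l) * (\<Sum>a\<in>UNIV - {0}. \<kappa> a ^ l))
      = - (\<Sum>l<h. (-1) ^ (h + l + 1) * real (h choose l) * D ^ (h - l) * (\<Sum>a\<in>UNIV - {0}. \<kappa> a ^ l))"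
    unfolding sum_distrib_left[where A = "{..<h}"] sum_negf[symmetric]
    by (intro sum.cong refl) (simp add: power_add)
  ultimately show ?thesis by (simp add: C_def D_def)
qed

end

section \<open>Matrix groups over finite fields\<close>

definition GLs :: "nat \<Rightarrow> 'a::field mat set" where
  "GLs n = {A \<in> carrier_mat n n. det A \<noteq> 0}"

lemma bij_betw_carrier_mat:
  "bij_betw (\<lambda>f. mat nr nc f) (({..<nr} \<times> {..<nc}) \<rightarrow>\<^sub>E UNIV) (carrier_mat nr nc)"
  by (rule bij_betw_byWitness[of _ "\<lambda>A. restrict (\<lambda>ij. A $$ ij) ({..<nr} \<times> {..<nc})"])
    (auto simp: PiE_def extensional_def fun_eq_iff split: prod.splits)

lemma card_carrier_mat: "card (carrier_mat nr nc :: 'a::finite mat set) = CARD('a) ^ (nr * nc)"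
  using bij_betw_same_card[OF bij_betw_carrier_mat[of nr nc, where 'a='a]]
  by (simp add: card_PiE card_cartesian_product)

lemma finite_carrier_mat [simp]: "finite (carrier_mat nr nc :: 'a::finite mat set)"
  by (rule card_ge_0_finite) (simp add: card_carrier_mat)

lemma card_carrier_vec: "card (carrier_vec n :: 'a::finite vec set) = CARD('a) ^ n"
proof -
  have "bij_betw (\<lambda>f. vec n f) ({..<n} \<rightarrow>\<^sub>E UNIV) (carrier_vec n :: 'a vec set)"
    by (rule bij_betw_byWitness[of _ "\<lambda>v. restrict (\<lambda>i. v $ i) {..<n}"])
      (auto simp: PiE_def extensional_def fun_eq_iff)
  from bij_betw_same_card[OF this] show ?thesis by (simp add: card_PiE)
qed

lemma finite_carrier_vec [simp]: "finite (carrier_vec n :: 'a::finite vec set)"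
  by (rule card_ge_0_finite) (simp add: card_carrier_vec)

lemma finite_GLs [simp]: "finite (GLs n :: 'a::{finite,field} mat set)"
  by (rule finite_subset[OF _ finite_carrier_mat]) (auto simp: GLs_def)

lemma GLs_carrier: "A \<in> GLs n \<Longrightarrow> A \<in> carrier_mat n n"
  by (simp add: GLs_def)

lemma one_in_GLs [simp]: "1\<^sub>m n \<in> GLs n"
  by (simp add: GLs_def)

lemma GLs_mult: "A \<in> GLs n \<Longrightarrow> B \<in> GLs n \<Longrightarrow> A * B \<in> GLs n"
  by (auto simp: GLs_def det_mult)

lemma GLs_transpose: "A \<in> GLs n \<Longrightarrow> transpose_mat A \<in> GLs n"
  by (auto simp: GLs_def det_transpose)

lemma GLs_I:
  assumes "A \<in> carrier_mat n n" "A' \<in> carrier_mat n n" "A * A' = 1\<^sub>m n"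
  shows "A \<in> GLs n"
proof -
  have "det A * det A' = 1" using det_mult[OF assms(1,2)] assms(3) by simp
  then show ?thesis using assms(1) by (auto simp: GLs_def)
qed

lemma GLs_ex_inverse:
  assumes "A \<in> GLs n"
  shows "\<exists>A'\<in>GLs n. A * A' = 1\<^sub>m n \<and> A' * A = 1\<^sub>m n"
proof -
  have A: "A \<in> carrier_mat n n" "det A \<noteq> 0" using assms by (auto simp: GLs_def)
  from det_non_zero_imp_unit[OF A, of undefined] obtain A' where
    "A' \<in> carrier_mat n n" "A' * A = 1\<^sub>m n" "A * A' = 1\<^sub>m n"
    by (auto simp: Units_def ring_mat_def)
  then show ?thesis using GLs_I[of A' n A] A by blast
qed

definition minv :: "'a::field mat \<Rightarrow> 'a mat" where
  "minv A = (SOME A'. A' \<in> carrier_mat (dim_row A) (dim_row A) \<and> A * A' = 1\<^sub>m (dim_row A) \<and> A' * A = 1\<^sub>m (dim_row A))"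

lemma minv:
  assumes "A \<in> GLs n"
  shows "minv A \<in> carrier_mat n n" "A * minv A = 1\<^sub>m n" "minv A * A = 1\<^sub>m n" "minv A \<in> GLs n"
proof -
  have d: "dim_row A = n" using assms by (auto simp: GLs_def)
  have "\<exists>A'. A' \<in> carrier_mat n n \<and> A * A' = 1\<^sub>m n \<and> A' * A = 1\<^sub>m n"
    using GLs_ex_inverse[OF assms] GLs_carrier by blast
  then have *: "minv A \<in> carrier_mat n n \<and> A * minv A = 1\<^sub>m n \<and> minv A * A = 1\<^sub>m n"
    unfolding minv_def d by (rule someI_ex)
  then show "minv A \<in> carrier_mat n n" "A * minv A = 1\<^sub>m n" "minv A * A = 1\<^sub>m n" by auto
  then show "minv A \<in> GLs n" using GLs_I[of "minv A" n A] GLs_carrier[OF assms] by blast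
qed

lemma minv_unique:
  assumes "A \<in> carrier_mat n n" "A' \<in> carrier_mat n n" "A * A' = 1\<^sub>m n"
  shows "minv A = A'"
proof -
  have A: "A \<in> GLs n" by (rule GLs_I[OF assms])
  have "minv A = minv A * (A * A')" using minv(1)[OF A] by (simp add: assms(3))
  also have "\<dots> = minv A * A * A'" using minv(1)[OF A] assms by (simp add: assoc_mult_mat[of _ n n _ n _ n])
  finally show ?thesis using minv(3)[OF A] assms by simp
qed

definition submat :: "'a mat \<Rightarrow> nat \<Rightarrow> nat \<Rightarrow> nat \<Rightarrow> nat \<Rightarrow> 'a mat" where
  "submat A r c nr nc = mat nr nc (\<lambda>(i, j). A $$ (r + i, c + j))"

lemma submat_carrier [simp]: "submat A r c nr nc \<in> carrier_mat nr nc"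
  by (simp add: submat_def)

lemma four_block_submat:
  assumes "A \<in> carrier_mat (n1 + n2) (m1 + m2)"
  shows "four_block_mat (submat A 0 0 n1 m1) (submat A 0 m1 n1 m2) (submat A n1 0 n2 m1) (submat A n1 m1 n2 m2) = A"
  by (rule eq_matI) (use assms in \<open>auto simp: submat_def\<close>)

lemma submat_four_block:
  assumes "A \<in> carrier_mat n1 m1" "B \<in> carrier_mat n1 m2" "C \<in> carrier_mat n2 m1" "D \<in> carrier_mat n2 m2"
  shows "submat (four_block_mat A B C D) 0 0 n1 m1 = A" "submat (four_block_mat A B C D) 0 m1 n1 m2 = B"
    "submat (four_block_mat A B C D) n1 0 n2 m1 = C" "submat (four_block_mat A B C D) n1 m1 n2 m2 = D"
  using assms by (auto intro!: eq_matI simp: submat_def)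

lemma four_block_inject:
  assumes "A \<in> carrier_mat n1 m1" "B \<in> carrier_mat n1 m2" "C \<in> carrier_mat n2 m1" "D \<in> carrier_mat n2 m2"
    and "A' \<in> carrier_mat n1 m1" "B' \<in> carrier_mat n1 m2" "C' \<in> carrier_mat n2 m1" "D' \<in> carrier_mat n2 m2"
  shows "four_block_mat A B C D = four_block_mat A' B' C' D' \<longleftrightarrow> A = A' \<and> B = B' \<and> C = C' \<and> D = D'"
  using submat_four_block[OF assms(1-4)] submat_four_block[OF assms(5-8)] by metis

lemma det_1x1: "A \<in> carrier_mat 1 1 \<Longrightarrow> det A = A $$ (0, 0)"
  by (simp add: det_single)

text \<open>Transitivity of \<open>GL\<close> on nonzero vectors. If the first entry of the column
  is nonzero, a lower triangular matrix does it; otherwise a row swap moves a nonzero entry to the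
  top.\<close>

lemma ex_GLs_first_col:
  fixes v :: "'a::field vec"
  assumes v: "v \<in> carrier_vec (1 + n)" "v \<noteq> 0\<^sub>v (1 + n)"
  shows "\<exists>g\<in>GLs (1 + n). col g 0 = v"
proof -
  have nz: "\<exists>g\<in>GLs (1 + n). col g 0 = w" if w: "w \<in> carrier_vec (1 + n)" "w $ 0 \<noteq> 0" for w :: "'a vec"
  proof -
    let ?g = "four_block_mat (mat 1 1 (\<lambda>_. w $ 0)) (0\<^sub>m 1 n) (mat n 1 (\<lambda>(i, j). w $ (Suc i))) (1\<^sub>m n)"
    have "det ?g = det (mat 1 1 (\<lambda>_. w $ 0)) * det (1\<^sub>m n :: 'a mat)"
      by (rule det_four_block_mat_upper_right_zero) auto
    then have "det ?g \<noteq> 0" using w by (simp add: det_1x1)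
    moreover have "?g \<in> carrier_mat (1 + n) (1 + n)" by (rule four_block_carrier_mat) auto
    moreover have "col ?g 0 = w"
      by (rule eq_vecI) (use w in auto)
    ultimately show ?thesis unfolding GLs_def by blast
  qed
  show ?thesis
  proof (cases "v $ 0 = 0")
    case False
    then show ?thesis using nz v by blast
  next
    case True
    have "\<exists>k<1 + n. v $ k \<noteq> 0"
    proof (rule ccontr)
      assume "\<not> (\<exists>k<1 + n. v $ k \<noteq> 0)"
      then have "v = 0\<^sub>v (1 + n)" using v(1) by (intro eq_vecI) auto
      with v(2) show False by simp
    qed
    then obtain k where k: "k < 1 + n" "v $ k \<noteq> 0" by blast
    with True have k0: "0 \<noteq> k" by metis
    define w where "w = vec (1 + n) (\<lambda>i. if i = 0 then v $ k else if i = k then v $ 0 else v $ i)"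
    obtain g where g: "g \<in> GLs (1 + n)" "col g 0 = w" using nz[of w] k by (auto simp: w_def)
    have gc: "g \<in> carrier_mat (1 + n) (1 + n)" using g(1) by (rule GLs_carrier)
    have ent: "g $$ (i, 0) = w $ i" if "i < 1 + n" for i
      using g(2) gc that by (metis carrier_matD index_col zero_less_one add_is_0 less_add_same_cancel1 neq0_conv le_less_trans le0)
    have "det (swaprows 0 k g) = - det g" by (rule det_swaprows[OF _ k(1) k0 gc]) simp
    then have "swaprows 0 k g \<in> GLs (1 + n)" using g(1) gc by (auto simp: GLs_def)
    moreover have "col (swaprows 0 k g) 0 = v"
      by (rule eq_vecI) (use v gc k k0 in \<open>auto simp: ent w_def\<close>)
    ultimately show ?thesis by blast
  qed
qed

lemma bij_betw_GLs_col:
  assumes g: "g \<in> GLs n" and w: "w \<in> carrier_vec n" and n: "0 < n"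
  shows "bij_betw (\<lambda>A. g * A) {A \<in> GLs n. col A 0 = w} {A \<in> GLs n. col A 0 = g *\<^sub>v w}"
proof (rule bij_betw_byWitness[of _ "\<lambda>A. minv g * A"])
  note gc = GLs_carrier[OF g] minv[OF g]
  have col: "col (h * A) 0 = h *\<^sub>v col A 0" if "h \<in> carrier_mat n n" "A \<in> GLs n" for h A
    using that n GLs_carrier by (intro col_mult2) auto
  have inv1: "minv g * (g * A) = A" if "A \<in> GLs n" for A
    using gc GLs_carrier[OF that] by (simp flip: assoc_mult_mat[of _ n n _ n _ n])
  have inv2: "g * (minv g * A) = A" if "A \<in> GLs n" for A
    using gc GLs_carrier[OF that] by (simp flip: assoc_mult_mat[of _ n n _ n _ n])
  show "\<forall>A\<in>{A \<in> GLs n. col A 0 = w}. minv g * (g * A) = A" using inv1 by blast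
  show "\<forall>A\<in>{A \<in> GLs n. col A 0 = g *\<^sub>v w}. g * (minv g * A) = A" using inv2 by blast
  show "(\<lambda>A. g * A) ` {A \<in> GLs n. col A 0 = w} \<subseteq> {A \<in> GLs n. col A 0 = g *\<^sub>v w}"
    using col[OF gc(1)] GLs_mult[OF g] by auto
  have "minv g *\<^sub>v (g *\<^sub>v w) = w"
    using gc w by (simp flip: assoc_mult_mat_vec[of _ n n _ n])
  then show "(\<lambda>A. minv g * A) ` {A \<in> GLs n. col A 0 = g *\<^sub>v w} \<subseteq> {A \<in> GLs n. col A 0 = w}"
    using col[OF gc(2)] GLs_mult[OF gc(5)] by auto
qed

lemma mult_unit_vec_eq_col:
  fixes A :: "'a::field mat"
  assumes "A \<in> carrier_mat n m" "j < m"
  shows "A *\<^sub>v unit_vec m j = col A j"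
  using assms by (intro eq_vecI) (auto simp: scalar_prod_right_unit)

lemma GLs_first_col_unit:
  "{A \<in> GLs (1 + n). col A 0 = unit_vec (1 + n) 0} =
     (\<lambda>(R, A'). four_block_mat (1\<^sub>m 1) R (0\<^sub>m n 1) A') ` (carrier_mat 1 n \<times> (GLs n :: 'a::field mat set))"
  (is "?L = ?R")
proof (intro equalityI subsetI)
  fix A :: "'a mat" assume "A \<in> ?L"
  then have A: "A \<in> carrier_mat (1 + n) (1 + n)" "det A \<noteq> 0" "col A 0 = unit_vec (1 + n) 0"
    by (auto simp: GLs_def)
  have ent: "A $$ (i, 0) = (if i = 0 then 1 else 0)" if "i < 1 + n" for i
  proof -
    have "A $$ (i, 0) = col A 0 $ i" using A(1) that by simp
    then show ?thesis using A(3) that by simp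
  qed
  have "submat A 0 0 1 1 = 1\<^sub>m 1" "submat A 1 0 n 1 = 0\<^sub>m n 1"
    by (auto intro!: eq_matI simp: submat_def ent)
  then have eq: "A = four_block_mat (1\<^sub>m 1) (submat A 0 1 1 n) (0\<^sub>m n 1) (submat A 1 1 n n)"
    using four_block_submat[OF A(1)] by simp
  have "det A = det (1\<^sub>m 1 :: 'a mat) * det (submat A 1 1 n n)"
    by (subst eq, rule det_four_block_mat_lower_left_zero) auto
  then have "submat A 1 1 n n \<in> GLs n" using A(2) by (simp add: GLs_def)
  then show "A \<in> ?R" using eq by (intro image_eqI[of _ _ "(submat A 0 1 1 n, submat A 1 1 n n)"]) auto
next
  fix A :: "'a mat" assume "A \<in> ?R"
  then obtain R A' where R: "R \<in> carrier_mat 1 n" and A': "A' \<in> GLs n"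
    and A: "A = four_block_mat (1\<^sub>m 1) R (0\<^sub>m n 1) A'" by auto
  note A'c = GLs_carrier[OF A']
  have "det A = det (1\<^sub>m 1 :: 'a mat) * det A'"
    unfolding A by (rule det_four_block_mat_lower_left_zero) (use R A'c in auto)
  moreover have "A \<in> carrier_mat (1 + n) (1 + n)"
    unfolding A by (rule four_block_carrier_mat) (use A'c in auto)
  moreover have "col A 0 = unit_vec (1 + n) 0"
    unfolding A by (rule eq_vecI) (use R A'c in auto)
  ultimately show "A \<in> ?L" using A' by (simp add: GLs_def)
qed

text \<open>The matrices are sorted by their first column, a nonzero vector. By transitivity all
  fibres are as large as the one over the first unit vector, where the remaining first row is free
  and the lower block is in \<open>GLs n\<close>.\<close>

lemma card_GLs_Suc:
  "card (GLs (1 + n) :: 'a::{finite,field} mat set) = (CARD('a) ^ (1 + n) - 1) * CARD('a) ^ n * card (GLs n :: 'a mat set)"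
proof -
  let ?V = "carrier_vec (1 + n) - {0\<^sub>v (1 + n)} :: 'a vec set"
  let ?F = "\<lambda>v. {A \<in> GLs (1 + n) :: 'a mat set. col A 0 = v}"
  have e: "unit_vec (1 + n) 0 \<in> carrier_vec (1 + n)" by simp
  have base: "card (?F (unit_vec (1 + n) 0)) = CARD('a) ^ n * card (GLs n :: 'a mat set)"
  proof -
    have "inj_on (\<lambda>(R, A'). four_block_mat (1\<^sub>m 1) R (0\<^sub>m n 1) A') (carrier_mat 1 n \<times> (GLs n :: 'a mat set))"
    proof (rule inj_onI, clarify)
      fix R A R' A' :: "'a mat"
      assume *: "R \<in> carrier_mat 1 n" "R' \<in> carrier_mat 1 n" "A \<in> GLs n" "A' \<in> GLs n"
        and "four_block_mat (1\<^sub>m 1) R (0\<^sub>m n 1) A = four_block_mat (1\<^sub>m 1) R' (0\<^sub>m n 1) A'"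
      then show "R = R' \<and> A = A'"
        using four_block_inject[of "1\<^sub>m 1" 1 1 R n "0\<^sub>m n 1" n A "1\<^sub>m 1" R' "0\<^sub>m n 1" A'] GLs_carrier by auto
    qed
    then show ?thesis unfolding GLs_first_col_unit
      by (subst card_image) (simp_all add: card_cartesian_product card_carrier_mat)
  qed
  have "GLs (1 + n) = (\<Union>v\<in>?V. ?F v)"
  proof (intro equalityI subsetI)
    fix A :: "'a mat" assume A: "A \<in> GLs (1 + n)"
    then have Ac: "A \<in> carrier_mat (1 + n) (1 + n)" by (rule GLs_carrier)
    have "col A 0 \<noteq> 0\<^sub>v (1 + n)"
    proof
      assume "col A 0 = 0\<^sub>v (1 + n)"
      then have "A *\<^sub>v unit_vec (1 + n) 0 = 0\<^sub>v (1 + n)" using mult_unit_vec_eq_col[OF Ac, of 0] by simp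
      then have "det A = 0"
        unfolding det_0_iff_vec_prod_zero[OF Ac] using e unit_vec_nonzero[of 0 "1 + n"]
        by (intro exI[of _ "unit_vec (1 + n) 0"]) auto
      then show False using A by (simp add: GLs_def)
    qed
    moreover have "col A 0 \<in> carrier_vec (1 + n)" using Ac by (intro carrier_vecI) simp
    ultimately show "A \<in> (\<Union>v\<in>?V. ?F v)" using A by blast
  qed auto
  then have "card (GLs (1 + n) :: 'a mat set) = card (\<Union>v\<in>?V. ?F v)" by simp
  also have "\<dots> = (\<Sum>v\<in>?V. card (?F v))"
    by (rule card_UN_disjoint) auto
  also have "\<dots> = (\<Sum>v\<in>?V. CARD('a) ^ n * card (GLs n :: 'a mat set))"
  proof (rule sum.cong[OF refl])
    fix v :: "'a vec" assume "v \<in> ?V"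
    then obtain g where g: "g \<in> GLs (1 + n)" "col g 0 = v" using ex_GLs_first_col by blast
    have "g *\<^sub>v unit_vec (1 + n) 0 = v" using mult_unit_vec_eq_col[OF GLs_carrier[OF g(1)], of 0] g(2) by simp
    then have "card (?F v) = card (?F (unit_vec (1 + n) 0))"
      using bij_betw_same_card[OF bij_betw_GLs_col[OF g(1) e]] by simp
    then show "card (?F v) = CARD('a) ^ n * card (GLs n :: 'a mat set)" using base by simp
  qed
  also have "\<dots> = card ?V * (CARD('a) ^ n * card (GLs n :: 'a mat set))" by simp
  also have "card ?V = CARD('a) ^ (1 + n) - 1" by (subst card_Diff_singleton) (auto simp: card_carrier_vec)
  finally show ?thesis by (simp add: mult.assoc)
qed

lemma card_GLs_0: "card (GLs 0 :: 'a::field mat set) = 1"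
proof -
  have "GLs 0 = {1\<^sub>m 0 :: 'a mat}" by (auto simp: GLs_def intro!: eq_matI)
  then show ?thesis by simp
qed

text \<open>The set \<open>S\<close> of upper left blocks is a parameter because two instances are
  needed: all of \<open>GLs s\<close>, for the stabiliser, and the invertible alternating matrices,
  for those \<open>A\<close> on which the trace does not depend on \<open>B\<close>.\<close>

lemma GLs_upper_right_zero:
  fixes S :: "'a::field mat set"
  assumes "S \<subseteq> GLs s"
  shows "{A \<in> GLs (s + k). submat A 0 s s k = 0\<^sub>m s k \<and> submat A 0 0 s s \<in> S} =
    (\<lambda>(A1, A3, A4). four_block_mat A1 (0\<^sub>m s k) A3 A4) ` (S \<times> carrier_mat k s \<times> GLs k)" (is "?L = ?R")
    and "inj_on (\<lambda>(A1, A3, A4). four_block_mat A1 (0\<^sub>m s k) A3 A4) (S \<times> carrier_mat k s \<times> GLs k)"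
proof -
  show "?L = ?R"
  proof (intro equalityI subsetI)
    fix A assume "A \<in> ?L"
    then have A: "A \<in> carrier_mat (s + k) (s + k)" "det A \<noteq> 0" "submat A 0 s s k = 0\<^sub>m s k" "submat A 0 0 s s \<in> S"
      by (auto simp: GLs_def)
    have eq: "A = four_block_mat (submat A 0 0 s s) (0\<^sub>m s k) (submat A s 0 k s) (submat A s s k k)"
      using four_block_submat[OF A(1)] A(3) by simp
    have "det A = det (submat A 0 0 s s) * det (submat A s s k k)"
      by (subst eq, rule det_four_block_mat_upper_right_zero) auto
    then have "submat A s s k k \<in> GLs k" using A(2) by (simp add: GLs_def)
    then show "A \<in> ?R" using eq A(4)
      by (intro image_eqI[of _ _ "(submat A 0 0 s s, submat A s 0 k s, submat A s s k k)"]) auto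
  next
    fix A assume "A \<in> ?R"
    then obtain A1 A3 A4 where *: "A1 \<in> S" "A3 \<in> carrier_mat k s" "A4 \<in> GLs k"
      and A: "A = four_block_mat A1 (0\<^sub>m s k) A3 A4" by auto
    have c: "A1 \<in> carrier_mat s s" "A4 \<in> carrier_mat k k" "A1 \<in> GLs s" using * assms GLs_carrier by blast+
    have "det A = det A1 * det A4"
      unfolding A by (rule det_four_block_mat_upper_right_zero) (use c * in auto)
    moreover have "A \<in> carrier_mat (s + k) (s + k)"
      unfolding A by (rule four_block_carrier_mat) (use c in auto)
    moreover have "submat A 0 s s k = 0\<^sub>m s k" "submat A 0 0 s s = A1"
      unfolding A using submat_four_block[OF c(1) _ *(2) c(2), of "0\<^sub>m s k"] by auto
    ultimately show "A \<in> ?L" using * c by (simp add: GLs_def)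
  qed
  show "inj_on (\<lambda>(A1, A3, A4). four_block_mat A1 (0\<^sub>m s k) A3 A4) (S \<times> carrier_mat k s \<times> GLs k)"
  proof (rule inj_onI)
    fix x y
    assume x: "x \<in> S \<times> carrier_mat k s \<times> GLs k" and y: "y \<in> S \<times> carrier_mat k s \<times> GLs k"
      and eq: "(\<lambda>(A1, A3, A4). four_block_mat A1 (0\<^sub>m s k) A3 A4) x = (\<lambda>(A1, A3, A4). four_block_mat A1 (0\<^sub>m s k) A3 A4) y"
    obtain A1 A3 A4 B1 B3 B4 where xy: "x = (A1, A3, A4)" "y = (B1, B3, B4)" by (metis surj_pair)
    have "A1 \<in> carrier_mat s s" "B1 \<in> carrier_mat s s" "A4 \<in> carrier_mat k k" "B4 \<in> carrier_mat k k"
      using x y xy assms GLs_carrier by blast+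
    then show "x = y"
      using eq x y four_block_inject[of A1 s s "0\<^sub>m s k" k A3 k A4 B1 "0\<^sub>m s k" B3 B4] by (auto simp: xy)
  qed
qed

lemma card_GLs_upper_right_zero:
  fixes S :: "'a::{finite,field} mat set"
  assumes "S \<subseteq> GLs s"
  shows "card {A \<in> GLs (s + k). submat A 0 s s k = 0\<^sub>m s k \<and> submat A 0 0 s s \<in> S} =
    card S * CARD('a) ^ (k * s) * card (GLs k :: 'a mat set)"
  unfolding GLs_upper_right_zero(1)[OF assms] card_image[OF GLs_upper_right_zero(2)[OF assms]]
  by (simp add: card_cartesian_product card_carrier_mat mult.assoc)

text \<open>With \<open>s = 0\<close> the block condition is void and all symmetric matrices remain,
  which is the unipotent part of \<open>P\<close>; with \<open>s\<close> the block size of sigma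
  these are the \<open>B\<close> whose conjugate stays in \<open>P\<close>.\<close>

definition sym_mats :: "nat \<Rightarrow> nat \<Rightarrow> 'a::zero mat set" where
  "sym_mats n s = {B \<in> carrier_mat n n. transpose_mat B = B \<and> submat B 0 0 s s = 0\<^sub>m s s}"

text \<open>A symmetric matrix is given by its lower triangle including the diagonal; the vanishing
  block removes exactly the first \<open>s\<close> rows of it.\<close>

lemma card_sym_mats:
  assumes "s \<le> n"
  shows "card (sym_mats n s :: 'a::{finite,zero} mat set) = CARD('a) ^ (n * (n + 1) div 2 - s * (s + 1) div 2)"
proof -
  let ?I = "SIGMA i:{s..<n}. {..i}"
  define lower :: "'a mat \<Rightarrow> nat \<times> nat \<Rightarrow> 'a" where "lower B = restrict (\<lambda>ij. B $$ ij) ?I" for B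
  define symm :: "(nat \<times> nat \<Rightarrow> 'a) \<Rightarrow> 'a mat" where
    "symm f = mat n n (\<lambda>(i, j). if i < s \<and> j < s then 0 else if j \<le> i then f (i, j) else f (j, i))" for f
  have "bij_betw lower (sym_mats n s) (?I \<rightarrow>\<^sub>E (UNIV :: 'a set))"
  proof (rule bij_betw_byWitness[of _ symm])
    show "\<forall>B\<in>sym_mats n s. symm (lower B) = B"
    proof
      fix B :: "'a mat" assume "B \<in> sym_mats n s"
      then have B: "B \<in> carrier_mat n n" "transpose_mat B = B" "submat B 0 0 s s = 0\<^sub>m s s" by (auto simp: sym_mats_def)
      have z: "B $$ (i, j) = 0" if "i < s" "j < s" for i j
      proof -
        have "submat B 0 0 s s $$ (i, j) = 0" using that B(3) by simp
        then show ?thesis using that by (simp add: submat_def)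
      qed
      have sym: "B $$ (j, i) = B $$ (i, j)" if "i < j" "j < n" for i j
      proof -
        have "transpose_mat B $$ (i, j) = B $$ (j, i)" using that B(1) by simp
        then show ?thesis using B(2) by simp
      qed
      show "symm (lower B) = B"
        by (rule eq_matI) (use B z sym in \<open>auto simp: symm_def lower_def not_less not_le\<close>)
    qed
    show "\<forall>f\<in>?I \<rightarrow>\<^sub>E UNIV. lower (symm f) = f"
    proof
      fix f :: "nat \<times> nat \<Rightarrow> 'a" assume "f \<in> ?I \<rightarrow>\<^sub>E UNIV"
      then have f: "f x = undefined" if "x \<notin> ?I" for x using that by (rule PiE_arb)
      show "lower (symm f) = f"
      proof
        fix x
        show "lower (symm f) x = f x"
          using f[of x] by (cases "x \<in> ?I") (auto simp: lower_def symm_def)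
      qed
    qed
    show "lower ` sym_mats n s \<subseteq> ?I \<rightarrow>\<^sub>E (UNIV :: 'a set)" by (auto simp: lower_def split: if_splits)
    show "symm ` (?I \<rightarrow>\<^sub>E (UNIV :: 'a set)) \<subseteq> sym_mats n s"
      using assms by (auto simp: sym_mats_def submat_def symm_def intro!: eq_matI)
  qed
  then have "card (sym_mats n s :: 'a mat set) = CARD('a) ^ card ?I"
    by (simp add: bij_betw_same_card card_PiE)
  also have "card ?I = n * (n + 1) div 2 - s * (s + 1) div 2"
  proof -
    have triangular: "(\<Sum>i\<in>{0..<m}. i + 1) = m * (m + 1) div 2" for m :: nat
      by (induction m) auto
    have "card ?I = (\<Sum>i\<in>{s..<n}. i + 1)" by simp
    also have "\<dots> = (\<Sum>i\<in>{0..<n}. i + 1) - (\<Sum>i\<in>{0..<s}. i + 1)"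
      using sum.atLeastLessThan_concat[of 0 s n "\<lambda>i. i + 1"] assms by simp
    also have "\<dots> = n * (n + 1) div 2 - s * (s + 1) div 2" by (simp only: triangular)
    finally show ?thesis .
  qed
  finally show ?thesis .
qed

section \<open>Invertible alternating matrices in characteristic two\<close>

context char2_field
begin

text \<open>These are the alternating matrices. In characteristic 2 skew symmetry is symmetry, so
  the zero diagonal is a genuine extra condition.\<close>

definition alt_mats :: "nat \<Rightarrow> 'a mat set" where
  "alt_mats n = {M \<in> carrier_mat n n. (\<forall>i<n. M $$ (i, i) = 0) \<and> (\<forall>i<n. \<forall>j<n. M $$ (i, j) = M $$ (j, i))}"

definition alt_GLs :: "nat \<Rightarrow> 'a mat set" where
  "alt_GLs n = alt_mats n \<inter> GLs n"

lemma mat_add_self: "A \<in> carrier_mat n m \<Longrightarrow> A + A = (0\<^sub>m n m :: 'a mat)"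
  by (rule eq_matI) (auto simp: add_self)

lemma mat_add_eq_0_iff:
  assumes "A \<in> carrier_mat n m" "B \<in> carrier_mat n m"
  shows "A + B = 0\<^sub>m n m \<longleftrightarrow> A = (B :: 'a mat)"
proof
  assume "A + B = 0\<^sub>m n m"
  then have "(A + B) $$ (i, j) = 0" if "i < n" "j < m" for i j using that by simp
  then show "A = B" using assms by (intro eq_matI) (auto simp: add_eq_0_iff2)
qed (use assms mat_add_self in auto)

text \<open>The strictly lower triangular part serves as \<open>N\<close>. In this form invariance
  under congruence needs no look at entries.\<close>

lemma alt_mats_iff: "M \<in> alt_mats n \<longleftrightarrow> (\<exists>N\<in>carrier_mat n n. M = N + transpose_mat N)"
proof
  assume M: "M \<in> alt_mats n"
  let ?N = "mat n n (\<lambda>(i, j). if j < i then M $$ (i, j) else 0)"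
  have "M = ?N + transpose_mat ?N"
    by (rule eq_matI) (use M in \<open>auto simp: alt_mats_def not_less dest!: le_neq_implies_less\<close>)
  then show "\<exists>N\<in>carrier_mat n n. M = N + transpose_mat N" by (intro bexI[of _ ?N]) auto
qed (auto simp: alt_mats_def add_self add.commute)

lemma alt_mats_congruence:
  assumes "M \<in> alt_mats n" "G \<in> carrier_mat n n"
  shows "G * M * transpose_mat G \<in> alt_mats n"
proof -
  obtain N where N: "N \<in> carrier_mat n n" "M = N + transpose_mat N" using assms(1) alt_mats_iff by blast
  have "G * M * transpose_mat G = G * N * transpose_mat G + G * transpose_mat N * transpose_mat G"
    using N assms(2) by (simp add: mult_add_distrib_mat[of _ n n] add_mult_distrib_mat[of _ n n])
  also have "G * transpose_mat N * transpose_mat G = transpose_mat (G * N * transpose_mat G)"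
    using N assms(2) by (simp add: transpose_mult[of _ n n _ n] assoc_mult_mat[of _ n n _ n _ n])
  finally show ?thesis unfolding alt_mats_iff using N assms(2) by (intro bexI[of _ "G * N * transpose_mat G"]) auto
qed

lemma alt_GLs_congruence:
  assumes "M \<in> alt_GLs n" "G \<in> GLs n"
  shows "G * M * transpose_mat G \<in> alt_GLs n"
proof -
  have "G * M * transpose_mat G \<in> GLs n"
    using assms by (intro GLs_mult GLs_transpose) (simp_all add: alt_GLs_def)
  moreover have "G * M * transpose_mat G \<in> alt_mats n"
    using assms GLs_carrier[OF assms(2)] by (intro alt_mats_congruence) (simp_all add: alt_GLs_def)
  ultimately show ?thesis by (simp add: alt_GLs_def)
qed

text \<open>The condition on the first row makes congruence by \<open>G\<close> act on first columns
  as plain multiplication by \<open>G\<close>. The condition on column 1 moves the unit vector with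
  index 1, the model first column of an alternating matrix, to the prescribed one.\<close>

lemma ex_GLs_fix_row:
  assumes "v \<in> carrier_vec (1 + n)" "v \<noteq> 0\<^sub>v (1 + n)"
  shows "\<exists>G\<in>GLs (2 + n). row G 0 = unit_vec (2 + n) 0 \<and> col G 1 = vCons 0 (v :: 'a vec)"
proof -
  obtain g where g: "g \<in> GLs (1 + n)" "col g 0 = v" using ex_GLs_first_col[OF assms] by blast
  have gc: "g \<in> carrier_mat (1 + n) (1 + n)" using g(1) by (rule GLs_carrier)
  let ?G = "four_block_mat (1\<^sub>m 1) (0\<^sub>m 1 (1 + n)) (0\<^sub>m (1 + n) 1) g"
  have c: "?G \<in> carrier_mat (1 + (1 + n)) (1 + (1 + n))" by (rule four_block_carrier_mat) (use gc in auto)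
  have "det ?G = det (1\<^sub>m 1 :: 'a mat) * det g"
    by (rule det_four_block_mat_lower_left_zero) (use gc in auto)
  then have "?G \<in> GLs (2 + n)" using c g(1) by (simp add: GLs_def)
  moreover have "row ?G 0 = unit_vec (2 + n) 0"
    by (rule eq_vecI) (use gc in auto)
  moreover have "g $$ (i, 0) = v $ i" if "i < 1 + n" for i
  proof -
    have "col g 0 $ i = g $$ (i, 0)" using gc that by simp
    then show ?thesis using g(2) by simp
  qed
  then have "col ?G 1 = vCons 0 v"
    by (intro eq_vecI) (use gc assms in \<open>auto simp: vec_index_vCons\<close>)
  ultimately show ?thesis by blast
qed

lemma bij_betw_alt_GLs_col:
  assumes G: "G \<in> GLs n" "row G 0 = unit_vec n 0" and n: "0 < n" and w: "w \<in> carrier_vec n"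
  shows "bij_betw (\<lambda>M. G * M * transpose_mat G) {M \<in> alt_GLs n. col M 0 = w} {M \<in> alt_GLs n. col M 0 = G *\<^sub>v w}"
proof (rule bij_betw_byWitness[of _ "\<lambda>M. minv G * M * transpose_mat (minv G)"])
  note Gc = GLs_carrier[OF G(1)] minv[OF G(1)]
  have tr1: "transpose_mat G * transpose_mat (minv G) = 1\<^sub>m n" "transpose_mat (minv G) * transpose_mat G = 1\<^sub>m n"
    using Gc by (simp_all flip: transpose_mult[of _ n n _ n])
  have cancel: "A * (B * M * transpose_mat B) * transpose_mat A = M"
    if "A \<in> carrier_mat n n" "B \<in> carrier_mat n n" "M \<in> carrier_mat n n" "A * B = 1\<^sub>m n"
      "transpose_mat B * transpose_mat A = 1\<^sub>m n" for A B M :: "'a mat"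
  proof -
    have "A * (B * M * transpose_mat B) * transpose_mat A = (A * B) * M * (transpose_mat B * transpose_mat A)"
      using that(1-3) by (simp add: assoc_mult_mat[of _ n n _ n _ n])
    then show ?thesis using that by simp
  qed
  have carr: "M \<in> carrier_mat n n" if "M \<in> alt_GLs n" for M using that by (auto simp: alt_GLs_def GLs_def)
  \<comment> \<open>The inverse map is congruence by \<open>minv G\<close>, which must satisfy the
    same row condition. Multiplying by \<open>G\<close> on the left does not change row 0, and
    \<open>G * minv G\<close> is the identity.\<close>
  have row': "row (minv G) 0 = unit_vec n 0"
  proof -
    have "row (G * minv G) 0 = row (minv G) 0"
    proof (rule eq_vecI)
      fix j assume "j < dim_vec (row (minv G) 0)"
      then have j: "j < n" using Gc by auto
      then have "row (G * minv G) 0 $ j = (G * minv G) $$ (0, j)" using Gc(1,2) n by (intro index_row) auto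
      also have "\<dots> = row G 0 \<bullet> col (minv G) j" using Gc(1,2) n j by (intro index_mult_mat) auto
      also have "\<dots> = minv G $$ (0, j)" using Gc j n by (simp add: G(2) scalar_prod_left_unit)
      finally show "row (G * minv G) 0 $ j = row (minv G) 0 $ j" using Gc j n by simp
    qed (use Gc in auto)
    then show ?thesis using Gc n by simp
  qed
  have col: "col (H * M * transpose_mat H) 0 = H *\<^sub>v col M 0"
    if H: "H \<in> carrier_mat n n" "row H 0 = unit_vec n 0" and M: "M \<in> carrier_mat n n" for H M :: "'a mat"
  proof -
    have "col (H * M * transpose_mat H) 0 = (H * M) *\<^sub>v col (transpose_mat H) 0"
      using H M n by (intro col_mult2[of _ n n _ n]) auto
    also have "col (transpose_mat H) 0 = unit_vec n 0" using H n by simp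
    also have "(H * M) *\<^sub>v unit_vec n 0 = col (H * M) 0" using H M n by (intro mult_unit_vec_eq_col) auto
    also have "\<dots> = H *\<^sub>v col M 0" using H M n by (intro col_mult2[of _ n n _ n]) auto
    finally show ?thesis .
  qed
  show "\<forall>M\<in>{M \<in> alt_GLs n. col M 0 = w}. minv G * (G * M * transpose_mat G) * transpose_mat (minv G) = M"
    using cancel[OF Gc(2,1) carr] Gc tr1 by auto
  show "\<forall>M\<in>{M \<in> alt_GLs n. col M 0 = G *\<^sub>v w}. G * (minv G * M * transpose_mat (minv G)) * transpose_mat G = M"
    using cancel[OF Gc(1,2) carr] Gc tr1 by auto
  show "(\<lambda>M. G * M * transpose_mat G) ` {M \<in> alt_GLs n. col M 0 = w} \<subseteq> {M \<in> alt_GLs n. col M 0 = G *\<^sub>v w}"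
    using alt_GLs_congruence[OF _ G(1)] col[OF Gc(1) G(2) carr] by auto
  have "minv G *\<^sub>v (G *\<^sub>v w) = w"
    using Gc w by (simp flip: assoc_mult_mat_vec[of _ n n _ n])
  then show "(\<lambda>M. minv G * M * transpose_mat (minv G)) ` {M \<in> alt_GLs n. col M 0 = G *\<^sub>v w} \<subseteq> {M \<in> alt_GLs n. col M 0 = w}"
    using alt_GLs_congruence[OF _ Gc(5)] col[OF Gc(2) row' carr] by auto
qed

text \<open>General form of a symmetric matrix of size \<open>2 + n\<close> whose first column is
  the unit vector with index 1 and whose entry at (1, 1) is zero; the column \<open>U\<close> is
  unconstrained.\<close>

definition border :: "nat \<Rightarrow> 'a mat \<Rightarrow> 'a mat \<Rightarrow> 'a mat" where
  "border n U M = mat (2 + n) (2 + n) (\<lambda>(i, j).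
     if i = 0 then of_bool (j = 1)
     else if i = 1 then (if j = 0 then 1 else if j = 1 then 0 else U $$ (j - 2, 0))
     else if j = 0 then 0 else if j = 1 then U $$ (i - 2, 0) else M $$ (i - 2, j - 2))"

text \<open>Exchanging the first two rows makes the matrix block triangular with two leading ones,
  so only \<open>M\<close> and one sign remain.\<close>

lemma det_border:
  assumes "U \<in> carrier_mat n 1" "M \<in> carrier_mat n n"
  shows "det (border n U M) = - det M"
proof -
  let ?X = "four_block_mat (1\<^sub>m 1) (0\<^sub>m 1 n) U M"
  let ?R = "mat 1 (1 + n) (\<lambda>(i, j). if j = 0 then 0 else U $$ (j - 1, 0))"
  let ?Y = "four_block_mat (1\<^sub>m 1) ?R (0\<^sub>m (1 + n) 1) ?X"
  have X: "?X \<in> carrier_mat (1 + n) (1 + n)" by (rule four_block_carrier_mat) (use assms in auto)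
  then have Y: "?Y \<in> carrier_mat (1 + (1 + n)) (1 + (1 + n))" by (rule four_block_carrier_mat[OF one_carrier_mat])
  have "border n U M = swaprows 0 1 ?Y"
    by (rule eq_matI) (use assms in \<open>auto simp: border_def numeral_2_eq_2\<close>)
  then have "det (border n U M) = - det ?Y"
    by (simp only:) (rule det_swaprows[OF _ _ _ Y], auto)
  also have "det ?Y = det (1\<^sub>m 1 :: 'a mat) * det ?X"
    by (rule det_four_block_mat_lower_left_zero) (use X in auto)
  also have "det ?X = det (1\<^sub>m 1 :: 'a mat) * det M"
    by (rule det_four_block_mat_upper_right_zero) (use assms in auto)
  finally show ?thesis by simp
qed

lemma submat_border:
  assumes "U \<in> carrier_mat n 1" "M \<in> carrier_mat n n"
  shows "submat (border n U M) 2 1 n 1 = U" "submat (border n U M) 2 2 n n = M"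
  using assms by (auto intro!: eq_matI simp: submat_def border_def)

lemma alt_GLs_first_col_unit:
  "{M \<in> alt_GLs (2 + n). col M 0 = unit_vec (2 + n) 1} = (\<lambda>(U, M). border n U M) ` (carrier_mat n 1 \<times> alt_GLs n)"
  (is "?L = ?R")
proof (intro equalityI subsetI)
  fix M assume "M \<in> ?L"
  then have M: "M \<in> carrier_mat (2 + n) (2 + n)" "det M \<noteq> 0" "col M 0 = unit_vec (2 + n) 1"
    and alt: "\<And>i. i < 2 + n \<Longrightarrow> M $$ (i, i) = 0" "\<And>i j. i < 2 + n \<Longrightarrow> j < 2 + n \<Longrightarrow> M $$ (i, j) = M $$ (j, i)"
    by (auto simp: alt_GLs_def alt_mats_def GLs_def)
  have c0: "M $$ (i, 0) = of_bool (i = 1)" if "i < 2 + n" for i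
  proof -
    have "M $$ (i, 0) = col M 0 $ i" using M(1) that by simp
    then show ?thesis using M(3) that by simp
  qed
  let ?U = "submat M 2 1 n 1" and ?M = "submat M 2 2 n n"
  have eq: "M = border n ?U ?M"
  proof (rule eq_matI)
    fix i j assume "i < dim_row (border n ?U ?M)" "j < dim_col (border n ?U ?M)"
    then have ij: "i < 2 + n" "j < 2 + n" by (auto simp: border_def)
    have r0: "M $$ (0, j) = of_bool (j = 1)" using c0[OF ij(2)] alt(2)[of 0 j] ij by simp
    have r1: "M $$ (1, j) = M $$ (j, 1)" using alt(2)[of 1 j] ij by simp
    have shift: "Suc (Suc (l - 2)) = l" if "l \<noteq> 0" "l \<noteq> Suc 0" for l using that by simp
    show "M $$ (i, j) = border n ?U ?M $$ (i, j)"
      using ij r0 r1 c0[OF ij(1)] c0[of 1] alt(1)[of 1] by (auto simp: border_def submat_def shift)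
  qed (use M in \<open>auto simp: border_def\<close>)
  have "det M = - det ?M" by (subst eq, rule det_border) auto
  then have "?M \<in> GLs n" using M(2) by (simp add: GLs_def)
  moreover have "?M \<in> alt_mats n" using alt by (auto simp: alt_mats_def submat_def)
  ultimately have "?M \<in> alt_GLs n" by (simp add: alt_GLs_def)
  then show "M \<in> ?R" using eq by (intro image_eqI[of _ _ "(?U, ?M)"]) auto
next
  fix M assume "M \<in> ?R"
  then obtain U M' where U: "U \<in> carrier_mat n 1" and M': "M' \<in> alt_GLs n" and M: "M = border n U M'" by auto
  have M'c: "M' \<in> carrier_mat n n" "det M' \<noteq> 0" "M' \<in> alt_mats n" using M' by (auto simp: alt_GLs_def GLs_def)
  have "M \<in> GLs (2 + n)" using det_border[OF U M'c(1)] M'c(2) by (simp add: M GLs_def border_def)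
  moreover have "M \<in> alt_mats (2 + n)" using M'c(3) by (auto simp: M alt_mats_def border_def)
  moreover have "col M 0 = unit_vec (2 + n) 1" by (rule eq_vecI) (auto simp: M border_def)
  ultimately show "M \<in> ?L" by (simp add: alt_GLs_def)
qed

text \<open>Same scheme as for the general linear group, in steps of two: the first column is 0
  followed by a nonzero vector, congruence makes all these fibres equally large, and the model fibre
  consists of the bordered matrices.\<close>

lemma card_alt_GLs_Suc_Suc:
  "card (alt_GLs (2 + n)) = (CARD('a) ^ (1 + n) - 1) * CARD('a) ^ n * card (alt_GLs n)"
proof -
  let ?V = "carrier_vec (1 + n) - {0\<^sub>v (1 + n)} :: 'a vec set"
  let ?F = "\<lambda>w. {M \<in> alt_GLs (2 + n). col M 0 = w}"
  have fin: "finite (alt_GLs m)" for m by (rule finite_subset[OF _ finite_GLs]) (auto simp: alt_GLs_def)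
  have e: "unit_vec (2 + n) 1 \<in> carrier_vec (2 + n)" by simp
  have base: "card (?F (unit_vec (2 + n) 1)) = CARD('a) ^ n * card (alt_GLs n)"
  proof -
    have "inj_on (\<lambda>(U, M). border n U M) (carrier_mat n 1 \<times> alt_GLs n)"
    proof (rule inj_onI)
      fix x y assume x: "x \<in> carrier_mat n 1 \<times> alt_GLs n" and y: "y \<in> carrier_mat n 1 \<times> alt_GLs n"
        and eq: "(\<lambda>(U, M). border n U M) x = (\<lambda>(U, M). border n U M) y"
      obtain U M U' M' where xy: "x = (U, M)" "y = (U', M')" by (metis surj_pair)
      have "M \<in> carrier_mat n n" "M' \<in> carrier_mat n n" "U \<in> carrier_mat n 1" "U' \<in> carrier_mat n 1"
        using x y by (auto simp: xy alt_GLs_def GLs_def)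
      moreover have "border n U M = border n U' M'" using eq by (simp add: xy)
      ultimately have "U = U'" "M = M'" using submat_border[of U n M] submat_border[of U' n M'] by metis+
      then show "x = y" by (simp add: xy)
    qed
    then show ?thesis unfolding alt_GLs_first_col_unit
      by (subst card_image) (simp_all add: card_cartesian_product card_carrier_mat)
  qed
  have "alt_GLs (2 + n) = (\<Union>v\<in>?V. ?F (vCons 0 v))"
  proof (intro equalityI subsetI)
    fix M assume M: "M \<in> alt_GLs (2 + n)"
    then have Mc: "M \<in> carrier_mat (2 + n) (2 + n)" "det M \<noteq> 0" "M $$ (0, 0) = 0"
      by (auto simp: alt_GLs_def alt_mats_def GLs_def)
    define v where "v = vec (1 + n) (\<lambda>i. M $$ (Suc i, 0))"
    have cv: "col M 0 = vCons 0 v"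
      by (rule eq_vecI) (use Mc in \<open>auto simp: v_def vec_index_vCons\<close>)
    have "v \<noteq> 0\<^sub>v (1 + n)"
    proof
      assume "v = 0\<^sub>v (1 + n)"
      then have "col M 0 = 0\<^sub>v (2 + n)" unfolding cv by (intro eq_vecI) (auto simp: vec_index_vCons)
      then have "M *\<^sub>v unit_vec (2 + n) 0 = 0\<^sub>v (2 + n)" using mult_unit_vec_eq_col[OF Mc(1), of 0] by simp
      then have "det M = 0"
        unfolding det_0_iff_vec_prod_zero[OF Mc(1)] using unit_vec_nonzero[of 0 "2 + n"]
        by (intro exI[of _ "unit_vec (2 + n) 0"]) auto
      then show False using Mc by simp
    qed
    then have "v \<in> ?V" by (simp add: v_def)
    then show "M \<in> (\<Union>v\<in>?V. ?F (vCons 0 v))" using M cv by blast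
  qed auto
  then have "card (alt_GLs (2 + n)) = card (\<Union>v\<in>?V. ?F (vCons 0 v))" by simp
  also have "\<dots> = (\<Sum>v\<in>?V. card (?F (vCons 0 v)))"
    by (rule card_UN_disjoint) (auto simp: fin)
  also have "\<dots> = (\<Sum>v\<in>?V. CARD('a) ^ n * card (alt_GLs n))"
  proof (rule sum.cong[OF refl])
    fix v :: "'a vec" assume "v \<in> ?V"
    then obtain G where G: "G \<in> GLs (2 + n)" "row G 0 = unit_vec (2 + n) 0" "col G 1 = vCons 0 v"
      using ex_GLs_fix_row[of v n] by blast
    have "G *\<^sub>v unit_vec (2 + n) 1 = vCons 0 v" using mult_unit_vec_eq_col[OF GLs_carrier[OF G(1)], of 1] G(3) by simp
    then have "card (?F (vCons 0 v)) = card (?F (unit_vec (2 + n) 1))"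
      using bij_betw_same_card[OF bij_betw_alt_GLs_col[OF G(1,2) _ e]] by simp
    then show "card (?F (vCons 0 v)) = CARD('a) ^ n * card (alt_GLs n)" using base by simp
  qed
  also have "\<dots> = card ?V * (CARD('a) ^ n * card (alt_GLs n))" by simp
  also have "card ?V = CARD('a) ^ (1 + n) - 1" by (subst card_Diff_singleton) (auto simp: card_carrier_vec)
  finally show ?thesis by (simp add: mult.assoc)
qed

lemma card_alt_GLs_0: "card (alt_GLs 0) = 1"
proof -
  have "alt_GLs 0 = {1\<^sub>m 0}" by (auto simp: alt_GLs_def alt_mats_def GLs_def intro!: eq_matI)
  then show ?thesis by simp
qed

end

section \<open>Double cosets of the parabolic subgroup\<close>

text \<open>Pairs \<open>(p', p)\<close> are counted in two ways. Since \<open>T\<close> is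
  invariant under cyclic exchange, \<open>p s p'\<close> may be replaced by \<open>p' p s\<close>,
  and \<open>p'\<close> is absorbed by translation. On the other hand each element of the double
  coset has as many representations as the intersection of \<open>P\<close> with its conjugate by
  \<open>s\<close> has elements.\<close>

lemma (in group) double_coset_count:
  fixes T :: "'a \<Rightarrow> 'c"
  assumes P: "subgroup P G" "finite P" and s: "s \<in> carrier G" "s \<otimes> s = \<one>"
    and T: "\<And>x y. x \<in> carrier G \<Longrightarrow> y \<in> carrier G \<Longrightarrow> T (x \<otimes> y) = T (y \<otimes> x)"
  shows "card {w. (\<exists>p\<in>P. \<exists>p'\<in>P. w = p \<otimes> s \<otimes> p') \<and> T w = b} * card {x \<in> P. s \<otimes> x \<otimes> s \<in> P}
    = card P * card {p \<in> P. T (p \<otimes> s) = b}"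
proof -
  let ?D = "{w. (\<exists>p\<in>P. \<exists>p'\<in>P. w = p \<otimes> s \<otimes> p') \<and> T w = b}"
  let ?H = "{x \<in> P. s \<otimes> x \<otimes> s \<in> P}"
  let ?E = "{(p', p) \<in> P \<times> P. T (p \<otimes> s \<otimes> p') = b}"
  interpret P: subgroup P G by (rule P)
  have Pc: "x \<in> carrier G" if "x \<in> P" for x using that P.subset by blast
  have finE: "finite ?E" by (rule finite_subset[of _ "P \<times> P"]) (use P in auto)
  have ss: "s \<otimes> (s \<otimes> x) = x" if "x \<in> carrier G" for x
    using s that by (simp flip: m_assoc)
  have "card ?E = (\<Sum>p'\<in>P. card {p \<in> P. T (p \<otimes> s \<otimes> p') = b})"
  proof -
    have "?E = (SIGMA p':P. {p \<in> P. T (p \<otimes> s \<otimes> p') = b})" by auto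
    then show ?thesis using P(2) by simp
  qed
  also have "\<dots> = (\<Sum>p'\<in>P. card {p \<in> P. T (p \<otimes> s) = b})"
  proof (rule sum.cong[OF refl])
    fix p' assume p': "p' \<in> P"
    have eq: "T (p \<otimes> s \<otimes> p') = T (p' \<otimes> p \<otimes> s)" if "p \<in> P" for p
      using T[of "p \<otimes> s" p'] Pc[OF that] Pc[OF p'] s by (simp add: m_assoc)
    have "bij_betw (\<lambda>p. p' \<otimes> p) {p \<in> P. T (p \<otimes> s \<otimes> p') = b} {p \<in> P. T (p \<otimes> s) = b}"
    proof (rule bij_betw_byWitness[of _ "\<lambda>p. inv p' \<otimes> p"])
      have i: "inv p' \<otimes> (p' \<otimes> p) = p" "p' \<otimes> (inv p' \<otimes> p) = p" if "p \<in> P" for p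
        using Pc[OF that] Pc[OF p'] by (simp_all flip: m_assoc)
      then show "\<forall>p\<in>{p \<in> P. T (p \<otimes> s \<otimes> p') = b}. inv p' \<otimes> (p' \<otimes> p) = p"
        "\<forall>p\<in>{p \<in> P. T (p \<otimes> s) = b}. p' \<otimes> (inv p' \<otimes> p) = p" by auto
      show "(\<lambda>p. p' \<otimes> p) ` {p \<in> P. T (p \<otimes> s \<otimes> p') = b} \<subseteq> {p \<in> P. T (p \<otimes> s) = b}"
      proof clarify
        fix p assume p: "p \<in> P"
        show "p' \<otimes> p \<in> P \<and> T (p' \<otimes> p \<otimes> s) = T (p \<otimes> s \<otimes> p')"
          using eq[OF p] P.m_closed[OF p' p] by simp
      qed
      show "(\<lambda>p. inv p' \<otimes> p) ` {p \<in> P. T (p \<otimes> s) = b} \<subseteq> {p \<in> P. T (p \<otimes> s \<otimes> p') = b}"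
      proof clarify
        fix p assume p: "p \<in> P"
        have q: "inv p' \<otimes> p \<in> P" using p p' by simp
        show "inv p' \<otimes> p \<in> P \<and> T (inv p' \<otimes> p \<otimes> s \<otimes> p') = T (p \<otimes> s)"
          using eq[OF q] i(2)[OF p] q by simp
      qed
    qed
    then show "card {p \<in> P. T (p \<otimes> s \<otimes> p') = b} = card {p \<in> P. T (p \<otimes> s) = b}"
      by (rule bij_betw_same_card)
  qed
  finally have 1: "card ?E = card P * card {p \<in> P. T (p \<otimes> s) = b}" by simp

  let ?F = "\<lambda>w. {(p', p) \<in> P \<times> P. p \<otimes> s \<otimes> p' = w}"
  have finD: "finite ?D"
  proof (rule finite_subset)
    show "?D \<subseteq> (\<lambda>(p, p'). p \<otimes> s \<otimes> p') ` (P \<times> P)" by auto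
  qed (use P in auto)
  have "?E = (\<Union>w\<in>?D. ?F w)" by auto
  then have "card ?E = (\<Sum>w\<in>?D. card (?F w))"
    by (simp only:) (intro card_UN_disjoint finD, auto intro: finite_subset[OF _ finite_cartesian_product[OF P(2) P(2)]])
  also have "\<dots> = (\<Sum>w\<in>?D. card ?H)"
  proof (rule sum.cong[OF refl])
    fix w assume "w \<in> ?D"
    then obtain a c where a: "a \<in> P" and c: "c \<in> P" and w: "w = a \<otimes> s \<otimes> c" by auto
    note ac = Pc[OF a] Pc[OF c]
    \<comment> \<open>Starting from one representation \<open>a s c\<close>, changing
      \<open>a\<close> to \<open>a x\<close> has to be compensated on the right by the conjugate of
      the inverse of \<open>x\<close>, which lies in \<open>P\<close> exactly for \<open>x\<close>
      in \<open>?H\<close>.\<close>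
    have "bij_betw (\<lambda>x. (s \<otimes> inv x \<otimes> s \<otimes> c, a \<otimes> x)) ?H (?F w)"
    proof (rule bij_betw_byWitness[of _ "\<lambda>(p', p). inv a \<otimes> p"])
      show "\<forall>x\<in>?H. (case (s \<otimes> inv x \<otimes> s \<otimes> c, a \<otimes> x) of (p', p) \<Rightarrow> inv a \<otimes> p) = x"
        using ac Pc by (auto simp flip: m_assoc)
      have sol: "s \<otimes> inv (inv a \<otimes> p) \<otimes> s \<otimes> c = p'" "s \<otimes> (inv a \<otimes> p) \<otimes> s = c \<otimes> inv p'"
        if p: "p \<in> P" "p' \<in> P" "p \<otimes> s \<otimes> p' = w" for p p'
      proof -
        note pc = Pc[OF p(1)] Pc[OF p(2)]
        have e1: "inv a \<otimes> p \<otimes> s \<otimes> p' = s \<otimes> c"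
        proof -
          have "inv a \<otimes> p \<otimes> s \<otimes> p' = inv a \<otimes> (p \<otimes> s \<otimes> p')" using ac pc s by (simp add: m_assoc)
          also have "\<dots> = inv a \<otimes> (a \<otimes> (s \<otimes> c))" using ac s by (simp add: p(3) w m_assoc)
          also have "\<dots> = s \<otimes> c" using ac s by (simp flip: m_assoc)
          finally show ?thesis .
        qed
        have e2: "inv a \<otimes> p \<otimes> s = s \<otimes> c \<otimes> inv p'"
          using e1 ac pc s by (metis inv_closed inv_solve_right m_closed)
        show "s \<otimes> (inv a \<otimes> p) \<otimes> s = c \<otimes> inv p'"
          using e2 ac pc s ss[of "c \<otimes> inv p'"] by (simp add: m_assoc)
        have "inv (inv a \<otimes> p) \<otimes> (s \<otimes> c) = s \<otimes> p'"
          using e1 ac pc s by (metis inv_closed inv_solve_left m_assoc m_closed)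
        then show "s \<otimes> inv (inv a \<otimes> p) \<otimes> s \<otimes> c = p'"
          using ac pc s ss by (simp add: m_assoc)
      qed
      show "\<forall>y\<in>?F w. (\<lambda>x. (s \<otimes> inv x \<otimes> s \<otimes> c, a \<otimes> x)) (case y of (p', p) \<Rightarrow> inv a \<otimes> p) = y"
      proof
        fix y assume "y \<in> ?F w"
        then obtain p' p where y: "y = (p', p)" and p: "p' \<in> P" "p \<in> P" "p \<otimes> s \<otimes> p' = w" by blast
        have "a \<otimes> (inv a \<otimes> p) = p" using ac Pc[OF p(2)] by (simp flip: m_assoc)
        then show "(\<lambda>x. (s \<otimes> inv x \<otimes> s \<otimes> c, a \<otimes> x)) (case y of (p', p) \<Rightarrow> inv a \<otimes> p) = y"
          using sol(1)[OF p(2,1,3)] by (simp add: y)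
      qed
      show "(\<lambda>x. (s \<otimes> inv x \<otimes> s \<otimes> c, a \<otimes> x)) ` ?H \<subseteq> ?F w"
      proof (rule image_subsetI)
        fix x assume "x \<in> ?H"
        then have x: "x \<in> P" "s \<otimes> x \<otimes> s \<in> P" by auto
        note xc = Pc[OF x(1)]
        have "inv (s \<otimes> x \<otimes> s) = s \<otimes> inv x \<otimes> s"
        proof (rule inv_equality)
          have "s \<otimes> inv x \<otimes> s \<otimes> (s \<otimes> x \<otimes> s) = s \<otimes> (inv x \<otimes> (s \<otimes> (s \<otimes> (x \<otimes> s))))"
            using xc s by (simp add: m_assoc)
          also have "\<dots> = s \<otimes> (inv x \<otimes> (x \<otimes> s))" using xc s ss[of "x \<otimes> s"] by simp
          also have "inv x \<otimes> (x \<otimes> s) = s" using xc s by (simp flip: m_assoc)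
          finally show "s \<otimes> inv x \<otimes> s \<otimes> (s \<otimes> x \<otimes> s) = \<one>" using s by simp
        qed (use xc s in auto)
        then have "s \<otimes> inv x \<otimes> s \<in> P" using P.m_inv_closed[OF x(2)] by simp
        then have "s \<otimes> inv x \<otimes> s \<otimes> c \<in> P" using c by simp
        moreover have "a \<otimes> x \<otimes> s \<otimes> (s \<otimes> inv x \<otimes> s \<otimes> c) = w"
        proof -
          have "a \<otimes> x \<otimes> s \<otimes> (s \<otimes> inv x \<otimes> s \<otimes> c) = a \<otimes> (x \<otimes> (s \<otimes> (s \<otimes> (inv x \<otimes> (s \<otimes> c)))))"
            using ac xc s by (simp add: m_assoc)
          also have "\<dots> = a \<otimes> (x \<otimes> (inv x \<otimes> (s \<otimes> c)))" using ac xc s ss by simp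
          also have "x \<otimes> (inv x \<otimes> (s \<otimes> c)) = s \<otimes> c" using ac xc s by (simp flip: m_assoc)
          finally show ?thesis using ac s by (simp add: w m_assoc)
        qed
        ultimately show "(s \<otimes> inv x \<otimes> s \<otimes> c, a \<otimes> x) \<in> ?F w"
          using P.m_closed[OF a x(1)] by simp
      qed
      show "(\<lambda>(p', p). inv a \<otimes> p) ` ?F w \<subseteq> ?H"
      proof (rule image_subsetI)
        fix y assume "y \<in> ?F w"
        then obtain p' p where y: "y = (p', p)" and p: "p' \<in> P" "p \<in> P" "p \<otimes> s \<otimes> p' = w" by blast
        have "inv a \<otimes> p \<in> P" using a p by simp
        moreover have "s \<otimes> (inv a \<otimes> p) \<otimes> s \<in> P"
          unfolding sol(2)[OF p(2,1,3)] using c p by simp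
        ultimately show "(case y of (p', p) \<Rightarrow> inv a \<otimes> p) \<in> ?H" by (simp add: y)
      qed
    qed
    from bij_betw_same_card[OF this] show "card (?F w) = card ?H" by (rule sym)
  qed
  finally show ?thesis using 1 by simp
qed

lemma mat_trace_commute:
  fixes A B :: "'a::field mat"
  assumes "A \<in> carrier_mat n m" "B \<in> carrier_mat m n"
  shows "mat_trace (A * B) = mat_trace (B * A)"
proof -
  have "mat_trace (A * B) = (\<Sum>i<n. \<Sum>j<m. A $$ (i, j) * B $$ (j, i))"
    using assms by (auto simp: mat_trace_def scalar_prod_def atLeast0LessThan intro!: sum.cong)
  also have "\<dots> = (\<Sum>j<m. \<Sum>i<n. B $$ (j, i) * A $$ (i, j))"
    by (subst sum.swap) (simp add: mult.commute)
  also have "\<dots> = mat_trace (B * A)"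
    using assms by (auto simp: mat_trace_def scalar_prod_def atLeast0LessThan intro!: sum.cong)
  finally show ?thesis .
qed

section \<open>The parabolic subgroup as a semidirect product\<close>

definition GL_group :: "nat \<Rightarrow> 'a::field mat monoid" where
  "GL_group n = \<lparr>carrier = GLs n, mult = (*), one = 1\<^sub>m n\<rparr>"

lemma group_GL_group: "group (GL_group n :: 'a::field mat monoid)"
proof (rule groupI)
  fix x :: "'a mat" assume "x \<in> carrier (GL_group n)"
  then show "\<exists>y\<in>carrier (GL_group n). y \<otimes>\<^bsub>GL_group n\<^esub> x = \<one>\<^bsub>GL_group n\<^esub>"
    using minv[of x n] by (intro bexI[of _ "minv x"]) (simp_all add: GL_group_def)
next
  fix x :: "'a mat" assume "x \<in> carrier (GL_group n)"
  then show "\<one>\<^bsub>GL_group n\<^esub> \<otimes>\<^bsub>GL_group n\<^esub> x = x"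
    using GLs_carrier[of x n] by (simp add: GL_group_def)
next
  fix x y z :: "'a mat" assume "x \<in> carrier (GL_group n)" "y \<in> carrier (GL_group n)" "z \<in> carrier (GL_group n)"
  then show "x \<otimes>\<^bsub>GL_group n\<^esub> y \<otimes>\<^bsub>GL_group n\<^esub> z = x \<otimes>\<^bsub>GL_group n\<^esub> (y \<otimes>\<^bsub>GL_group n\<^esub> z)"
    using GLs_carrier[of x n] GLs_carrier[of y n] GLs_carrier[of z n]
    by (simp add: GL_group_def assoc_mult_mat[of _ n n _ n _ n])
qed (auto simp: GL_group_def GLs_mult)

definition para :: "'a::field mat \<Rightarrow> 'a mat \<Rightarrow> 'a mat" where
  "para A B = four_block_mat A (A * B) (0\<^sub>m (dim_row A) (dim_row A)) (transpose_mat (minv A))"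

lemma parabolic_eq: "parabolic n = (\<lambda>(A, B). para A B) ` (GLs n \<times> (sym_mats n 0 :: 'a::field mat set))"
proof -
  have block: "four_block_mat A (0\<^sub>m n n) (0\<^sub>m n n) (transpose_mat (minv A)) * four_block_mat (1\<^sub>m n) B (0\<^sub>m n n) (1\<^sub>m n) = para A B"
    if "A \<in> GLs n" "B \<in> carrier_mat n n" for A B :: "'a mat"
    using that GLs_carrier[OF that(1)] minv(1)[OF that(1)]
    by (subst mult_four_block_mat[of _ n n _ n _ n _ _ n _ n]) (auto simp: para_def)
  have sym: "sym_mats n 0 = {B \<in> carrier_mat n n. transpose_mat B = (B :: 'a mat)}"
    by (auto simp: sym_mats_def submat_def intro!: eq_matI)
  show ?thesis
  proof (intro equalityI subsetI)
    fix p :: "'a mat" assume "p \<in> parabolic n"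
    then obtain A A' B where A: "A \<in> carrier_mat n n" "A' \<in> carrier_mat n n" "inverts_mat A A'"
      and B: "B \<in> carrier_mat n n" "transpose_mat B = B"
      and p: "p = four_block_mat A (0\<^sub>m n n) (0\<^sub>m n n) (transpose_mat A') * four_block_mat (1\<^sub>m n) B (0\<^sub>m n n) (1\<^sub>m n)"
      unfolding parabolic_def by blast
    have inv: "A * A' = 1\<^sub>m n" using A by (simp add: inverts_mat_def)
    have "A \<in> GLs n" "minv A = A'" using GLs_I[OF A(1,2) inv] minv_unique[OF A(1,2) inv] by auto
    then show "p \<in> (\<lambda>(A, B). para A B) ` (GLs n \<times> sym_mats n 0)"
      using block[of A B] B p sym by (intro image_eqI[of _ _ "(A, B)"]) auto
  next
    fix p :: "'a mat" assume "p \<in> (\<lambda>(A, B). para A B) ` (GLs n \<times> sym_mats n 0)"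
    then obtain A B where A: "A \<in> GLs n" and B: "B \<in> carrier_mat n n" "transpose_mat B = B" and p: "p = para A B"
      unfolding sym by auto
    show "p \<in> parabolic n"
      unfolding parabolic_def p block[OF A B(1), symmetric]
      using minv[OF A] GLs_carrier[OF A] B by (auto simp: inverts_mat_def)
  qed
qed

lemma para_inj: "inj_on (\<lambda>(A, B). para A B) (GLs n \<times> (sym_mats n s :: 'a::field mat set))"
proof (rule inj_onI)
  fix x y assume x: "x \<in> GLs n \<times> (sym_mats n s :: 'a mat set)" and y: "y \<in> GLs n \<times> (sym_mats n s :: 'a mat set)"
    and eq: "(\<lambda>(A, B). para A B) x = (\<lambda>(A, B). para A B) y"
  obtain A B A' B' where xy: "x = (A, B)" "y = (A', B')" by (metis surj_pair)
  have c: "A \<in> GLs n" "A' \<in> GLs n" "B \<in> carrier_mat n n" "B' \<in> carrier_mat n n"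
    using x y by (auto simp: xy sym_mats_def)
  note m = minv[OF c(1)] minv[OF c(2)] GLs_carrier[OF c(1)] GLs_carrier[OF c(2)]
  have "A = A' \<and> A * B = A' * B' \<and> 0\<^sub>m n n = (0\<^sub>m n n :: 'a mat) \<and> transpose_mat (minv A) = transpose_mat (minv A')"
    using eq c m by (subst four_block_inject[symmetric, of _ n n _ n _ n]) (auto simp: xy para_def)
  then have "A = A'" and AB: "A * B = A * B'" by auto
  moreover have "B = minv A * (A * B)" "B' = minv A * (A * B')"
    using m c by (simp_all flip: assoc_mult_mat[of _ n n _ n _ n])
  ultimately show "x = y" by (metis xy)
qed

lemma para_carrier: "A \<in> GLs n \<Longrightarrow> para A B \<in> carrier_mat (n + n) (n + n)"
  using GLs_carrier[of A n] minv(1)[of A n] by (auto simp: para_def)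

lemma para_GLs:
  assumes "A \<in> GLs n" "B \<in> carrier_mat n n"
  shows "para A B \<in> GLs (n + n)"
proof -
  note c = GLs_carrier[OF assms(1)] minv[OF assms(1)]
  have "det (para A B) = det A * det (transpose_mat (minv A))"
    unfolding para_def by (rule det_four_block_mat_lower_left_zero) (use c assms in auto)
  moreover have "transpose_mat (minv A) \<in> GLs n" by (rule GLs_transpose) (rule c)
  ultimately show ?thesis using para_carrier[OF assms(1)] assms(1) by (simp add: GLs_def)
qed

lemma minv_mult:
  assumes "A \<in> GLs n" "B \<in> GLs n"
  shows "minv (A * B) = minv B * minv A"
proof (rule minv_unique)
  note c = GLs_carrier[OF assms(1)] GLs_carrier[OF assms(2)] minv[OF assms(1)] minv[OF assms(2)]
  show "A * B \<in> carrier_mat n n" "minv B * minv A \<in> carrier_mat n n" using c by auto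
  have "A * B * (minv B * minv A) = A * (B * minv B) * minv A"
    using c(1,2,3,7) by (simp add: assoc_mult_mat[of _ n n _ n _ n])
  then show "A * B * (minv B * minv A) = 1\<^sub>m n" using c by simp
qed

lemma sym_mats_0: "B \<in> sym_mats n 0 \<longleftrightarrow> B \<in> carrier_mat n n \<and> transpose_mat B = B"
  by (auto simp: sym_mats_def submat_def intro!: eq_matI)

text \<open>The semidirect product law: moving the unipotent factor of the first matrix past the
  Levi part of the second acts on it by congruence with the inverse of \<open>A2\<close>.\<close>

lemma para_mult:
  assumes A: "A1 \<in> GLs n" "A2 \<in> GLs n" and B: "B1 \<in> carrier_mat n n" "B2 \<in> carrier_mat n n"
  shows "para A1 B1 * para A2 B2 = para (A1 * A2) (B2 + minv A2 * B1 * transpose_mat (minv A2))"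
proof -
  note c = GLs_carrier[OF A(1)] GLs_carrier[OF A(2)] minv(1)[OF A(1)] minv(1)[OF A(2)] B
  have "A1 * A2 * (B2 + minv A2 * B1 * transpose_mat (minv A2)) = A1 * (A2 * B2) + A1 * ((A2 * minv A2) * B1 * transpose_mat (minv A2))"
    using c by (simp add: mult_add_distrib_mat[of _ n n] assoc_mult_mat[of _ n n _ n _ n])
  also have "\<dots> = A1 * (A2 * B2) + A1 * B1 * transpose_mat (minv A2)"
    using c minv(2)[OF A(2)] by (simp add: assoc_mult_mat[of _ n n _ n _ n])
  finally have ur: "A1 * A2 * (B2 + minv A2 * B1 * transpose_mat (minv A2)) = A1 * (A2 * B2) + A1 * B1 * transpose_mat (minv A2)" .
  have "para A1 B1 * para A2 B2 = four_block_mat (A1 * A2 + A1 * B1 * 0\<^sub>m n n) (A1 * (A2 * B2) + A1 * B1 * transpose_mat (minv A2))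
      (0\<^sub>m n n * A2 + transpose_mat (minv A1) * 0\<^sub>m n n) (0\<^sub>m n n * (A2 * B2) + transpose_mat (minv A1) * transpose_mat (minv A2))"
    unfolding para_def using c by (subst mult_four_block_mat[of _ n n _ n _ n _ _ n _ n]) auto
  also have "\<dots> = para (A1 * A2) (B2 + minv A2 * B1 * transpose_mat (minv A2))"
    unfolding para_def ur minv_mult[OF A]
    using c by (intro cong_four_block_mat) (auto simp: transpose_mult[of _ n n _ n])
  finally show ?thesis .
qed

context char2_field
begin

lemma subgroup_parabolic: "subgroup (parabolic n :: 'a mat set) (GL_group (n + n))"
proof -
  interpret G: group "GL_group (n + n) :: 'a mat monoid" by (rule group_GL_group)
  have sym_congr: "G * B * transpose_mat G \<in> sym_mats n 0" if "B \<in> sym_mats n 0" "G \<in> carrier_mat n n" for G B :: "'a mat"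
  proof -
    have B: "B \<in> carrier_mat n n" "transpose_mat B = B" using that(1) by (auto simp: sym_mats_0)
    have "transpose_mat (G * B * transpose_mat G) = G * (transpose_mat B * transpose_mat G)"
      using transpose_mult[of "G * B" n n "transpose_mat G" n] transpose_mult[of G n n B n] B(1) that(2) by simp
    also have "\<dots> = G * B * transpose_mat G" using B that(2) by (simp add: assoc_mult_mat[of _ n n _ n _ n])
    finally show ?thesis using B(1) that(2) by (auto simp: sym_mats_0)
  qed
  have sym_add: "B + B' \<in> sym_mats n 0" if "B \<in> sym_mats n 0" "B' \<in> sym_mats n 0" for B B' :: "'a mat"
    using that by (simp add: sym_mats_0 transpose_add[of _ n n])
  show ?thesis
  proof (rule G.subgroupI)
    show "parabolic n \<subseteq> carrier (GL_group (n + n) :: 'a mat monoid)"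
      unfolding parabolic_eq using para_GLs[of _ n] by (auto simp: GL_group_def sym_mats_0)
    have "(1\<^sub>m n, 0\<^sub>m n n) \<in> GLs n \<times> (sym_mats n 0 :: 'a mat set)" by (simp add: sym_mats_0)
    then show "parabolic n \<noteq> ({} :: 'a mat set)" unfolding parabolic_eq by blast
  next
    fix a b :: "'a mat" assume "a \<in> parabolic n" "b \<in> parabolic n"
    then obtain A1 B1 A2 B2 where *: "A1 \<in> GLs n" "A2 \<in> GLs n" "B1 \<in> sym_mats n 0" "B2 \<in> sym_mats n 0"
      and ab: "a = para A1 B1" "b = para A2 B2" unfolding parabolic_eq by auto
    have "a * b = para (A1 * A2) (B2 + minv A2 * B1 * transpose_mat (minv A2))"
      unfolding ab by (rule para_mult) (use * in \<open>auto simp: sym_mats_0\<close>)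
    moreover have "B2 + minv A2 * B1 * transpose_mat (minv A2) \<in> sym_mats n 0"
      using * by (intro sym_add sym_congr) (auto simp: minv)
    ultimately show "a \<otimes>\<^bsub>GL_group (n + n)\<^esub> b \<in> parabolic n"
      unfolding parabolic_eq using GLs_mult[OF *(1,2)] by (auto simp: GL_group_def)
  next
    fix a :: "'a mat" assume a': "a \<in> parabolic n"
    then obtain A B where *: "A \<in> GLs n" "B \<in> sym_mats n 0" and a: "a = para A B" unfolding parabolic_eq by auto
    note c = GLs_carrier[OF *(1)] minv[OF *(1)]
    have Bc: "B \<in> carrier_mat n n" using * by (simp add: sym_mats_0)
    define B' where "B' = A * B * transpose_mat A"
    have B': "B' \<in> sym_mats n 0" unfolding B'_def using * c by (intro sym_congr) auto
    have "para (minv A) B' * para A B = para (minv A * A) (B + minv A * B' * transpose_mat (minv A))"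
      by (rule para_mult) (use * c Bc B' in \<open>auto simp: sym_mats_0\<close>)
    also have "minv A * B' * transpose_mat (minv A) = (minv A * A) * B * (transpose_mat A * transpose_mat (minv A))"
      unfolding B'_def using c(1,2) Bc by (simp add: assoc_mult_mat[of _ n n _ n _ n])
    also have "transpose_mat A * transpose_mat (minv A) = 1\<^sub>m n"
      using c by (simp flip: transpose_mult[of _ n n _ n])
    also have "B + (minv A * A) * B * 1\<^sub>m n = 0\<^sub>m n n" using c Bc mat_add_self[of B n n] by simp
    also have "para (minv A * A) (0\<^sub>m n n) = 1\<^sub>m (n + n)"
    proof -
      have "minv (1\<^sub>m n :: 'a mat) = 1\<^sub>m n" by (rule minv_unique[of _ n]) auto
      then show ?thesis using c by (simp add: para_def)
    qed
    finally have "inv\<^bsub>GL_group (n + n)\<^esub> a = para (minv A) B'"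
      using para_GLs[of A n B] para_GLs[of "minv A" n B'] * c Bc B'
      by (intro G.inv_equality) (auto simp: GL_group_def a sym_mats_0)
    then show "inv\<^bsub>GL_group (n + n)\<^esub> a \<in> parabolic n"
      unfolding parabolic_eq using c B' by auto
  qed
qed

end

section \<open>The distribution of the trace of C plus the trace of its inverse on GL(1) and
  GL(2)\<close>

lemma GLs_1_eq: "GLs 1 = (\<lambda>c. mat 1 1 (\<lambda>_. c)) ` (UNIV - {0 :: 'a::field})"
proof (intro equalityI subsetI)
  fix A :: "'a mat" assume "A \<in> GLs 1"
  then have A: "A \<in> carrier_mat 1 1" "A $$ (0, 0) \<noteq> 0" by (auto simp: GLs_def det_1x1)
  have "A = mat 1 1 (\<lambda>_. A $$ (0, 0))" by (rule eq_matI) (use A in auto)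
  then show "A \<in> (\<lambda>c. mat 1 1 (\<lambda>_. c)) ` (UNIV - {0})" using A(2) by blast
qed (auto simp: GLs_def det_1x1)

text \<open>The sum of the two traces is what remains of the trace on the parabolic times sigma when
  the part depending on the symmetric matrix vanishes; \<open>C\<close> is the lower right block
  there.\<close>

definition trace_count :: "nat \<Rightarrow> 'a::field \<Rightarrow> nat" where
  "trace_count k \<beta> = card {C \<in> GLs k. mat_trace C + mat_trace (minv C) = \<beta>}"

lemma card_Collect_sum: "int (card {x::'b::finite. P x}) = (\<Sum>x\<in>UNIV. of_bool (P x))"
  by (simp add: of_bool_def sum.If_cases)

lemma sum_of_bool_mult: "(\<Sum>t\<in>UNIV. of_bool (P t) * g t) = (\<Sum>t::'b::finite | P t. g t :: int)"
proof -
  have "(\<Sum>t\<in>UNIV. of_bool (P t) * g t) = (\<Sum>t\<in>UNIV. if P t then g t else 0)"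
    by (intro sum.cong) auto
  then show ?thesis by (simp add: sum.If_cases)
qed

lemma sum_UNIV_prod: "(\<Sum>p\<in>UNIV. f p) = (\<Sum>x\<in>UNIV. \<Sum>y\<in>UNIV. f (x, y))"
  by (simp add: sum.cartesian_product)

definition mat2 :: "'a \<Rightarrow> 'a \<Rightarrow> 'a \<Rightarrow> 'a \<Rightarrow> 'a mat" where
  "mat2 x y z w = mat 2 2 (\<lambda>(i, j). if i = 0 then (if j = 0 then x else y) else (if j = 0 then z else w))"

lemma mat2_eq:
  assumes "A \<in> carrier_mat 2 2"
  shows "A = mat2 (A $$ (0, 0)) (A $$ (0, 1)) (A $$ (1, 0)) (A $$ (1, 1))"
  by (rule eq_matI) (use assms in \<open>auto simp: mat2_def less_2_cases_iff\<close>)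

lemma mat2_inject: "mat2 x y z w = mat2 x' y' z' w' \<longleftrightarrow> x = x' \<and> y = y' \<and> z = z' \<and> w = w'"
proof
  assume eq: "mat2 x y z w = mat2 x' y' z' w'"
  have "mat2 x y z w $$ (0, 0) = x" "mat2 x y z w $$ (0, 1) = y" "mat2 x y z w $$ (1, 0) = z" "mat2 x y z w $$ (1, 1) = w"
    for x y z w :: 'a by (simp_all add: mat2_def)
  then show "x = x' \<and> y = y' \<and> z = z' \<and> w = w'" using eq by metis
qed simp

lemma mat2_mult: "mat2 x y z w * mat2 x' y' z' w' =
    mat2 (x * x' + y * z') (x * y' + y * w') (z * x' + w * z') (z * y' + w * (w'::'a::field))"
  by (rule eq_matI) (auto simp: mat2_def scalar_prod_def less_2_cases_iff numeral_2_eq_2)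

lemma mat2_one: "1\<^sub>m 2 = mat2 1 0 0 (1::'a::field)"
  by (rule eq_matI) (auto simp: mat2_def less_2_cases_iff)

lemma mat2_carrier [simp]: "mat2 x y z w \<in> carrier_mat 2 2"
  by (simp add: mat2_def)

lemma mat_trace_mat2: "mat_trace (mat2 x y z w) = x + (w::'a::field)"
  by (simp add: mat_trace_def mat2_def numeral_2_eq_2)

lemma minv_mat2:
  fixes x y z w :: "'a::field"
  assumes "x * w - y * z \<noteq> 0"
  defines "d \<equiv> x * w - y * z"
  shows "mat2 x y z w \<in> GLs 2" "minv (mat2 x y z w) = mat2 (w / d) (- y / d) (- z / d) (x / d)"
proof -
  have "mat2 x y z w * mat2 (w / d) (- y / d) (- z / d) (x / d) = mat2 (d / d) 0 0 (d / d)"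
  proof -
    have "x * (w / d) + y * (- z / d) = (x * w - y * z) / d" "z * (- y / d) + w * (x / d) = (x * w - y * z) / d"
      by (simp_all add: diff_divide_distrib mult.commute)
    then show ?thesis unfolding mat2_mult mat2_inject d_def[symmetric] by simp
  qed
  then have *: "mat2 x y z w * mat2 (w / d) (- y / d) (- z / d) (x / d) = 1\<^sub>m 2"
    using assms(1) by (simp add: mat2_one d_def)
  show "mat2 x y z w \<in> GLs 2" using GLs_I[OF _ _ *] by simp
  show "minv (mat2 x y z w) = mat2 (w / d) (- y / d) (- z / d) (x / d)"
    using minv_unique[OF _ _ *] by simp
qed

text \<open>If the determinant expression vanished, the adjugate times the matrix would be zero;
  cancelling the inverse makes the adjugate, hence every entry, zero.\<close>

lemma mat2_in_GLs_iff: "mat2 x y z w \<in> GLs 2 \<longleftrightarrow> x * w - y * z \<noteq> (0::'a::field)"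
proof
  assume g: "mat2 x y z w \<in> GLs 2"
  show "x * w - y * z \<noteq> 0"
  proof
    assume d: "x * w - y * z = 0"
    have "mat2 w (- y) (- z) x * mat2 x y z w = mat2 0 0 0 0"
      unfolding mat2_mult mat2_inject using d by (auto simp: algebra_simps)
    moreover have zero: "mat2 0 0 0 0 * minv (mat2 x y z w) = mat2 0 0 0 (0::'a)"
      by (subst mat2_eq[OF minv(1)[OF g]]) (simp add: mat2_mult)
    ultimately have "mat2 w (- y) (- z) x * mat2 x y z w * minv (mat2 x y z w) = mat2 0 0 0 0" by simp
    moreover have "mat2 w (- y) (- z) x * mat2 x y z w * minv (mat2 x y z w) = mat2 w (- y) (- z) x"
      using minv[OF g] by (simp add: assoc_mult_mat[of _ 2 2 _ 2 _ 2] right_mult_one_mat[OF mat2_carrier])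
    ultimately have "x = 0" "y = 0" "z = 0" "w = 0" by (simp_all add: mat2_inject)
    then have "mat2 0 0 0 0 * minv (mat2 x y z w) = 1\<^sub>m 2" using minv[OF g] by simp
    then show False unfolding zero by (simp add: mat2_one mat2_inject)
  qed
qed (rule minv_mat2)

context char2_field
begin

text \<open>Clearing denominators turns \<open>c + 1/c = \<beta>\<close> into a quadratic equation
  with constant term 1. The character value at \<open>1/\<beta>^2\<close> equals that at
  \<open>1/\<beta>\<close>.\<close>

lemma trace_count_1: "int (trace_count 1 \<beta>) = 1 + (if \<beta> = 0 then 0 else lam (inverse (\<beta>::'a)))"
proof -
  have minv1: "minv (mat 1 1 (\<lambda>_. c)) = mat 1 1 (\<lambda>_. inverse c)" if "c \<noteq> 0" for c :: 'a
    by (rule minv_unique[of _ 1]) (use that in \<open>auto intro!: eq_matI simp: scalar_prod_def\<close>)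
  have iff: "c \<noteq> 0 \<and> c + inverse c = \<beta> \<longleftrightarrow> c\<^sup>2 + \<beta> * c = 1" for c :: 'a
  proof (cases "c = 0")
    case False
    have "c + inverse c = \<beta> \<longleftrightarrow> (c + inverse c) * c = \<beta> * c" using False by simp
    also have "(c + inverse c) * c = c\<^sup>2 + 1" using False by (simp add: power2_eq_square distrib_right)
    also have "c\<^sup>2 + 1 = \<beta> * c \<longleftrightarrow> c\<^sup>2 + \<beta> * c = 1"
      by (metis add_left_self add.commute)
    finally show ?thesis using False by simp
  qed simp
  have "{C \<in> GLs 1. mat_trace C + mat_trace (minv C) = \<beta>} = (\<lambda>c. mat 1 1 (\<lambda>_. c)) ` {c. c\<^sup>2 + \<beta> * c = 1}"
  proof -
    have "{C \<in> GLs 1. mat_trace C + mat_trace (minv C) = \<beta>} = (\<lambda>c. mat 1 1 (\<lambda>_. c)) ` {c. c \<noteq> 0 \<and> c + inverse c = \<beta>}"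
    proof -
      have "mat_trace (mat 1 1 (\<lambda>_. c)) + mat_trace (minv (mat 1 1 (\<lambda>_. c))) = c + inverse c" if "c \<noteq> 0" for c :: 'a
        unfolding minv1[OF that] by (simp add: mat_trace_def)
      then show ?thesis unfolding GLs_1_eq by (auto simp del: One_nat_def)
    qed
    then show ?thesis by (simp only: iff)
  qed
  moreover have "inj (\<lambda>c. mat 1 1 (\<lambda>_. c :: 'a))"
  proof (rule injI)
    fix c d :: 'a assume "mat 1 1 (\<lambda>_. c) = mat 1 1 (\<lambda>_. d)"
    then have "mat 1 1 (\<lambda>_. c) $$ (0, 0) = mat 1 1 (\<lambda>_. d) $$ (0, 0)" by (simp only:)
    then show "c = d" by simp
  qed
  ultimately have "trace_count 1 \<beta> = card {c. c\<^sup>2 + \<beta> * c = 1}"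
    unfolding trace_count_def by (simp add: card_image inj_on_subset)
  also have "int \<dots> = 1 + (if \<beta> = 0 then 0 else lam (inverse \<beta>))"
  proof (cases "\<beta> = 0")
    case False
    have "lam (1 / \<beta>\<^sup>2) = lam ((inverse \<beta>)\<^sup>2)" by (simp add: power_inverse divide_inverse)
    then show ?thesis using False card_quadratic[OF False, of 1] by (simp add: lam_square)
  qed (simp add: card_square_root)
  finally show ?thesis .
qed

lemma card_products: "(\<Sum>y\<in>UNIV. \<Sum>z\<in>UNIV. of_bool (y * z = e)) = int CARD('a) - 1 + (if e = (0::'a) then int CARD('a) else 0)"
proof -
  have "(\<Sum>z\<in>UNIV. of_bool (y * z = e)) = (if y = 0 then (if e = 0 then int CARD('a) else 0) else 1)" for y
  proof (cases "y = 0")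
    case False
    then have "y * z = e \<longleftrightarrow> z = e / y" for z by (auto simp: field_simps)
    then show ?thesis using False by (simp add: of_bool_def)
  qed auto
  then have "(\<Sum>y\<in>UNIV. \<Sum>z\<in>UNIV. of_bool (y * z = e)) =
      (\<Sum>y\<in>UNIV. if y = (0::'a) then (if e = 0 then int CARD('a) else 0) else 1)" by simp
  also have "\<dots> = (if e = 0 then int CARD('a) else 0) + (\<Sum>y\<in>UNIV - {0::'a}. 1)"
    by (subst sum.remove[of _ 0]) auto
  also have "(\<Sum>y\<in>UNIV - {0::'a}. 1) = int CARD('a) - 1"
    by (simp add: card_Diff_singleton of_nat_diff)
  finally show ?thesis by simp
qed

text \<open>In size 2 the trace of the inverse is the trace divided by the determinant, so only
  trace \<open>t\<close> and determinant \<open>d\<close> matter. Given the diagonal entries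
  \<open>x\<close> and \<open>w = x + t\<close>, the equation \<open>y z = x w + d\<close> has
  \<open>q - 1\<close> solutions, and \<open>q\<close> more if \<open>x w = d\<close>, which reads
  \<open>x^2 + t x = d\<close>.\<close>

lemma trace_count_2_sum:
  "int (trace_count 2 \<beta>) = (\<Sum>d\<in>UNIV - {0::'a}. \<Sum>t | t * (1 + inverse d) = \<beta>.
     int CARD('a) * (int CARD('a) - 1) + int CARD('a) * int (card {x. x\<^sup>2 + t * x = d}))"
proof -
  define R where "R = (\<lambda>x y z w. x * w + y * z \<noteq> 0 \<and> (x + w) * (1 + inverse (x * w + y * z)) = \<beta>)"
  have "bij_betw (\<lambda>(x, y, z, w). mat2 x y z w) {(x, y, z, w). R x y z w}
    {C \<in> GLs 2. mat_trace C + mat_trace (minv C) = \<beta>}"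
  proof (rule bij_betw_imageI)
    show "inj_on (\<lambda>(x, y, z, w). mat2 x y z w) {(x, y, z, w). R x y z w}"
      by (auto simp: inj_on_def mat2_inject)
    have tr: "mat_trace (mat2 x y z w) + mat_trace (minv (mat2 x y z w)) = (x + w) * (1 + inverse (x * w + y * z))"
      if "x * w + y * z \<noteq> 0" for x y z w :: 'a
    proof -
      have "mat_trace (minv (mat2 x y z w)) = (w + x) * inverse (x * w + y * z)"
        using minv_mat2(2)[of x w y z] that unfolding minus_eq
        by (simp only: mat_trace_mat2 divide_inverse distrib_right[symmetric] not_False_eq_True)
      then show ?thesis by (simp add: mat_trace_mat2 distrib_left add.commute[of w x])
    qed
    have g: "mat2 x y z w \<in> GLs 2 \<longleftrightarrow> x * w + y * z \<noteq> 0" for x y z w :: 'a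
      using mat2_in_GLs_iff[of x y z w] by (simp add: minus_eq)
    show "(\<lambda>(x, y, z, w). mat2 x y z w) ` {(x, y, z, w). R x y z w} = {C \<in> GLs 2. mat_trace C + mat_trace (minv C) = \<beta>}"
    proof (intro equalityI subsetI)
      fix C :: "'a mat" assume C: "C \<in> {C \<in> GLs 2. mat_trace C + mat_trace (minv C) = \<beta>}"
      define x y z w where "x = C $$ (0, 0)" and "y = C $$ (0, 1)" and "z = C $$ (1, 0)" and "w = C $$ (1, 1)"
      have eq: "C = mat2 x y z w" using mat2_eq[of C] C GLs_carrier unfolding x_def y_def z_def w_def by blast
      have "R x y z w" using C g[of x y z w] tr[of x w y z] unfolding R_def eq by auto
      then show "C \<in> (\<lambda>(x, y, z, w). mat2 x y z w) ` {(x, y, z, w). R x y z w}"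
        unfolding eq by (intro image_eqI[of _ _ "(x, y, z, w)"]) auto
    next
      fix C assume "C \<in> (\<lambda>(x, y, z, w). mat2 x y z w) ` {(x, y, z, w). R x y z w}"
      then obtain x y z w where "R x y z w" "C = mat2 x y z w" by auto
      then show "C \<in> {C \<in> GLs 2. mat_trace C + mat_trace (minv C) = \<beta>}"
        using g tr by (simp add: R_def)
    qed
  qed
  then have "int (trace_count 2 \<beta>) = int (card {(x, y, z, w). R x y z w})"
    unfolding trace_count_def by (simp add: bij_betw_same_card)
  also have "\<dots> = (\<Sum>x\<in>UNIV. \<Sum>y\<in>UNIV. \<Sum>z\<in>UNIV. \<Sum>w\<in>UNIV. of_bool (R x y z w))"
    by (simp only: card_Collect_sum sum_UNIV_prod case_prod_conv)
  also have "\<dots> = (\<Sum>x\<in>UNIV. \<Sum>y\<in>UNIV. \<Sum>z\<in>UNIV. \<Sum>w\<in>UNIV. \<Sum>d\<in>UNIV - {0}.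
      of_bool ((x + w) * (1 + inverse d) = \<beta>) * of_bool (y * z = x * w + d))"
  proof (intro sum.cong refl)
    fix x y z w :: 'a
    have e: "y * z = x * w + d \<longleftrightarrow> d = x * w + y * z" for d by (metis add_left_self)
    have "(\<Sum>d\<in>UNIV - {0}. of_bool ((x + w) * (1 + inverse d) = \<beta>) * of_bool (y * z = x * w + d))
      = (\<Sum>d\<in>UNIV - {0}. if d = x * w + y * z then of_bool ((x + w) * (1 + inverse d) = \<beta>) else (0::int))"
      unfolding e by (intro sum.cong) auto
    also have "\<dots> = of_bool (R x y z w)" by (simp add: R_def)
    finally show "of_bool (R x y z w) = (\<Sum>d\<in>UNIV - {0}. of_bool ((x + w) * (1 + inverse d) = \<beta>) * of_bool (y * z = x * w + d) :: int)"
      by simp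
  qed
  also have "\<dots> = (\<Sum>d\<in>UNIV - {0}. \<Sum>x\<in>UNIV. \<Sum>w\<in>UNIV.
      of_bool ((x + w) * (1 + inverse d) = \<beta>) * (\<Sum>y\<in>UNIV. \<Sum>z\<in>UNIV. of_bool (y * z = x * w + d)))"
  proof -
    have "(\<Sum>x\<in>UNIV. \<Sum>y\<in>UNIV. \<Sum>z\<in>UNIV. \<Sum>w\<in>UNIV. \<Sum>d\<in>D. f x y z w d) =
       (\<Sum>d\<in>D. \<Sum>x\<in>UNIV. \<Sum>w\<in>UNIV. \<Sum>y\<in>UNIV. \<Sum>z\<in>UNIV. f x y z w d)"
      for f :: "'a \<Rightarrow> 'a \<Rightarrow> 'a \<Rightarrow> 'a \<Rightarrow> 'a \<Rightarrow> int" and D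
    proof -
      have "(\<Sum>x\<in>UNIV. \<Sum>y\<in>UNIV. \<Sum>z\<in>UNIV. \<Sum>w\<in>UNIV. \<Sum>d\<in>D. f x y z w d)
        = (\<Sum>x\<in>UNIV. \<Sum>y\<in>UNIV. \<Sum>w\<in>UNIV. \<Sum>z\<in>UNIV. \<Sum>d\<in>D. f x y z w d)"
        by (rule sum.cong[OF refl], rule sum.cong[OF refl], rule sum.swap)
      also have "\<dots> = (\<Sum>x\<in>UNIV. \<Sum>w\<in>UNIV. \<Sum>y\<in>UNIV. \<Sum>z\<in>UNIV. \<Sum>d\<in>D. f x y z w d)"
        by (rule sum.cong[OF refl], rule sum.swap)
      also have "\<dots> = (\<Sum>x\<in>UNIV. \<Sum>w\<in>UNIV. \<Sum>y\<in>UNIV. \<Sum>d\<in>D. \<Sum>z\<in>UNIV. f x y z w d)"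
        by (rule sum.cong[OF refl], rule sum.cong[OF refl], rule sum.cong[OF refl], rule sum.swap)
      also have "\<dots> = (\<Sum>x\<in>UNIV. \<Sum>w\<in>UNIV. \<Sum>d\<in>D. \<Sum>y\<in>UNIV. \<Sum>z\<in>UNIV. f x y z w d)"
        by (rule sum.cong[OF refl], rule sum.cong[OF refl], rule sum.swap)
      also have "\<dots> = (\<Sum>x\<in>UNIV. \<Sum>d\<in>D. \<Sum>w\<in>UNIV. \<Sum>y\<in>UNIV. \<Sum>z\<in>UNIV. f x y z w d)"
        by (rule sum.cong[OF refl], rule sum.swap)
      also have "\<dots> = (\<Sum>d\<in>D. \<Sum>x\<in>UNIV. \<Sum>w\<in>UNIV. \<Sum>y\<in>UNIV. \<Sum>z\<in>UNIV. f x y z w d)"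
        by (rule sum.swap)
      finally show ?thesis .
    qed
    then show ?thesis by (simp only: sum_distrib_left)
  qed
  also have "\<dots> = (\<Sum>d\<in>UNIV - {0}. \<Sum>x\<in>UNIV. \<Sum>w\<in>UNIV. of_bool ((x + w) * (1 + inverse d) = \<beta>)
      * (int CARD('a) - 1 + int CARD('a) * of_bool (x * w = d)))"
    unfolding card_products by (intro sum.cong refl) (simp add: add_eq_0_iff2)
  also have "\<dots> = (\<Sum>d\<in>UNIV - {0}. \<Sum>x\<in>UNIV. \<Sum>t\<in>UNIV. of_bool (t * (1 + inverse d) = \<beta>)
      * (int CARD('a) - 1 + int CARD('a) * of_bool (x\<^sup>2 + t * x = d)))"
  proof (rule sum.cong[OF refl], rule sum.cong[OF refl])
    fix d x :: 'a
    show "(\<Sum>w\<in>UNIV. of_bool ((x + w) * (1 + inverse d) = \<beta>) * (int CARD('a) - 1 + int CARD('a) * of_bool (x * w = d)))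
      = (\<Sum>t\<in>UNIV. of_bool (t * (1 + inverse d) = \<beta>) * (int CARD('a) - 1 + int CARD('a) * of_bool (x\<^sup>2 + t * x = d)))"
    proof (rule sum.reindex_bij_witness[of _ "\<lambda>t. x + t" "\<lambda>w. x + w"])
      fix w :: 'a
      have "x\<^sup>2 + (x + w) * x = (x\<^sup>2 + x\<^sup>2) + x * w" by (simp add: power2_eq_square algebra_simps)
      also have "\<dots> = x * w" by (simp only: add_self add_0)
      finally show "of_bool ((x + w) * (1 + inverse d) = \<beta>) * (int CARD('a) - 1 + int CARD('a) * of_bool (x\<^sup>2 + (x + w) * x = d))
        = of_bool ((x + w) * (1 + inverse d) = \<beta>) * (int CARD('a) - 1 + int CARD('a) * of_bool (x * w = d))" by simp
    qed (simp_all add: add_left_self)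
  qed
  also have "\<dots> = (\<Sum>d\<in>UNIV - {0}. \<Sum>t\<in>UNIV. of_bool (t * (1 + inverse d) = \<beta>)
      * (int CARD('a) * (int CARD('a) - 1) + int CARD('a) * int (card {x. x\<^sup>2 + t * x = d})))"
    unfolding card_Collect_sum
    by (rule sum.cong[OF refl], subst sum.swap) (simp add: sum.distrib flip: sum_distrib_left)
  also have "\<dots> = (\<Sum>d\<in>UNIV - {0::'a}. \<Sum>t | t * (1 + inverse d) = \<beta>.
     int CARD('a) * (int CARD('a) - 1) + int CARD('a) * int (card {x. x\<^sup>2 + t * x = d}))"
    by (simp only: sum_of_bool_mult)
  finally show ?thesis .
qed

text \<open>For \<open>d\<close> other than 1 the trace is forced to be
  \<open>t = \<beta> / (1 + 1/d)\<close>, and then \<open>d / t^2\<close> is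
  \<open>(d + 1/d) / \<beta>^2\<close>. The sum of the character over \<open>d\<close> is therefore
  a Kloosterman sum with a square parameter.\<close>

lemma trace_count_2:
  "int (trace_count 2 \<beta>) = int CARD('a) ^ 3 - 2 * int CARD('a) ^ 2 - int CARD('a)
     + int CARD('a) * (if \<beta> = 0 then int CARD('a) ^ 2 else Kloost r (inverse (\<beta>::'a)))"
proof -
  let ?q = "int CARD('a)"
  define c where "c t d = ?q * (?q - 1) + ?q * int (card {x. x\<^sup>2 + t * x = (d::'a)})" for t d
  have c0: "c 0 d = ?q\<^sup>2" for d using card_square_root[of d] by (simp add: c_def power2_eq_square algebra_simps)
  have ct: "c t d = ?q\<^sup>2 + ?q * lam (d / t\<^sup>2)" if "t \<noteq> 0" for t d
    unfolding c_def card_quadratic[OF that] by (simp add: power2_eq_square algebra_simps)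
  have inv1: "1 + inverse d = 0 \<longleftrightarrow> d = 1" for d :: 'a
    by (metis add_eq_0_iff2 inverse_1 inverse_inverse_eq)
  have "int (trace_count 2 \<beta>) = (\<Sum>d\<in>UNIV - {0}. \<Sum>t | t * (1 + inverse d) = \<beta>. c t d)"
    unfolding trace_count_2_sum c_def ..
  also have "\<dots> = (\<Sum>t | t * (1 + inverse 1) = \<beta>. c t 1) + (\<Sum>d\<in>UNIV - {0} - {1}. \<Sum>t | t * (1 + inverse d) = \<beta>. c t d)"
    by (rule sum.remove) auto
  also have "(\<Sum>d\<in>UNIV - {0} - {1}. \<Sum>t | t * (1 + inverse d) = \<beta>. c t d) = (\<Sum>d\<in>UNIV - {0} - {1}. c (\<beta> / (1 + inverse d)) d)"
  proof (intro sum.cong refl)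
    fix d :: 'a assume "d \<in> UNIV - {0} - {1}"
    then have "1 + inverse d \<noteq> 0" using inv1 by auto
    then have "{t. t * (1 + inverse d) = \<beta>} = {\<beta> / (1 + inverse d)}"
      by (auto simp: eq_divide_eq simp del: divide_inverse)
    then show "(\<Sum>t | t * (1 + inverse d) = \<beta>. c t d) = c (\<beta> / (1 + inverse d)) d" by simp
  qed
  \<comment> \<open>For determinant 1 the factor \<open>1 + 1/d\<close> vanishes: no trace is
    admissible unless \<beta> is 0, and then every \<open>t\<close> is.\<close>
  also have "(\<Sum>t | t * (1 + inverse 1) = \<beta>. c t 1) = (if \<beta> = 0 then ?q ^ 3 - ?q else 0)"
  proof (cases "\<beta> = 0")
    case True
    then have "{t. t * (1 + inverse 1) = \<beta>} = UNIV" by (simp add: add_self)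
    then have "(\<Sum>t | t * (1 + inverse 1) = \<beta>. c t 1) = c 0 1 + (\<Sum>t\<in>UNIV - {0}. c t 1)"
      by (simp add: sum.remove[of UNIV 0])
    also have "(\<Sum>t\<in>UNIV - {0}. c t 1) = (\<Sum>t\<in>UNIV - {0}. ?q\<^sup>2 + ?q * lam (inverse t))"
    proof (intro sum.cong refl)
      fix t :: 'a assume t: "t \<in> UNIV - {0}"
      have "lam (1 / t\<^sup>2) = lam ((inverse t)\<^sup>2)" by (simp add: power_inverse divide_inverse)
      then show "c t 1 = ?q\<^sup>2 + ?q * lam (inverse t)" using t by (simp add: ct lam_square)
    qed
    also have "\<dots> = (\<Sum>t\<in>UNIV - {0::'a}. ?q\<^sup>2) + ?q * (\<Sum>t\<in>UNIV - {0}. lam (inverse t))"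
      by (simp only: sum.distrib sum_distrib_left)
    also have "(\<Sum>t\<in>UNIV - {0}. lam (inverse t)) = (\<Sum>t\<in>UNIV - {0}. lam t)"
      by (rule sum.reindex_bij_witness[of _ inverse inverse]) auto
    finally show ?thesis using True
      by (simp add: c0 sum_lam_nonzero card_Diff_singleton of_nat_diff power2_eq_square power3_eq_cube algebra_simps)
  qed (simp add: add_self)
  also have "(\<Sum>d\<in>UNIV - {0} - {1}. c (\<beta> / (1 + inverse d)) d) =
     (?q - 2) * ?q\<^sup>2 + (if \<beta> = 0 then 0 else ?q * (Kloost r (inverse \<beta>) - 1))"
  proof -
    have card2: "int (card (UNIV - {0} - {1::'a})) = ?q - 2"
    proof -
      have "card {0, 1::'a} \<le> CARD('a)" by (intro card_mono) auto
      then have "2 \<le> CARD('a)" by simp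
      then show ?thesis by (simp add: card_Diff_singleton of_nat_diff)
    qed
    show ?thesis
    proof (cases "\<beta> = 0")
      case True
      then show ?thesis using card2 by (simp add: c0)
    next
      case False
      have "(\<Sum>d\<in>UNIV - {0} - {1}. c (\<beta> / (1 + inverse d)) d)
        = (\<Sum>d\<in>UNIV - {0} - {1}. ?q\<^sup>2 + ?q * lam ((inverse \<beta>)\<^sup>2 * (d + inverse d)))"
      proof (intro sum.cong refl)
        fix d :: 'a assume d: "d \<in> UNIV - {0} - {1}"
        then have nz: "1 + inverse d \<noteq> 0" "d \<noteq> 0" using inv1 by auto
        have "d / (\<beta> / (1 + inverse d))\<^sup>2 = (inverse \<beta>)\<^sup>2 * (d * (1 + inverse d)\<^sup>2)"
          by (simp add: power_divide power_inverse divide_inverse power_mult_distrib)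
        also have "d * (1 + inverse d)\<^sup>2 = d + inverse d"
          unfolding square_add using nz by (simp add: distrib_left power2_eq_square)
        finally show "c (\<beta> / (1 + inverse d)) d = ?q\<^sup>2 + ?q * lam ((inverse \<beta>)\<^sup>2 * (d + inverse d))"
          using False nz by (simp add: ct)
      qed
      also have "\<dots> = (?q - 2) * ?q\<^sup>2 + ?q * (\<Sum>d\<in>UNIV - {0} - {1}. lam ((inverse \<beta>)\<^sup>2 * (d + inverse d)))"
        using card2 by (simp add: sum.distrib sum_distrib_left)
      \<comment> \<open>The omitted index \<open>d = 1\<close> would contribute the character at 0,
        which is 1.\<close>
      also have "(\<Sum>d\<in>UNIV - {0} - {1}. lam ((inverse \<beta>)\<^sup>2 * (d + inverse d))) = Kloost r ((inverse \<beta>)\<^sup>2) - 1"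
        using lam_scaled_Kloost[of "(inverse \<beta>)\<^sup>2"] False by (simp add: sum_diff1 add_self)
      finally show ?thesis using False by (simp only: Kloost_square if_False)
    qed
  qed
  finally show ?thesis by (simp add: power2_eq_square power3_eq_cube algebra_simps)
qed

end

section \<open>The matrix sigma, the symplectic form and the stabiliser\<close>

definition proj_mat :: "nat \<Rightarrow> (nat \<Rightarrow> bool) \<Rightarrow> 'a::field mat" where
  "proj_mat n Q = mat n n (\<lambda>(i, j). if i = j \<and> Q i then 1 else 0)"

lemma proj_mat_carrier [simp]: "proj_mat n Q \<in> carrier_mat n n"
  by (simp add: proj_mat_def)

lemma proj_mat_mult_left:
  assumes "X \<in> carrier_mat n m"
  shows "proj_mat n Q * X = mat n m (\<lambda>(i, j). if Q i then X $$ (i, j) else 0)"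
proof (rule eq_matI)
  fix i j assume "i < dim_row (mat n m (\<lambda>(i, j). if Q i then X $$ (i, j) else 0))"
    "j < dim_col (mat n m (\<lambda>(i, j). if Q i then X $$ (i, j) else 0))"
  then have ij: "i < n" "j < m" by auto
  then have "(proj_mat n Q * X) $$ (i, j) = (\<Sum>l<n. (if i = l \<and> Q i then 1 else 0) * X $$ (l, j))"
    using assms by (auto simp: proj_mat_def scalar_prod_def atLeast0LessThan intro!: sum.cong)
  also have "\<dots> = (\<Sum>l<n. if l = i then (if Q i then X $$ (i, j) else 0) else 0)"
    by (intro sum.cong) auto
  finally show "(proj_mat n Q * X) $$ (i, j) = mat n m (\<lambda>(i, j). if Q i then X $$ (i, j) else 0) $$ (i, j)"
    using ij by simp
qed (use assms in \<open>auto simp: proj_mat_def\<close>)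

lemma transpose_proj_mat: "transpose_mat (proj_mat n Q) = proj_mat n Q"
  by (rule eq_matI) (auto simp: proj_mat_def)

lemma proj_mat_mult_right:
  assumes "X \<in> carrier_mat m n"
  shows "X * proj_mat n Q = mat m n (\<lambda>(i, j). if Q j then X $$ (i, j) else (0::'a::field))"
proof -
  have "transpose_mat (X * proj_mat n Q) = proj_mat n Q * transpose_mat X"
    using assms by (simp add: transpose_mult[of _ m n _ n] transpose_proj_mat)
  also have "\<dots> = mat n m (\<lambda>(i, j). if Q i then transpose_mat X $$ (i, j) else 0)"
    by (rule proj_mat_mult_left) (use assms in auto)
  finally have "transpose_mat (transpose_mat (X * proj_mat n Q)) = transpose_mat (mat n m (\<lambda>(i, j). if Q i then transpose_mat X $$ (i, j) else 0))"
    by simp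
  then show ?thesis using assms by (auto intro!: eq_matI)
qed

lemma proj_mat_mult: "proj_mat n Q * proj_mat n R = (proj_mat n (\<lambda>i. Q i \<and> R i) :: 'a::field mat)"
  unfolding proj_mat_mult_left[OF proj_mat_carrier] by (rule eq_matI) (auto simp: proj_mat_def)

lemma sigma_mat_eq:
  "sigma_mat (s + k) s = four_block_mat (proj_mat (s + k) (\<lambda>i. s \<le> i)) (proj_mat (s + k) (\<lambda>i. i < s))
     (proj_mat (s + k) (\<lambda>i. i < s)) (proj_mat (s + k) (\<lambda>i. s \<le> i) :: 'a::field mat)"
proof -
  have "four_block_mat (0\<^sub>m s s) (0\<^sub>m s k) (0\<^sub>m k s) (1\<^sub>m k) = (proj_mat (s + k) (\<lambda>i. s \<le> i) :: 'a mat)"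
    "four_block_mat (1\<^sub>m s) (0\<^sub>m s k) (0\<^sub>m k s) (0\<^sub>m k k) = (proj_mat (s + k) (\<lambda>i. i < s) :: 'a mat)"
    by (rule eq_matI; auto simp: proj_mat_def)+
  then show ?thesis by (simp add: sigma_mat_def Let_def)
qed

lemma mat_trace_four_block:
  fixes A :: "'a::field mat"
  assumes "A \<in> carrier_mat n n" "D \<in> carrier_mat m m"
  shows "mat_trace (four_block_mat A B C D) = mat_trace A + mat_trace D"
proof -
  have "mat_trace (four_block_mat A B C D) = (\<Sum>i<n. four_block_mat A B C D $$ (i, i)) + (\<Sum>i<m. four_block_mat A B C D $$ (n + i, n + i))"
  proof -
    have "(\<Sum>i<n + m. f i) = (\<Sum>i<n. f i) + (\<Sum>i<m. f (n + i))" for f :: "nat \<Rightarrow> 'a"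
      by (induction m) (auto simp: add.assoc)
    then show ?thesis using assms by (simp add: mat_trace_def)
  qed
  then show ?thesis using assms by (simp add: mat_trace_def)
qed

context char2_field
begin

definition symp :: "nat \<Rightarrow> 'a mat" where
  "symp n = four_block_mat (0\<^sub>m n n) (1\<^sub>m n) (1\<^sub>m n) (0\<^sub>m n n)"

definition is_symplectic :: "nat \<Rightarrow> 'a mat \<Rightarrow> bool" where
  "is_symplectic n W \<longleftrightarrow> W \<in> carrier_mat (n + n) (n + n) \<and> transpose_mat W * symp n * W = symp n"

lemma symp_carrier: "symp n \<in> carrier_mat (n + n) (n + n)"
  unfolding symp_def by (rule four_block_carrier_mat) auto

lemma is_symplectic_mult:
  assumes "is_symplectic n V" "is_symplectic n W"
  shows "is_symplectic n (V * W)"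
proof -
  have c: "V \<in> carrier_mat (n + n) (n + n)" "W \<in> carrier_mat (n + n) (n + n)"
    and e: "transpose_mat V * symp n * V = symp n" "transpose_mat W * symp n * W = symp n"
    using assms by (auto simp: is_symplectic_def)
  have "transpose_mat (V * W) * symp n * (V * W) = transpose_mat W * (transpose_mat V * symp n * V) * W"
    using c symp_carrier[of n]
    by (simp add: transpose_mult[of _ "n + n" "n + n" _ "n + n"] assoc_mult_mat[of _ "n + n" "n + n" _ "n + n" _ "n + n"])
  then show ?thesis using c e by (simp add: is_symplectic_def)
qed

lemma four_block_form:
  assumes "A \<in> carrier_mat n n" "B \<in> carrier_mat n n" "C \<in> carrier_mat n n" "D \<in> carrier_mat n n"
  shows "transpose_mat (four_block_mat A B C D) * symp n * four_block_mat A B C D =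
    four_block_mat (transpose_mat A * C + transpose_mat C * A) (transpose_mat A * D + transpose_mat C * B)
      (transpose_mat B * C + transpose_mat D * A) (transpose_mat B * D + transpose_mat D * B)"
proof -
  have J: "symp n * four_block_mat A B C D = four_block_mat C D A B"
    unfolding symp_def using assms by (subst mult_four_block_mat[of _ n n _ n _ n _ _ n _ n]) auto
  have "transpose_mat (four_block_mat A B C D) * symp n * four_block_mat A B C D
    = transpose_mat (four_block_mat A B C D) * four_block_mat C D A B"
    using assms symp_carrier[of n] unfolding J[symmetric]
    by (intro assoc_mult_mat[of _ "n + n" "n + n" _ "n + n" _ "n + n"]) auto
  moreover have "transpose_mat (four_block_mat A B C D) = four_block_mat (transpose_mat A) (transpose_mat C) (transpose_mat B) (transpose_mat D)"
    by (rule transpose_four_block_mat) (use assms in auto)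
  moreover have "four_block_mat (transpose_mat A) (transpose_mat C) (transpose_mat B) (transpose_mat D) * four_block_mat C D A B =
      four_block_mat (transpose_mat A * C + transpose_mat C * A) (transpose_mat A * D + transpose_mat C * B)
      (transpose_mat B * C + transpose_mat D * A) (transpose_mat B * D + transpose_mat D * B)"
    using assms by (subst mult_four_block_mat[of _ n n _ n _ n _ _ n _ n]) auto
  ultimately show ?thesis by metis
qed

lemma is_symplectic_parabolic:
  assumes "p \<in> parabolic n"
  shows "is_symplectic n p"
proof -
  obtain A B where A: "A \<in> GLs n" and B: "B \<in> carrier_mat n n" "transpose_mat B = B" and p: "p = para A B"
    using assms unfolding parabolic_eq sym_mats_0 by (auto simp: sym_mats_0)
  note c = GLs_carrier[OF A] minv[OF A]
  have t1: "transpose_mat A * transpose_mat (minv A) = 1\<^sub>m n"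
    using c by (simp flip: transpose_mult[of _ n n _ n])
  have BA: "transpose_mat (A * B) = B * transpose_mat A"
    using c B by (simp add: transpose_mult[of _ n n _ n])
  have "transpose_mat (A * B) * transpose_mat (minv A) = B"
    unfolding BA using c B t1 by (simp add: assoc_mult_mat[of _ n n _ n _ n])
  moreover have "minv A * (A * B) = B"
    using c B by (simp flip: assoc_mult_mat[of _ n n _ n _ n])
  ultimately have "transpose_mat p * symp n * p = symp n"
    unfolding p para_def using c B t1
    by (subst four_block_form) (auto simp: symp_def mat_add_self)
  then show ?thesis using para_carrier[OF A] by (simp add: is_symplectic_def p)
qed

text \<open>Reduces membership in \<open>P\<close> to a single block: for products already known to
  be symplectic it suffices that the lower left block is zero. The form then forces \<open>D\<close>
  to be the inverse transpose of \<open>A\<close> and makes the unipotent part symmetric.\<close>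

lemma parabolic_if_symplectic:
  assumes "A \<in> carrier_mat n n" "B \<in> carrier_mat n n" "D \<in> carrier_mat n n"
    and "is_symplectic n (four_block_mat A B (0\<^sub>m n n) D)"
  shows "four_block_mat A B (0\<^sub>m n n) D \<in> parabolic n"
proof -
  have "four_block_mat (transpose_mat A * 0\<^sub>m n n + transpose_mat (0\<^sub>m n n) * A) (transpose_mat A * D + transpose_mat (0\<^sub>m n n) * B)
      (transpose_mat B * 0\<^sub>m n n + transpose_mat D * A) (transpose_mat B * D + transpose_mat D * B) = symp n"
    using assms four_block_form[of A n B "0\<^sub>m n n" D] by (auto simp: is_symplectic_def)
  then have "transpose_mat B * 0\<^sub>m n n + transpose_mat D * A = 1\<^sub>m n" "transpose_mat B * D + transpose_mat D * B = 0\<^sub>m n n"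
    unfolding symp_def using assms
    by (subst (asm) four_block_inject[of _ n n _ n _ n]; auto)+
  then have DA: "transpose_mat D * A = 1\<^sub>m n" and BD: "transpose_mat B * D = transpose_mat D * B"
    using assms mat_add_eq_0_iff[of "transpose_mat B * D" n n "transpose_mat D * B"] by auto
  have AD: "A * transpose_mat D = 1\<^sub>m n"
    using mat_mult_left_right_inverse[OF _ assms(1) DA] assms by simp
  have A: "A \<in> GLs n" using GLs_I[OF assms(1) _ AD] assms by simp
  have mA: "minv A = transpose_mat D" by (rule minv_unique[OF assms(1) _ AD]) (use assms in auto)
  have "A * (transpose_mat D * B) = B"
    using AD assms by (simp flip: assoc_mult_mat[of _ n n _ n _ n])
  then have "four_block_mat A B (0\<^sub>m n n) D = para A (transpose_mat D * B)"
    unfolding para_def mA using assms by simp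
  moreover have "transpose_mat D * B \<in> sym_mats n 0"
    unfolding sym_mats_0 using assms BD by (simp add: transpose_mult[of _ n n _ n])
  ultimately show ?thesis unfolding parabolic_eq using A by auto
qed

lemma is_symplectic_sigma: "is_symplectic (s + k) (sigma_mat (s + k) s)"
proof -
  let ?n = "s + k"
  let ?D = "proj_mat ?n (\<lambda>i. s \<le> i) :: 'a mat" and ?E = "proj_mat ?n (\<lambda>i. i < s) :: 'a mat"
  have "transpose_mat (sigma_mat ?n s) * symp ?n * sigma_mat ?n s =
      four_block_mat (?D * ?E + ?E * ?D) (?D * ?D + ?E * ?E) (?E * ?E + ?D * ?D) (?E * ?D + ?D * ?E)"
    unfolding sigma_mat_eq by (subst four_block_form) (auto simp: transpose_proj_mat)
  moreover have "?D * ?E + ?E * ?D = 0\<^sub>m ?n ?n" "?D * ?D + ?E * ?E = 1\<^sub>m ?n" "?E * ?E + ?D * ?D = 1\<^sub>m ?n" "?E * ?D + ?D * ?E = 0\<^sub>m ?n ?n"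
    unfolding proj_mat_mult by (rule eq_matI; auto simp: proj_mat_def)+
  ultimately have "transpose_mat (sigma_mat ?n s) * symp ?n * sigma_mat ?n s = (symp ?n :: 'a mat)"
    by (simp only: symp_def)
  moreover have "sigma_mat ?n s \<in> carrier_mat (?n + ?n) (?n + ?n)"
    unfolding sigma_mat_eq by (rule four_block_carrier_mat) auto
  ultimately show ?thesis unfolding is_symplectic_def by blast
qed

lemma sigma_square: "sigma_mat (s + k) s * sigma_mat (s + k) s = (1\<^sub>m (s + k + (s + k)) :: 'a mat)"
proof -
  let ?n = "s + k"
  let ?D = "proj_mat ?n (\<lambda>i. s \<le> i) :: 'a mat" and ?E = "proj_mat ?n (\<lambda>i. i < s) :: 'a mat"
  have "sigma_mat ?n s * sigma_mat ?n s = four_block_mat (?D * ?D + ?E * ?E) (?D * ?E + ?E * ?D) (?E * ?D + ?D * ?E) (?E * ?E + ?D * ?D)"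
    unfolding sigma_mat_eq by (subst mult_four_block_mat[of _ ?n ?n _ ?n _ ?n _ _ ?n _ ?n]) auto
  moreover have "?D * ?E + ?E * ?D = 0\<^sub>m ?n ?n" "?D * ?D + ?E * ?E = 1\<^sub>m ?n" "?E * ?E + ?D * ?D = 1\<^sub>m ?n" "?E * ?D + ?D * ?E = 0\<^sub>m ?n ?n"
    unfolding proj_mat_mult by (rule eq_matI; auto simp: proj_mat_def)+
  ultimately show ?thesis by (simp only: four_block_one_mat)
qed

lemma sigma_carrier: "sigma_mat (s + k) s \<in> carrier_mat (s + k + (s + k)) (s + k + (s + k))"
  unfolding sigma_mat_eq by (rule four_block_carrier_mat) auto

lemma para_sigma:
  assumes "A \<in> GLs (s + k)" "B \<in> carrier_mat (s + k) (s + k)"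
  defines "D \<equiv> proj_mat (s + k) (\<lambda>i. s \<le> i) :: 'a mat" and "E \<equiv> proj_mat (s + k) (\<lambda>i. i < s) :: 'a mat"
  shows "para A B * sigma_mat (s + k) s = four_block_mat (A * D + A * B * E) (A * E + A * B * D)
      (transpose_mat (minv A) * E) (transpose_mat (minv A) * D)"
    and "sigma_mat (s + k) s * para A B * sigma_mat (s + k) s = four_block_mat
      (D * (A * D + A * B * E) + E * (transpose_mat (minv A) * E)) (D * (A * E + A * B * D) + E * (transpose_mat (minv A) * D))
      (E * (A * D + A * B * E) + D * (transpose_mat (minv A) * E)) (E * (A * E + A * B * D) + D * (transpose_mat (minv A) * D))"
proof -
  let ?n = "s + k"
  note c = GLs_carrier[OF assms(1)] minv(1)[OF assms(1)] assms(2)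
  have DE: "D \<in> carrier_mat ?n ?n" "E \<in> carrier_mat ?n ?n" by (auto simp: D_def E_def)
  show 1: "para A B * sigma_mat (s + k) s = four_block_mat (A * D + A * B * E) (A * E + A * B * D)
      (transpose_mat (minv A) * E) (transpose_mat (minv A) * D)"
    unfolding para_def sigma_mat_eq D_def[symmetric] E_def[symmetric] using c DE
    by (subst mult_four_block_mat[of _ ?n ?n _ ?n _ ?n _ _ ?n _ ?n]) auto
  have "sigma_mat (s + k) s * para A B * sigma_mat (s + k) s = sigma_mat (s + k) s * (para A B * sigma_mat (s + k) s)"
    by (rule assoc_mult_mat[OF sigma_carrier para_carrier[OF assms(1)] sigma_carrier])
  then show "sigma_mat (s + k) s * para A B * sigma_mat (s + k) s = four_block_mat
      (D * (A * D + A * B * E) + E * (transpose_mat (minv A) * E)) (D * (A * E + A * B * D) + E * (transpose_mat (minv A) * D))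
      (E * (A * D + A * B * E) + D * (transpose_mat (minv A) * E)) (E * (A * E + A * B * D) + D * (transpose_mat (minv A) * D))"
    unfolding 1 unfolding sigma_mat_eq D_def[symmetric] E_def[symmetric] using c DE
    by (subst (asm) mult_four_block_mat[of _ ?n ?n _ ?n _ ?n _ _ ?n _ ?n]) auto
qed

lemma GLs_block_triangular:
  assumes A: "A \<in> GLs (s + k)" "submat A 0 s s k = (0\<^sub>m s k :: 'a mat)"
  shows "submat A 0 0 s s \<in> GLs s" "submat A s s k k \<in> GLs k"
    "submat (minv A) 0 s s k = 0\<^sub>m s k" "submat (minv A) s s k k = minv (submat A s s k k)"
proof -
  note c = GLs_carrier[OF A(1)] minv[OF A(1)]
  have eq: "A = four_block_mat (submat A 0 0 s s) (0\<^sub>m s k) (submat A s 0 k s) (submat A s s k k)"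
    using four_block_submat[OF c(1)] A(2) by simp
  have "det A = det (submat A 0 0 s s) * det (submat A s s k k)"
    by (subst eq, rule det_four_block_mat_upper_right_zero) auto
  then show g: "submat A 0 0 s s \<in> GLs s" "submat A s s k k \<in> GLs k" using A(1) by (auto simp: GLs_def)
  define P Q R S where "P = submat (minv A) 0 0 s s" and "Q = submat (minv A) 0 s s k"
    and "R = submat (minv A) s 0 k s" and "S = submat (minv A) s s k k"
  have cc: "P \<in> carrier_mat s s" "Q \<in> carrier_mat s k" "R \<in> carrier_mat k s" "S \<in> carrier_mat k k"
    by (auto simp: P_def Q_def R_def S_def)
  have eq': "minv A = four_block_mat P Q R S"
    using four_block_submat[OF c(2)] by (simp add: P_def Q_def R_def S_def)
  define A1 A3 A4 where "A1 = submat A 0 0 s s" and "A3 = submat A s 0 k s" and "A4 = submat A s s k k"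
  have cA: "A1 \<in> carrier_mat s s" "A3 \<in> carrier_mat k s" "A4 \<in> carrier_mat k k"
    by (auto simp: A1_def A3_def A4_def)
  have "four_block_mat A1 (0\<^sub>m s k) A3 A4 * four_block_mat P Q R S = four_block_mat (1\<^sub>m s) (0\<^sub>m s k) (0\<^sub>m k s) (1\<^sub>m k)"
    using c(3) unfolding eq' using eq by (simp add: A1_def A3_def A4_def)
  moreover have "four_block_mat A1 (0\<^sub>m s k) A3 A4 * four_block_mat P Q R S =
      four_block_mat (A1 * P + 0\<^sub>m s k * R) (A1 * Q + 0\<^sub>m s k * S) (A3 * P + A4 * R) (A3 * Q + A4 * S)"
    by (rule mult_four_block_mat) (use cA cc in auto)
  ultimately have "four_block_mat (A1 * P + 0\<^sub>m s k * R) (A1 * Q + 0\<^sub>m s k * S) (A3 * P + A4 * R) (A3 * Q + A4 * S)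
      = four_block_mat (1\<^sub>m s) (0\<^sub>m s k) (0\<^sub>m k s) (1\<^sub>m k)" by simp
  then have "A1 * Q + 0\<^sub>m s k * S = 0\<^sub>m s k \<and> A3 * Q + A4 * S = 1\<^sub>m k"
    using cA cc by (subst (asm) four_block_inject[of _ s s _ k _ k]) auto
  then have AQ: "A1 * Q = 0\<^sub>m s k" and AS: "A3 * Q + A4 * S = 1\<^sub>m k" using cA cc by auto
  have "Q = minv A1 * A1 * Q" using minv[OF g(1)] cc by (simp add: A1_def)
  also have "\<dots> = minv A1 * (A1 * Q)"
    using minv[OF g(1)] cc cA by (intro assoc_mult_mat[of _ s s _ s _ k]) (auto simp: A1_def)
  finally have Q: "Q = 0\<^sub>m s k" using minv(1)[OF g(1)] AQ by (simp add: A1_def)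
  then show "submat (minv A) 0 s s k = 0\<^sub>m s k" by (simp add: Q_def)
  have "A4 * S = 1\<^sub>m k" using AS cA cc Q by simp
  then show "submat (minv A) s s k k = minv (submat A s s k k)"
    using minv_unique[of A4 k S] cA cc by (simp add: A4_def S_def)
qed

lemma submat_eq_0_iff: "submat X a c nr nc = 0\<^sub>m nr nc \<longleftrightarrow> (\<forall>i<nr. \<forall>j<nc. X $$ (a + i, c + j) = 0)"
proof
  assume "submat X a c nr nc = 0\<^sub>m nr nc"
  then have "submat X a c nr nc $$ (i, j) = 0" if "i < nr" "j < nc" for i j using that by simp
  then show "\<forall>i<nr. \<forall>j<nc. X $$ (a + i, c + j) = 0" by (simp add: submat_def)
qed (auto intro!: eq_matI simp: submat_def)

lemma submat_mult_upper_left: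
  assumes "A \<in> carrier_mat (s + k) (s + k)" "B \<in> carrier_mat (s + k) (s + k)" "submat A 0 s s k = (0\<^sub>m s k :: 'a mat)"
  shows "submat (A * B) 0 0 s s = submat A 0 0 s s * submat B 0 0 s s"
proof -
  have A: "A = four_block_mat (submat A 0 0 s s) (0\<^sub>m s k) (submat A s 0 k s) (submat A s s k k)"
    using four_block_submat[OF assms(1)] assms(3) by simp
  have B: "B = four_block_mat (submat B 0 0 s s) (submat B 0 s s k) (submat B s 0 k s) (submat B s s k k)"
    using four_block_submat[OF assms(2)] by simp
  have AB: "A * B = four_block_mat (submat A 0 0 s s * submat B 0 0 s s + 0\<^sub>m s k * submat B s 0 k s)
     (submat A 0 0 s s * submat B 0 s s k + 0\<^sub>m s k * submat B s s k k)
     (submat A s 0 k s * submat B 0 0 s s + submat A s s k k * submat B s 0 k s)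
     (submat A s 0 k s * submat B 0 s s k + submat A s s k k * submat B s s k k)"
    by (subst A, subst B, rule mult_four_block_mat[of _ s s _ k _ k _ _ s _ k]) auto
  have "submat (A * B) 0 0 s s = submat A 0 0 s s * submat B 0 0 s s + 0\<^sub>m s k * submat B s 0 k s"
    unfolding AB
  proof (rule submat_four_block(1))
    show "submat A 0 0 s s * submat B 0 s s k + 0\<^sub>m s k * submat B s s k k \<in> carrier_mat s k"
      "submat A s 0 k s * submat B 0 0 s s + submat A s s k k * submat B s 0 k s \<in> carrier_mat k s"
      "submat A s 0 k s * submat B 0 s s k + submat A s s k k * submat B s s k k \<in> carrier_mat k k"
      "submat A 0 0 s s * submat B 0 0 s s + 0\<^sub>m s k * submat B s 0 k s \<in> carrier_mat s s"
      by (rule add_carrier_mat, rule mult_carrier_mat, rule zero_carrier_mat submat_carrier, rule submat_carrier)+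
  qed
  moreover have "submat A 0 0 s s * submat B 0 0 s s \<in> carrier_mat s s"
    by (rule mult_carrier_mat, rule submat_carrier, rule submat_carrier)
  ultimately show ?thesis by (simp add: left_mult_zero_mat[OF submat_carrier])
qed

text \<open>The conditions say that the lower left block of the conjugate of \<open>para A B\<close> vanishes.\<close>

lemma sigma_conj_parabolic_iff:
  assumes A: "A \<in> GLs (s + k)" and B: "B \<in> sym_mats (s + k) 0"
  shows "sigma_mat (s + k) s * para A B * sigma_mat (s + k) s \<in> parabolic (s + k) \<longleftrightarrow>
    submat A 0 s s k = (0\<^sub>m s k :: 'a mat) \<and> submat B 0 0 s s = 0\<^sub>m s s"
proof -
  let ?n = "s + k"
  have Bc: "B \<in> carrier_mat ?n ?n" using B by (simp add: sym_mats_0)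
  note c = GLs_carrier[OF A] minv(1)[OF A] Bc
  define D E where "D = (proj_mat ?n (\<lambda>i. s \<le> i) :: 'a mat)" and "E = (proj_mat ?n (\<lambda>i. i < s) :: 'a mat)"
  define L where "L = E * (A * D + A * B * E) + D * (transpose_mat (minv A) * E)"
  have DE: "D \<in> carrier_mat ?n ?n" "E \<in> carrier_mat ?n ?n" by (auto simp: D_def E_def)
  have L_eq: "L = mat ?n ?n (\<lambda>(i, j). (if i < s then (if s \<le> j then A $$ (i, j) else (A * B) $$ (i, j)) else
      (if j < s then minv A $$ (j, i) else 0)))"
  proof -
    have cc: "A * D + A * B * E \<in> carrier_mat ?n ?n" "transpose_mat (minv A) * E \<in> carrier_mat ?n ?n" "A * B \<in> carrier_mat ?n ?n"
      "transpose_mat (minv A) \<in> carrier_mat ?n ?n"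
      using c DE by auto
    have "E * (A * D + A * B * E) = mat ?n ?n (\<lambda>(i, j). if i < s then (A * D + A * B * E) $$ (i, j) else 0)"
      "D * (transpose_mat (minv A) * E) = mat ?n ?n (\<lambda>(i, j). if s \<le> i then (transpose_mat (minv A) * E) $$ (i, j) else 0)"
      unfolding E_def D_def by (rule proj_mat_mult_left; use cc in \<open>simp add: E_def D_def\<close>)+
    moreover have "A * D = mat ?n ?n (\<lambda>(i, j). if s \<le> j then A $$ (i, j) else 0)"
      "A * B * E = mat ?n ?n (\<lambda>(i, j). if j < s then (A * B) $$ (i, j) else 0)"
      "transpose_mat (minv A) * E = mat ?n ?n (\<lambda>(i, j). if j < s then transpose_mat (minv A) $$ (i, j) else 0)"
      unfolding E_def D_def by (rule proj_mat_mult_right; use c cc in simp)+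
    ultimately show ?thesis
      unfolding L_def using c(2) by (simp only:) (rule eq_matI, auto)
  qed
  have L0: "L = 0\<^sub>m ?n ?n \<longleftrightarrow> submat A 0 s s k = (0\<^sub>m s k :: 'a mat) \<and> submat B 0 0 s s = 0\<^sub>m s s"
  proof
    assume "L = 0\<^sub>m ?n ?n"
    then have z: "L $$ (i, j) = 0" if "i < ?n" "j < ?n" for i j using that by simp
    have UR: "submat A 0 s s k = 0\<^sub>m s k"
      unfolding submat_eq_0_iff
    proof (intro allI impI)
      fix i j assume "i < s" "j < k"
      then show "A $$ (0 + i, s + j) = 0" using z[of i "s + j"] by (simp add: L_eq)
    qed
    have "submat (A * B) 0 0 s s = 0\<^sub>m s s"
      unfolding submat_eq_0_iff
    proof (intro allI impI)
      fix i j assume "i < s" "j < s"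
      then show "(A * B) $$ (0 + i, 0 + j) = 0" using z[of i j] by (simp add: L_eq del: index_mult_mat)
    qed
    then have AB: "submat A 0 0 s s * submat B 0 0 s s = 0\<^sub>m s s"
      using submat_mult_upper_left[OF c(1,3) UR] by simp
    note g = minv[OF GLs_block_triangular(1)[OF A UR]]
    have "submat B 0 0 s s = minv (submat A 0 0 s s) * submat A 0 0 s s * submat B 0 0 s s"
      using g by (simp add: left_mult_one_mat[OF submat_carrier])
    also have "\<dots> = minv (submat A 0 0 s s) * (submat A 0 0 s s * submat B 0 0 s s)"
      using g by (intro assoc_mult_mat[of _ s s _ s _ s]) auto
    finally show "submat A 0 s s k = (0\<^sub>m s k :: 'a mat) \<and> submat B 0 0 s s = 0\<^sub>m s s"
      using UR AB g by simp
  next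
    assume *: "submat A 0 s s k = (0\<^sub>m s k :: 'a mat) \<and> submat B 0 0 s s = 0\<^sub>m s s"
    then have "submat (A * B) 0 0 s s = 0\<^sub>m s s"
      using submat_mult_upper_left[OF c(1,3)] by (simp add: right_mult_zero_mat[OF submat_carrier])
    then have 1: "(A * B) $$ (i, j) = 0" if "i < s" "j < s" for i j using that by (simp add: submat_eq_0_iff del: index_mult_mat)
    have 2: "A $$ (i, j) = 0" if "i < s" "s \<le> j" "j < ?n" for i j
    proof -
      have "\<forall>i<s. \<forall>j<k. A $$ (0 + i, s + j) = 0" using * unfolding submat_eq_0_iff by blast
      from this[rule_format, of i "j - s"] show ?thesis using that by simp
    qed
    have 3: "minv A $$ (i, j) = 0" if "i < s" "s \<le> j" "j < ?n" for i j
    proof -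
      have "\<forall>i<s. \<forall>j<k. minv A $$ (0 + i, s + j) = 0"
        using GLs_block_triangular(3)[OF A] * unfolding submat_eq_0_iff by blast
      from this[rule_format, of i "j - s"] show ?thesis using that by simp
    qed
    show "L = 0\<^sub>m ?n ?n" unfolding L_eq by (rule eq_matI) (auto simp: 1 2 3 simp del: index_mult_mat)
  qed
  define X Y Z where "X = D * (A * D + A * B * E) + E * (transpose_mat (minv A) * E)"
    and "Y = D * (A * E + A * B * D) + E * (transpose_mat (minv A) * D)"
    and "Z = E * (A * E + A * B * D) + D * (transpose_mat (minv A) * D)"
  have XYZ: "X \<in> carrier_mat ?n ?n" "Y \<in> carrier_mat ?n ?n" "Z \<in> carrier_mat ?n ?n" "L \<in> carrier_mat ?n ?n"
    using c DE by (auto simp: X_def Y_def Z_def L_def)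
  have W: "sigma_mat ?n s * para A B * sigma_mat ?n s = four_block_mat X Y L Z"
    unfolding para_sigma(2)[OF A Bc] X_def Y_def Z_def L_def D_def E_def ..
  have "four_block_mat X Y L Z \<in> parabolic ?n \<longleftrightarrow> L = 0\<^sub>m ?n ?n"
  proof
    assume "four_block_mat X Y L Z \<in> parabolic ?n"
    then obtain A' B' where A': "A' \<in> GLs ?n" "B' \<in> sym_mats ?n 0" "four_block_mat X Y L Z = para A' B'"
      unfolding parabolic_eq by auto
    have "submat (four_block_mat X Y L Z) ?n 0 ?n ?n = L" by (rule submat_four_block(3)) (use XYZ in auto)
    moreover have "submat (para A' B') ?n 0 ?n ?n = 0\<^sub>m ?n ?n"
      unfolding para_def using GLs_carrier[OF A'(1)] minv(1)[OF A'(1)] A'(2)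
      by (subst submat_four_block(3)) (auto simp: sym_mats_0)
    ultimately show "L = 0\<^sub>m ?n ?n" using A'(3) by simp
  next
    assume L: "L = 0\<^sub>m ?n ?n"
    have "para A B \<in> parabolic ?n" unfolding parabolic_eq using A B by auto
    \<comment> \<open>All factors preserve the form, so the blocks \<open>X\<close>,
      \<open>Y\<close>, \<open>Z\<close> never have to be simplified.\<close>
    then have "is_symplectic ?n (sigma_mat ?n s * para A B * sigma_mat ?n s)"
      by (intro is_symplectic_mult is_symplectic_sigma is_symplectic_parabolic)
    then show "four_block_mat X Y L Z \<in> parabolic ?n"
      unfolding W L by (intro parabolic_if_symplectic XYZ)
  qed
  then show ?thesis unfolding W L0 .
qed

text \<open>This is the fibre size in the double coset count. The condition for staying in
  \<open>P\<close> under conjugation separates into one on \<open>A\<close> and one on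
  \<open>B\<close>, so the cardinality is a product.\<close>

lemma card_stabiliser:
  "card {p \<in> parabolic (s + k). sigma_mat (s + k) s * p * sigma_mat (s + k) s \<in> (parabolic (s + k) :: 'a mat set)} =
    card (GLs s :: 'a mat set) * CARD('a) ^ (k * s) * card (GLs k :: 'a mat set) *
    CARD('a) ^ ((s + k) * (s + k + 1) div 2 - s * (s + 1) div 2)"
proof -
  let ?n = "s + k"
  let ?T = "{A \<in> GLs ?n. submat A 0 s s k = 0\<^sub>m s k \<and> submat A 0 0 s s \<in> (GLs s :: 'a mat set)}"
  have "{p \<in> parabolic ?n. sigma_mat ?n s * p * sigma_mat ?n s \<in> (parabolic ?n :: 'a mat set)} = (\<lambda>(A, B). para A B) ` (?T \<times> sym_mats ?n s)"
  proof (intro equalityI subsetI)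
    fix p assume p: "p \<in> {p \<in> parabolic ?n. sigma_mat ?n s * p * sigma_mat ?n s \<in> (parabolic ?n :: 'a mat set)}"
    then obtain A B where *: "A \<in> GLs ?n" "B \<in> sym_mats ?n 0" "p = para A B" unfolding parabolic_eq by auto
    then have **: "submat A 0 s s k = (0\<^sub>m s k :: 'a mat)" "submat B 0 0 s s = 0\<^sub>m s s"
      using p sigma_conj_parabolic_iff[OF *(1,2)] by auto
    then have "A \<in> ?T" using * GLs_block_triangular(1) by blast
    moreover have "B \<in> sym_mats ?n s" using *(2) ** by (simp add: sym_mats_0) (simp add: sym_mats_def)
    ultimately show "p \<in> (\<lambda>(A, B). para A B) ` (?T \<times> sym_mats ?n s)" using *(3) by auto
  next
    fix p assume "p \<in> (\<lambda>(A, B). para A B) ` (?T \<times> (sym_mats ?n s :: 'a mat set))"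
    then obtain A B where *: "A \<in> ?T" "B \<in> sym_mats ?n s" "p = para A B" by auto
    then have **: "A \<in> GLs ?n" "B \<in> sym_mats ?n 0" "submat B 0 0 s s = 0\<^sub>m s s" "submat A 0 s s k = 0\<^sub>m s k"
      by (simp_all add: sym_mats_0) (simp_all add: sym_mats_def)
    then show "p \<in> {p \<in> parabolic ?n. sigma_mat ?n s * p * sigma_mat ?n s \<in> (parabolic ?n :: 'a mat set)}"
      using sigma_conj_parabolic_iff[OF **(1,2)] *(3) parabolic_eq[of ?n] by auto
  qed
  moreover have "inj_on (\<lambda>(A, B). para A B) (?T \<times> (sym_mats ?n s :: 'a mat set))"
    by (rule inj_on_subset[OF para_inj[of ?n s]]) auto
  ultimately have "card {p \<in> parabolic ?n. sigma_mat ?n s * p * sigma_mat ?n s \<in> (parabolic ?n :: 'a mat set)}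
      = card ?T * card (sym_mats ?n s :: 'a mat set)"
    by (simp add: card_image card_cartesian_product)
  then show ?thesis
    using card_GLs_upper_right_zero[OF subset_refl, of s k, where 'a='a] card_sym_mats[of s ?n, where 'a='a] by simp
qed


section \<open>The distribution of the trace on the parabolic times sigma\<close>

definition lin_part :: "nat \<Rightarrow> nat \<Rightarrow> 'a mat \<Rightarrow> 'a mat \<Rightarrow> 'a" where
  "lin_part s n A B = (\<Sum>i<s. \<Sum>j<n. A $$ (i, j) * B $$ (j, i))"

definition const_part :: "nat \<Rightarrow> nat \<Rightarrow> 'a mat \<Rightarrow> 'a" where
  "const_part s k A = mat_trace (submat A s s k k) + mat_trace (submat (minv A) s s k k)"

text \<open>Right multiplication by sigma picks, on the diagonal, the first \<open>s\<close> entries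
  of \<open>A * B\<close> from the upper half, together with the last \<open>k\<close> diagonal
  entries of \<open>A\<close> and of its inverse. Only the first contribution involves
  \<open>B\<close>.\<close>

lemma trace_para_sigma:
  assumes A: "A \<in> GLs (s + k)" and B: "B \<in> carrier_mat (s + k) (s + k)"
  shows "mat_trace (para A B * sigma_mat (s + k) s) = lin_part s (s + k) A B + const_part s k A"
proof -
  let ?n = "s + k"
  note c = GLs_carrier[OF A] minv(1)[OF A] B
  define D E where "D = (proj_mat ?n (\<lambda>i. s \<le> i) :: 'a mat)" and "E = (proj_mat ?n (\<lambda>i. i < s) :: 'a mat)"
  have DE: "D \<in> carrier_mat ?n ?n" "E \<in> carrier_mat ?n ?n" by (auto simp: D_def E_def)
  have sum_split: "(\<Sum>i<s + k. f i) = (\<Sum>i<s. f i) + (\<Sum>i<k. f (s + i))" for f :: "nat \<Rightarrow> 'a"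
    by (induction k) (auto simp: add.assoc)
  have e: "A * D = mat ?n ?n (\<lambda>(i, j). if s \<le> j then A $$ (i, j) else 0)"
    "A * B * E = mat ?n ?n (\<lambda>(i, j). if j < s then (A * B) $$ (i, j) else 0)"
    "transpose_mat (minv A) * D = mat ?n ?n (\<lambda>(i, j). if s \<le> j then transpose_mat (minv A) $$ (i, j) else 0)"
    unfolding E_def D_def by (rule proj_mat_mult_right; use c in simp)+
  have AB: "(A * B) $$ (i, i) = (\<Sum>j<?n. A $$ (i, j) * B $$ (j, i))" if "i < ?n" for i
    using c that by (auto simp: scalar_prod_def atLeast0LessThan intro!: sum.cong)
  have "mat_trace (para A B * sigma_mat ?n s) = mat_trace (A * D + A * B * E) + mat_trace (transpose_mat (minv A) * D)"
    unfolding para_sigma(1)[OF A B] D_def[symmetric] E_def[symmetric]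
    by (rule mat_trace_four_block) (use c DE in auto)
  also have "mat_trace (A * D + A * B * E) = (\<Sum>i<?n. (if s \<le> i then A $$ (i, i) else 0) + (if i < s then (A * B) $$ (i, i) else 0))"
    unfolding e by (simp add: mat_trace_def del: index_mult_mat)
  also have "\<dots> = (\<Sum>i<k. A $$ (s + i, s + i)) + (\<Sum>i<s. (A * B) $$ (i, i))"
    by (simp add: sum_split del: index_mult_mat)
  also have "(\<Sum>i<s. (A * B) $$ (i, i)) = lin_part s ?n A B"
    unfolding lin_part_def by (intro sum.cong refl AB) auto
  also have "(\<Sum>i<k. A $$ (s + i, s + i)) = mat_trace (submat A s s k k)"
    by (simp add: mat_trace_def submat_def)
  also have "mat_trace (transpose_mat (minv A) * D) = (\<Sum>i<?n. if s \<le> i then minv A $$ (i, i) else 0)"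
    unfolding e using c by (simp add: mat_trace_def) (intro sum.cong refl, simp)
  also have "\<dots> = mat_trace (submat (minv A) s s k k)"
    by (simp add: sum_split mat_trace_def submat_def)
  finally show ?thesis by (simp add: const_part_def add_ac)
qed

lemma lin_part_add: 
  assumes "B \<in> carrier_mat n n" "B' \<in> carrier_mat n n" "s \<le> n"
  shows "lin_part s n A (B + c \<cdot>\<^sub>m B') = lin_part s n A B + c * lin_part s n A B'"
proof -
  have "lin_part s n A (B + c \<cdot>\<^sub>m B') = (\<Sum>i<s. \<Sum>j<n. A $$ (i, j) * B $$ (j, i) + c * (A $$ (i, j) * B' $$ (j, i)))"
    unfolding lin_part_def using assms by (intro sum.cong refl) (auto simp: algebra_simps)
  then show ?thesis by (simp add: lin_part_def sum.distrib sum_distrib_left)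
qed

lemma sym_mats_lincomb:
  assumes "B \<in> sym_mats n 0" "B' \<in> sym_mats n 0"
  shows "B + c \<cdot>\<^sub>m B' \<in> (sym_mats n 0 :: 'a mat set)"
proof -
  have *: "B \<in> carrier_mat n n" "B' \<in> carrier_mat n n" "transpose_mat B = B" "transpose_mat B' = B'"
    using assms by (auto simp: sym_mats_0)
  have s: "B $$ (j, i) = B $$ (i, j)" "B' $$ (j, i) = B' $$ (i, j)" if "i < n" "j < n" for i j
    using that * by (metis index_transpose_mat(1) carrier_matD)+
  show ?thesis unfolding sym_mats_0 using * by (auto intro!: eq_matI simp: s)
qed

text \<open>Off the diagonal the terms for \<open>(i, j)\<close> and \<open>(j, i)\<close> are equal
  and cancel in characteristic 2.\<close>

lemma sum_alternating:
  fixes f :: "nat \<Rightarrow> nat \<Rightarrow> 'a"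
  assumes "\<And>i. i < m \<Longrightarrow> f i i = (0::'a)" "\<And>i j. i < m \<Longrightarrow> j < m \<Longrightarrow> f i j = f j i"
  shows "(\<Sum>i<m. \<Sum>j<m. f i j) = 0"
  using assms
proof (induction m)
  case (Suc m)
  have "(\<Sum>i<Suc m. \<Sum>j<Suc m. f i j) = (\<Sum>i<m. \<Sum>j<m. f i j) + ((\<Sum>i<m. f i m) + (\<Sum>j<m. f m j)) + f m m"
    by (simp add: sum.distrib add_ac)
  also have "(\<Sum>j<m. f m j) = (\<Sum>i<m. f i m)" using Suc.prems(2) by (intro sum.cong) auto
  finally show ?case using Suc by (simp add: add_self)
qed simp

text \<open>Exactly the invertible \<open>A\<close> for which \<open>lin_part\<close> vanishes on
  all symmetric \<open>B\<close>; the two directions are \<open>lin_part_alt_type\<close> and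
  \<open>lin_part_nonzero\<close>.\<close>

definition alt_type :: "nat \<Rightarrow> nat \<Rightarrow> 'a mat set" where
  "alt_type s k = {A \<in> GLs (s + k). submat A 0 s s k = 0\<^sub>m s k \<and> submat A 0 0 s s \<in> alt_GLs s}"

lemma alt_GLs_subset: "alt_GLs s \<subseteq> GLs s"
  by (simp add: alt_GLs_def)

lemma card_alt_type: "card (alt_type s k) = card (alt_GLs s) * CARD('a) ^ (k * s) * card (GLs k :: 'a mat set)"
  unfolding alt_type_def by (rule card_GLs_upper_right_zero[OF alt_GLs_subset])

lemma card_alt_type_const_part:
  "card {A \<in> alt_type s k. const_part s k A = \<beta>} = card (alt_GLs s) * CARD('a) ^ (k * s) * trace_count k \<beta>"
proof -
  let ?f = "\<lambda>(A1, A3, A4). four_block_mat A1 (0\<^sub>m s k) A3 A4"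
  let ?K = "{C \<in> GLs k. mat_trace C + mat_trace (minv C) = \<beta>}"
  have cp: "const_part s k (four_block_mat A1 (0\<^sub>m s k) A3 A4) = mat_trace A4 + mat_trace (minv A4)"
    if "A1 \<in> alt_GLs s" "A3 \<in> carrier_mat k s" "A4 \<in> GLs k" for A1 A3 A4
  proof -
    let ?A = "four_block_mat A1 (0\<^sub>m s k) A3 A4"
    have "?A \<in> alt_type s k"
      unfolding alt_type_def GLs_upper_right_zero(1)[OF alt_GLs_subset]
      using that by (intro image_eqI[of _ _ "(A1, A3, A4)"]) auto
    then have A: "?A \<in> GLs (s + k)" "submat ?A 0 s s k = 0\<^sub>m s k" by (auto simp: alt_type_def)
    have "submat ?A s s k k = A4"
    proof (rule submat_four_block(4))
      show "A1 \<in> carrier_mat s s" "A4 \<in> carrier_mat k k" using that by (simp_all add: alt_GLs_def GLs_def)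
    qed (use that in auto)
    then show ?thesis unfolding const_part_def GLs_block_triangular(4)[OF A] by simp
  qed
  have "{A \<in> alt_type s k. const_part s k A = \<beta>} = ?f ` (alt_GLs s \<times> carrier_mat k s \<times> ?K)"
    unfolding alt_type_def GLs_upper_right_zero(1)[OF alt_GLs_subset] 
  proof (intro equalityI subsetI)
    fix A assume "A \<in> {A \<in> ?f ` (alt_GLs s \<times> carrier_mat k s \<times> GLs k). const_part s k A = \<beta>}"
    then obtain A1 A3 A4 where *: "A1 \<in> alt_GLs s" "A3 \<in> carrier_mat k s" "A4 \<in> GLs k"
      "A = four_block_mat A1 (0\<^sub>m s k) A3 A4" "const_part s k A = \<beta>" by auto
    then have "A4 \<in> ?K" using cp[OF *(1-3)] by simp
    then show "A \<in> ?f ` (alt_GLs s \<times> carrier_mat k s \<times> ?K)"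
      using * by (intro image_eqI[of _ _ "(A1, A3, A4)"]) simp_all
  next
    fix A assume "A \<in> ?f ` (alt_GLs s \<times> carrier_mat k s \<times> ?K)"
    then obtain A1 A3 A4 where *: "A1 \<in> alt_GLs s" "A3 \<in> carrier_mat k s" "A4 \<in> ?K"
      "A = four_block_mat A1 (0\<^sub>m s k) A3 A4" by auto
    then have "const_part s k A = \<beta>" using cp[OF *(1,2)] by simp
    then show "A \<in> {A \<in> ?f ` (alt_GLs s \<times> carrier_mat k s \<times> GLs k). const_part s k A = \<beta>}"
      using * by (simp add: image_iff) blast
  qed
  moreover have "inj_on ?f (alt_GLs s \<times> carrier_mat k s \<times> ?K)"
    by (rule inj_on_subset[OF GLs_upper_right_zero(2)[OF alt_GLs_subset, of s k]]) auto
  ultimately show ?thesis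
    by (simp add: card_image card_cartesian_product card_carrier_mat trace_count_def mult.assoc)
qed

lemma lin_part_alt_type:
  assumes "A \<in> alt_type s k" "B \<in> sym_mats (s + k) 0"
  shows "lin_part s (s + k) A B = 0"
proof -
  have B: "B \<in> carrier_mat (s + k) (s + k)" "transpose_mat B = B" using assms(2) by (auto simp: sym_mats_0)
  have symB: "B $$ (j, i) = B $$ (i, j)" if "i < s + k" "j < s + k" for i j
    using that B by (metis index_transpose_mat(1) carrier_matD)
  have A: "submat A 0 s s k = 0\<^sub>m s k" "submat A 0 0 s s \<in> alt_mats s"
    using assms(1) by (auto simp: alt_type_def alt_GLs_def)
  have UR: "A $$ (i, s + j) = 0" if "i < s" "j < k" for i j
    using A(1) that unfolding submat_eq_0_iff by simp
  have alt: "A $$ (i, i) = 0" "A $$ (i, j) = A $$ (j, i)" if "i < s" "j < s" for i j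
    using A(2) that by (auto simp: alt_mats_def submat_def)
  have sum_split: "(\<Sum>i<s + k. f i) = (\<Sum>i<s. f i) + (\<Sum>i<k. f (s + i))" for f :: "nat \<Rightarrow> 'a"
    by (induction k) (auto simp: add.assoc)
  have "lin_part s (s + k) A B = (\<Sum>i<s. \<Sum>j<s. A $$ (i, j) * B $$ (j, i))"
    unfolding lin_part_def sum_split by (intro sum.cong refl) (simp add: UR)
  also have "\<dots> = 0"
  proof (rule sum_alternating)
    fix i j assume "i < s" "j < s"
    then show "A $$ (i, j) * B $$ (j, i) = A $$ (j, i) * B $$ (i, j)" using alt(2) symB by simp
  qed (simp add: alt)
  finally show ?thesis .
qed

text \<open>Evaluating on elementary symmetric matrices recovers from the linear form the diagonal
  entries, the sums \<open>A_ij + A_ji\<close> and the upper right block, hence every condition in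
  \<open>alt_type\<close>. For \<open>i = j\<close> the test matrix has a single entry, and the case
  distinction avoids counting it twice.\<close>

lemma lin_part_unit:
  assumes "i < s" "s \<le> n" "j < n"
  shows "lin_part s n A (mat n n (\<lambda>p. if p = (i, j) \<or> p = (j, i) then 1 else 0)) =
      (if j < s then A $$ (j, i) else 0) + (if i = j then 0 else A $$ (i, j))"
    and "mat n n (\<lambda>p. if p = (i, j) \<or> p = (j, i) then 1 else 0) \<in> (sym_mats n 0 :: 'a mat set)"
proof -
  let ?B = "mat n n (\<lambda>p. if p = (i, j) \<or> p = (j, i) then 1 else 0)"
  have "lin_part s n A ?B = (\<Sum>a<s. \<Sum>b<n. (if b = i then (if a = j then A $$ (j, i) else 0) else 0)
      + (if b = j then (if a = i \<and> i \<noteq> j then A $$ (i, j) else 0) else 0))"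
    unfolding lin_part_def using assms by (intro sum.cong refl) auto
  also have "\<dots> = (\<Sum>a<s. (if a = j then A $$ (j, i) else 0) + (if a = i then (if i = j then 0 else A $$ (i, j)) else 0))"
    using assms by (intro sum.cong refl) (auto simp: sum.distrib)
  also have "\<dots> = (if j < s then A $$ (j, i) else 0) + (if i = j then 0 else A $$ (i, j))"
    using assms by (simp add: sum.distrib)
  finally show "lin_part s n A ?B = (if j < s then A $$ (j, i) else 0) + (if i = j then 0 else A $$ (i, j))" .
  show "?B \<in> sym_mats n 0" by (auto simp: sym_mats_0 intro!: eq_matI)
qed

lemma lin_part_nonzero:
  assumes A: "A \<in> GLs (s + k)" "A \<notin> alt_type s k"
  shows "\<exists>B\<in>sym_mats (s + k) 0. lin_part s (s + k) A B \<noteq> 0"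
proof (rule ccontr)
  assume "\<not> ?thesis"
  then have z: "(if j < s then A $$ (j, i) else 0) + (if i = j then 0 else A $$ (i, j)) = 0" if "i < s" "j < s + k" for i j
    using lin_part_unit(1)[of i s "s + k" j A] lin_part_unit(2)[of i s "s + k" j] that by auto
  have "submat A 0 s s k = 0\<^sub>m s k"
    unfolding submat_eq_0_iff
  proof (intro allI impI)
    fix i j assume "i < s" "j < k"
    then show "A $$ (0 + i, s + j) = 0" using z[of i "s + j"] by simp
  qed
  moreover have "submat A 0 0 s s \<in> alt_mats s"
  proof -
    have "A $$ (i, i) = 0" if "i < s" for i using z[of i i] that by simp
    moreover have "A $$ (i, j) = A $$ (j, i)" if "i < s" "j < s" for i j
      using z[of i j] that by (cases "i = j") (auto simp: add_eq_0_iff2)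
    ultimately show ?thesis by (auto simp: alt_mats_def submat_def)
  qed
  ultimately have "A \<in> alt_type s k"
    using A(1) GLs_block_triangular(1)[OF A(1)] by (auto simp: alt_type_def alt_GLs_def)
  then show False using A(2) by simp
qed

text \<open>A linear form that is nonzero at some \<open>B0\<close> has all fibres of the same size,
  because translation by multiples of \<open>B0\<close> permutes them.\<close>

lemma lin_part_equidistributed:
  assumes A: "A \<in> GLs (s + k)" "A \<notin> alt_type s k"
  shows "CARD('a) * card {B \<in> sym_mats (s + k) 0. lin_part s (s + k) A B = \<gamma>} = card (sym_mats (s + k) 0 :: 'a mat set)"
proof -
  let ?n = "s + k"
  let ?L = "lin_part s ?n A"
  let ?S = "sym_mats ?n 0 :: 'a mat set"
  have fin: "finite ?S" by (rule finite_subset[OF _ finite_carrier_mat[of ?n ?n]]) (auto simp: sym_mats_def)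
  obtain B0 where B0: "B0 \<in> ?S" "?L B0 \<noteq> 0" using lin_part_nonzero[OF A] by blast
  have Bc: "B \<in> carrier_mat ?n ?n" if "B \<in> ?S" for B using that by (simp add: sym_mats_def)
  have L: "?L (B + c \<cdot>\<^sub>m B0) = ?L B + c * ?L B0" if "B \<in> ?S" for B c
    by (rule lin_part_add) (use Bc[OF that] Bc[OF B0(1)] in auto)
  have same: "card {B \<in> ?S. ?L B = \<delta>} = card {B \<in> ?S. ?L B = \<gamma>}" for \<delta>
  proof -
    \<comment> \<open>The translation by \<open>c\<close> times \<open>B0\<close> shifts the value
      by \<open>\<gamma> + \<delta>\<close> and so exchanges the two fibres; in characteristic 2 it
      is its own inverse.\<close>
    define c where "c = (\<gamma> + \<delta>) / ?L B0"
    have c: "c * ?L B0 = \<gamma> + \<delta>" using B0(2) by (simp add: c_def)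
    have twice: "B + c \<cdot>\<^sub>m B0 + c \<cdot>\<^sub>m B0 = B" if "B \<in> ?S" for B
    proof -
      have "B + c \<cdot>\<^sub>m B0 + c \<cdot>\<^sub>m B0 = B + (c \<cdot>\<^sub>m B0 + c \<cdot>\<^sub>m B0)"
        using Bc[OF that] Bc[OF B0(1)] by (intro assoc_add_mat[of _ ?n ?n]) auto
      also have "c \<cdot>\<^sub>m B0 + c \<cdot>\<^sub>m B0 = 0\<^sub>m ?n ?n" using Bc[OF B0(1)] by (intro mat_add_self) auto
      finally show ?thesis using Bc[OF that] by simp
    qed
    have "bij_betw (\<lambda>B. B + c \<cdot>\<^sub>m B0) {B \<in> ?S. ?L B = \<delta>} {B \<in> ?S. ?L B = \<gamma>}"
    proof (rule bij_betw_byWitness[of _ "\<lambda>B. B + c \<cdot>\<^sub>m B0"])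
      have 1: "\<delta> + (\<gamma> + \<delta>) = \<gamma>" by (metis add.commute add_left_self)
      have 2: "\<gamma> + (\<gamma> + \<delta>) = \<delta>" by (rule add_left_self)
      show "(\<lambda>B. B + c \<cdot>\<^sub>m B0) ` {B \<in> ?S. ?L B = \<delta>} \<subseteq> {B \<in> ?S. ?L B = \<gamma>}"
      proof (rule image_subsetI)
        fix B assume "B \<in> {B \<in> ?S. ?L B = \<delta>}"
        then have B: "B \<in> ?S" "?L B = \<delta>" by auto
        show "B + c \<cdot>\<^sub>m B0 \<in> {B \<in> ?S. ?L B = \<gamma>}"
          using L[OF B(1), of c] sym_mats_lincomb[OF B(1) B0(1), of c] unfolding B(2) c 1 by blast
      qed
      show "(\<lambda>B. B + c \<cdot>\<^sub>m B0) ` {B \<in> ?S. ?L B = \<gamma>} \<subseteq> {B \<in> ?S. ?L B = \<delta>}"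
      proof (rule image_subsetI)
        fix B assume "B \<in> {B \<in> ?S. ?L B = \<gamma>}"
        then have B: "B \<in> ?S" "?L B = \<gamma>" by auto
        show "B + c \<cdot>\<^sub>m B0 \<in> {B \<in> ?S. ?L B = \<delta>}"
          using L[OF B(1), of c] sym_mats_lincomb[OF B(1) B0(1), of c] unfolding B(2) c 2 by blast
      qed
    qed (use twice in auto)
    then show ?thesis by (rule bij_betw_same_card)
  qed
  have "card ?S = card (\<Union>\<delta>\<in>UNIV. {B \<in> ?S. ?L B = \<delta>})" by (rule arg_cong[of _ _ card]) auto
  also have "\<dots> = (\<Sum>\<delta>\<in>UNIV. card {B \<in> ?S. ?L B = \<delta>})"
    by (rule card_UN_disjoint) (auto intro: finite_subset[OF _ fin])
  also have "\<dots> = (\<Sum>\<delta>\<in>(UNIV :: 'a set). card {B \<in> ?S. ?L B = \<gamma>})" by (rule sum.cong[OF refl], rule same)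
  also have "\<dots> = CARD('a) * card {B \<in> ?S. ?L B = \<gamma>}" by simp
  finally show ?thesis by simp
qed

text \<open>The factor \<open>CARD('a)\<close> allows equidistribution to be used over the integers.
  Each \<open>A\<close> outside \<open>alt_type\<close> then contributes the number of symmetric
  matrices; an \<open>A\<close> inside contributes \<open>CARD('a)\<close> times that number or
  nothing, according to its constant part.\<close>

lemma card_para_trace:
  "int CARD('a) * int (card {p \<in> parabolic (s + k). mat_trace (p * sigma_mat (s + k) s) = (\<beta>::'a)}) =
    int (card (sym_mats (s + k) 0 :: 'a mat set)) *
      (int (card (GLs (s + k) :: 'a mat set)) - int (card (alt_type s k))
        + int CARD('a) * int (card {A \<in> alt_type s k. const_part s k A = \<beta>}))"
proof -
  let ?n = "s + k"
  let ?S = "sym_mats ?n 0 :: 'a mat set"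
  let ?G = "GLs ?n :: 'a mat set"
  let ?Y = "alt_type s k"
  let ?N = "\<lambda>A. {B \<in> ?S. lin_part s ?n A B = \<beta> + const_part s k A}"
  have finS: "finite ?S" by (rule finite_subset[OF _ finite_carrier_mat[of ?n ?n]]) (auto simp: sym_mats_def)
  have Y: "?Y \<subseteq> ?G" by (auto simp: alt_type_def)
  have finY: "finite ?Y" using Y finite_GLs finite_subset by blast
  have "{p \<in> parabolic ?n. mat_trace (p * sigma_mat ?n s) = \<beta>} = (\<lambda>(A, B). para A B) ` (SIGMA A:?G. ?N A)"
  proof -
    have "mat_trace (para A B * sigma_mat ?n s) = \<beta> \<longleftrightarrow> lin_part s ?n A B = \<beta> + const_part s k A"
      if "A \<in> ?G" "B \<in> ?S" for A B
    proof -
      have "mat_trace (para A B * sigma_mat ?n s) = lin_part s ?n A B + const_part s k A"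
        using that by (intro trace_para_sigma) (auto simp: sym_mats_def)
      moreover have "x + y = \<beta> \<longleftrightarrow> x = \<beta> + y" for x y :: 'a
        by (metis add.commute add_left_self)
      ultimately show ?thesis by simp
    qed
    then show ?thesis unfolding parabolic_eq by auto
  qed
  moreover have "inj_on (\<lambda>(A, B). para A B) (SIGMA A:?G. ?N A)"
    by (rule inj_on_subset[OF para_inj[of ?n 0]]) auto
  ultimately have "card {p \<in> parabolic ?n. mat_trace (p * sigma_mat ?n s) = \<beta>} = (\<Sum>A\<in>?G. card (?N A))"
    using finS by (simp add: card_image)
  then have "int CARD('a) * int (card {p \<in> parabolic ?n. mat_trace (p * sigma_mat ?n s) = \<beta>})
     = (\<Sum>A\<in>?G. int CARD('a) * int (card (?N A)))" by (simp add: sum_distrib_left)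
  also have "\<dots> = (\<Sum>A\<in>?G - ?Y. int CARD('a) * int (card (?N A))) + (\<Sum>A\<in>?Y. int CARD('a) * int (card (?N A)))"
    by (rule sum.subset_diff[OF Y finite_GLs])
  also have "(\<Sum>A\<in>?G - ?Y. int CARD('a) * int (card (?N A))) = (\<Sum>A\<in>?G - ?Y. int (card ?S))"
  proof (rule sum.cong[OF refl])
    fix A assume "A \<in> ?G - ?Y"
    then have "CARD('a) * card (?N A) = card ?S" by (intro lin_part_equidistributed) auto
    then have "int (CARD('a) * card (?N A)) = int (card ?S)" by (simp only:)
    then show "int CARD('a) * int (card (?N A)) = int (card ?S)" by (simp only: of_nat_mult)
  qed
  also have "\<dots> = int (card ?S) * (int (card ?G) - int (card ?Y))"
    using Y finY by (simp add: card_Diff_subset card_mono of_nat_diff)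
  also have "(\<Sum>A\<in>?Y. int CARD('a) * int (card (?N A))) = (\<Sum>A\<in>?Y. if const_part s k A = \<beta> then int CARD('a) * int (card ?S) else 0)"
  proof (rule sum.cong[OF refl])
    fix A assume A: "A \<in> ?Y"
    have "?N A = (if const_part s k A = \<beta> then ?S else {})"
      using lin_part_alt_type[OF A] add_eq_0_iff2[of \<beta> "const_part s k A"] by auto
    then show "int CARD('a) * int (card (?N A)) = (if const_part s k A = \<beta> then int CARD('a) * int (card ?S) else 0)"
      by simp
  qed
  also have "\<dots> = int (card {A \<in> ?Y. const_part s k A = \<beta>}) * (int CARD('a) * int (card ?S))"
    using finY by (simp add: sum.If_cases Int_def)
  finally show ?thesis by (simp add: algebra_simps)
qed

text \<open>The group count is applied with the trace as cyclic function and all cardinalities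
  inserted. Factors are left on the side where they arise, so that no division occurs before the
  passage to real numbers.\<close>

lemma double_coset_trace_count:
  "int CARD('a) * (int (card {w \<in> double_coset (s + k) s. mat_trace w = (\<beta>::'a)}) *
      (int (card (GLs s :: 'a mat set)) * int CARD('a) ^ (k * s) * int (card (GLs k :: 'a mat set)) *
       int CARD('a) ^ ((s + k) * (s + k + 1) div 2 - s * (s + 1) div 2))) =
   int (card (GLs (s + k) :: 'a mat set)) * (int CARD('a) ^ ((s + k) * (s + k + 1) div 2))\<^sup>2 *
     (int (card (GLs (s + k) :: 'a mat set)) +
        int (card (alt_GLs s)) * int CARD('a) ^ (k * s) * (int CARD('a) * int (trace_count k \<beta>) - int (card (GLs k :: 'a mat set))))"
proof -
  let ?n = "s + k"
  let ?P = "parabolic ?n :: 'a mat set"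
  interpret G: group "GL_group (?n + ?n) :: 'a mat monoid" by (rule group_GL_group)
  have P_eq: "?P = (\<lambda>(A, B). para A B) ` (GLs ?n \<times> (sym_mats ?n 0 :: 'a mat set))" by (rule parabolic_eq)
  have cardS: "card (sym_mats ?n 0 :: 'a mat set) = CARD('a) ^ (?n * (?n + 1) div 2)"
    using card_sym_mats[of 0 ?n, where 'a='a] by simp
  have cardP: "card ?P = card (GLs ?n :: 'a mat set) * CARD('a) ^ (?n * (?n + 1) div 2)"
    unfolding P_eq by (simp add: card_image[OF para_inj] card_cartesian_product cardS)
  have sigma: "sigma_mat ?n s \<in> (GLs (?n + ?n) :: 'a mat set)"
    by (rule GLs_I[OF sigma_carrier sigma_carrier sigma_square])
  have finP: "finite ?P"
    by (rule finite_subset[OF subgroup.subset[OF subgroup_parabolic]]) (simp add: GL_group_def)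
  have sigma_G: "sigma_mat ?n s \<in> carrier (GL_group (?n + ?n) :: 'a mat monoid)" using sigma by (simp add: GL_group_def)
  have sigma_sq: "sigma_mat ?n s \<otimes>\<^bsub>GL_group (?n + ?n)\<^esub> sigma_mat ?n s = \<one>\<^bsub>(GL_group (?n + ?n) :: 'a mat monoid)\<^esub>"
    using sigma_square[of s k] by (simp add: GL_group_def)
  have trace: "mat_trace (x \<otimes>\<^bsub>GL_group (?n + ?n)\<^esub> y) = mat_trace (y \<otimes>\<^bsub>GL_group (?n + ?n)\<^esub> x)"
    if "x \<in> carrier (GL_group (?n + ?n))" "y \<in> carrier (GL_group (?n + ?n))" for x y :: "'a mat"
    using that mat_trace_commute[of x "?n + ?n" "?n + ?n" y] GLs_carrier[of x] GLs_carrier[of y] by (simp add: GL_group_def)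
  note G.double_coset_count[where P = ?P and s = "sigma_mat ?n s" and T = mat_trace and b = \<beta>,
      OF subgroup_parabolic finP sigma_G sigma_sq trace]
  moreover have "{w. (\<exists>p\<in>?P. \<exists>p'\<in>?P. w = p * sigma_mat ?n s * p') \<and> mat_trace w = \<beta>} = {w \<in> double_coset ?n s. mat_trace w = \<beta>}"
    unfolding double_coset_def by blast
  ultimately have "card {w \<in> double_coset ?n s. mat_trace w = \<beta>} *
      card {x \<in> ?P. sigma_mat ?n s * x * sigma_mat ?n s \<in> ?P} = card ?P * card {p \<in> ?P. mat_trace (p * sigma_mat ?n s) = \<beta>}"
    by (simp add: GL_group_def)
  then have "int (card {w \<in> double_coset ?n s. mat_trace w = \<beta>}) *
      int (card {x \<in> ?P. sigma_mat ?n s * x * sigma_mat ?n s \<in> ?P}) = int (card ?P) * int (card {p \<in> ?P. mat_trace (p * sigma_mat ?n s) = \<beta>})"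
    by (simp only: of_nat_mult[symmetric])
  then have "int CARD('a) * (int (card {w \<in> double_coset ?n s. mat_trace w = \<beta>}) *
      int (card {x \<in> ?P. sigma_mat ?n s * x * sigma_mat ?n s \<in> ?P})) = int (card ?P) * (int CARD('a) * int (card {p \<in> ?P. mat_trace (p * sigma_mat ?n s) = \<beta>}))"
    by (simp add: mult_ac)
  then show ?thesis
    unfolding card_stabiliser card_para_trace card_alt_type card_alt_type_const_part cardP cardS
    by (simp add: algebra_simps power2_eq_square)
qed

end

section \<open>The weight distributions of the codes\<close>

context char2_field
begin

section \<open>Closed forms of the group orders and of the trace distributions\<close>

lemma card_ge_2: "CARD('a) \<ge> 2"
proof -
  have "card {0, 1::'a} \<le> CARD('a)" by (intro card_mono) auto
  then show ?thesis by simp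
qed

lemma real_card_GLs_Suc:
  "real (card (GLs (Suc n) :: 'a mat set)) = (real CARD('a) ^ Suc n - 1) * real CARD('a) ^ n * real (card (GLs n :: 'a mat set))"
  using card_GLs_Suc[of n, where 'a='a] by (simp add: of_nat_diff)

text \<open>The factor \<open>q ^ m\<close> completes the exponent of \<open>q\<close> to a perfect
  square. Odd and even factors are kept apart because the odd ones are those of the alternating
  count; the even ones survive in the quotient and form the product in \<open>B\<close>.\<close>

lemma real_card_GLs_even:
  "real (card (GLs (2 * m) :: 'a mat set)) * real CARD('a) ^ m = (real CARD('a) ^ (m * m))\<^sup>2
     * (\<Prod>j = 1..m. real CARD('a) ^ (2 * j - 1) - 1) * (\<Prod>j = 1..m. real CARD('a) ^ (2 * j) - 1)"
proof (induction m)
  case (Suc m)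
  define q where "q = real CARD('a)"
  let ?o = "\<Prod>j = 1..m. q ^ (2 * j - 1) - 1" and ?e = "\<Prod>j = 1..m. q ^ (2 * j) - 1"
  have "real (card (GLs (2 * Suc m) :: 'a mat set)) * q ^ Suc m =
      (q ^ (2 * m + 2) - 1) * (q ^ (2 * m + 1) - 1) * q ^ (2 * m + 1) * q ^ (2 * m) * q * (real (card (GLs (2 * m) :: 'a mat set)) * q ^ m)"
    using real_card_GLs_Suc[of "Suc (2 * m)"] real_card_GLs_Suc[of "2 * m"] by (simp add: q_def)
  also have "real (card (GLs (2 * m) :: 'a mat set)) * q ^ m = (q ^ (m * m))\<^sup>2 * ?o * ?e" using Suc.IH by (simp add: q_def)
  also have "(q ^ (2 * m + 2) - 1) * (q ^ (2 * m + 1) - 1) * q ^ (2 * m + 1) * q ^ (2 * m) * q * ((q ^ (m * m))\<^sup>2 * ?o * ?e)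
      = (q ^ (Suc m * Suc m))\<^sup>2 * (?o * (q ^ (2 * m + 1) - 1)) * (?e * (q ^ (2 * m + 2) - 1))"
  proof -
    have "(q ^ (Suc m * Suc m))\<^sup>2 = q ^ (2 * m + 1) * q ^ (2 * m) * q * (q ^ (m * m))\<^sup>2"
      unfolding power_mult[symmetric] power_add[symmetric] power_Suc2[symmetric]
      by (rule arg_cong[of _ _ "\<lambda>i. q ^ i"]) simp
    then show ?thesis by (simp only: mult_ac)
  qed
  finally show ?case by (simp add: q_def prod.nat_ivl_Suc')
qed (simp add: card_GLs_0)

lemma real_card_alt_GLs_even:
  "real (card (alt_GLs (2 * m))) * real CARD('a) ^ m = real CARD('a) ^ (m * m)
     * (\<Prod>j = 1..m. real CARD('a) ^ (2 * j - 1) - 1)"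
proof (induction m)
  case (Suc m)
  define q where "q = real CARD('a)"
  let ?o = "\<Prod>j = 1..m. q ^ (2 * j - 1) - 1"
  have "real (card (alt_GLs (2 * Suc m))) * q ^ Suc m = (q ^ (2 * m + 1) - 1) * q ^ (2 * m) * q * (real (card (alt_GLs (2 * m))) * q ^ m)"
    using card_alt_GLs_Suc_Suc[of "2 * m"] by (simp add: q_def of_nat_diff)
  also have "real (card (alt_GLs (2 * m))) * q ^ m = q ^ (m * m) * ?o" using Suc.IH by (simp add: q_def)
  also have "(q ^ (2 * m + 1) - 1) * q ^ (2 * m) * q * (q ^ (m * m) * ?o) = q ^ (Suc m * Suc m) * (?o * (q ^ (2 * m + 1) - 1))"
  proof -
    have "q ^ (Suc m * Suc m) = q ^ (2 * m) * q * q ^ (m * m)"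
      unfolding power_add[symmetric] power_Suc2[symmetric] by (rule arg_cong[of _ _ "\<lambda>i. q ^ i"]) simp
    then show ?thesis by (simp only: mult_ac)
  qed
  finally show ?case by (simp add: q_def prod.nat_ivl_Suc')
qed (simp add: card_alt_GLs_0)

definition lam0 :: "'a \<Rightarrow> real" where
  "lam0 \<beta> = (if \<beta> = 0 then 0 else real_of_int (lam (inverse \<beta>)))"

text \<open>The value at 0 is not a Kloosterman sum: \<open>q^2\<close> is what makes the formula of
  \<open>trace_count_2\<close> uniform in \<beta>.\<close>

definition Kloost0 :: "'a \<Rightarrow> real" where
  "Kloost0 \<beta> = (if \<beta> = 0 then real CARD('a) ^ 2 else real_of_int (Kloost r (inverse \<beta>)))"

text \<open>Origin of the constants: \<open>Gn\<close> is the order of \<open>GL(n)\<close>,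
  \<open>P\<close> the number of symmetric matrices, \<open>H\<close> the stabiliser order and
  \<open>u\<close> the weight of the alternating type. Then \<open>B\<close> is
  \<open>Gn / u\<close>, \<open>A\<close> is \<open>Gn * P^2 * u / H\<close>, and \<open>x\<close>
  is the part that depends on \<beta>.\<close>

lemma solve_count:
  fixes N H A B x Gn P q u :: real
  assumes "q * (N * H) = Gn * P\<^sup>2 * (Gn + u * x)" "Gn = u * B" "Gn * P\<^sup>2 * u = A * H" "H \<noteq> 0" "q \<noteq> 0"
  shows "N = A / q * (B + x)"
proof -
  have "q * (N * H) = Gn * P\<^sup>2 * u * (B + x)" using assms(1,2) by (simp add: distrib_left mult.assoc)
  also have "\<dots> = (A * (B + x)) * H" using assms(3) by (simp add: mult_ac)
  finally have "q * N = A * (B + x)" using assms(4) by (simp add: mult.assoc[symmetric])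
  then show ?thesis using assms(5) by (simp add: field_simps)
qed

lemma card_DC_minus_trace:
  assumes "odd n"
  shows "real (card {w \<in> DC_minus n. mat_trace w = (\<beta>::'a)}) =
    A_minus n CARD('a) / real CARD('a) * (B_minus n CARD('a) + (1 + real CARD('a) * lam0 \<beta>))"
proof -
  obtain m where n: "n = 2 * m + 1" using assms by (auto elim: oddE)
  define q where "q = real CARD('a)"
  have q: "q \<ge> 2" using card_ge_2 by (simp add: q_def)
  define Po Pe where "Po = (\<Prod>j = 1..m. q ^ (2 * j - 1) - 1)" and "Pe = (\<Prod>j = 1..m. q ^ (2 * j) - 1)"
  define Gs a where "Gs = real (card (GLs (2 * m) :: 'a mat set))" and "a = real (card (alt_GLs (2 * m)))"
  have Gs: "Gs * q ^ m = (q ^ (m * m))\<^sup>2 * Po * Pe" using real_card_GLs_even[of m] by (simp add: Gs_def q_def Po_def Pe_def)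
  have a: "a * q ^ m = q ^ (m * m) * Po" using real_card_alt_GLs_even[of m] by (simp add: a_def q_def Po_def)
  have pos: "q ^ i - 1 > 0" if "i > 0" for i using q that by (simp add: one_less_power)
  have "Po > 0" "Pe > 0" unfolding Po_def Pe_def by (auto intro!: prod_pos pos)
  then have "Gs \<noteq> 0" using Gs q by (metis less_numeral_extra(3) mult_eq_0_iff mult_zero_left not_numeral_le_zero power_not_zero zero_eq_power2)
  define Gn where "Gn = (q ^ (2 * m + 1) - 1) * q ^ (2 * m) * Gs"
  have Gn: "real (card (GLs n :: 'a mat set)) = Gn" using real_card_GLs_Suc[of "2 * m"] by (simp add: n Gn_def q_def Gs_def)
  have G1: "real (card (GLs 1 :: 'a mat set)) = q - 1" using real_card_GLs_Suc[of 0] card_GLs_0[where 'a='a] by (simp add: q_def)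
  have e2: "n * (n + 1) div 2 = (2 * m + 1) * (m + 1)" by (simp add: n)
  have e1: "n * (n + 1) div 2 - 2 * m * (2 * m + 1) div 2 = 2 * m + 1" by (simp add: n algebra_simps)
  let ?N = "real (card {w \<in> DC_minus n. mat_trace w = \<beta>})"
  let ?H = "Gs * q ^ (2 * m) * (q - 1) * q ^ (2 * m + 1)"
  have "real_of_int (int CARD('a) * (int (card {w \<in> double_coset (2 * m + 1) (2 * m). mat_trace w = \<beta>}) *
      (int (card (GLs (2 * m) :: 'a mat set)) * int CARD('a) ^ (1 * (2 * m)) * int (card (GLs 1 :: 'a mat set)) *
       int CARD('a) ^ ((2 * m + 1) * (2 * m + 1 + 1) div 2 - 2 * m * (2 * m + 1) div 2)))) =
    real_of_int (int (card (GLs (2 * m + 1) :: 'a mat set)) * (int CARD('a) ^ ((2 * m + 1) * (2 * m + 1 + 1) div 2))\<^sup>2 *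
     (int (card (GLs (2 * m + 1) :: 'a mat set)) +
        int (card (alt_GLs (2 * m))) * int CARD('a) ^ (1 * (2 * m)) * (int CARD('a) * int (trace_count 1 \<beta>) - int (card (GLs 1 :: 'a mat set)))))"
    by (simp only: double_coset_trace_count)
  then have "q * (?N * (real (card (GLs (2 * m) :: 'a mat set)) * q ^ (1 * (2 * m)) * real (card (GLs 1 :: 'a mat set)) * q ^ (n * (n + 1) div 2 - 2 * m * (2 * m + 1) div 2)))
    = real (card (GLs n :: 'a mat set)) * (q ^ (n * (n + 1) div 2))\<^sup>2 * (real (card (GLs n :: 'a mat set)) + real (card (alt_GLs (2 * m))) * q ^ (1 * (2 * m)) * (q * real_of_int (int (trace_count 1 \<beta>)) - real (card (GLs 1 :: 'a mat set))))"
    unfolding DC_minus_def n q_def by (simp only: of_int_mult of_int_add of_int_diff of_int_power of_int_of_nat_eq add_diff_cancel_right')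
  then have eq: "q * (?N * ?H) = Gn * (q ^ ((2 * m + 1) * (m + 1)))\<^sup>2 * (Gn + a * q ^ (2 * m) * (q * real_of_int (int (trace_count 1 \<beta>)) - (q - 1)))"
    unfolding e1 unfolding e2 Gn G1 Gs_def[symmetric] a_def[symmetric] mult_1 .
  have "q * real_of_int (int (trace_count 1 \<beta>)) - (q - 1) = 1 + q * lam0 \<beta>"
    unfolding trace_count_1 by (simp add: lam0_def algebra_simps)
  with eq have eq: "q * (?N * ?H) = Gn * (q ^ ((2 * m + 1) * (m + 1)))\<^sup>2 * (Gn + a * q ^ (2 * m) * (1 + q * lam0 \<beta>))" by simp
  have A: "A_minus n CARD('a) = q ^ (5 * (m * m) + 5 * m + 1) * ((q ^ (2 * m + 1) - 1) / (q - 1)) * Po"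
  proof -
    have "(5 * n\<^sup>2 - 1) div 4 = 5 * (m * m) + 5 * m + 1" by (simp add: n power2_eq_square algebra_simps)
    moreover have "(n - 1) div 2 = m" by (simp add: n)
    ultimately show ?thesis by (simp add: A_minus_def gauss_binom_def q_def Po_def n)
  qed
  have B: "B_minus n CARD('a) = q ^ (m * m) * (q ^ (2 * m + 1) - 1) * Pe"
  proof -
    have "(n - 1)\<^sup>2 div 4 = m * m" by (simp add: n power2_eq_square algebra_simps)
    moreover have "(n - 1) div 2 = m" by (simp add: n)
    ultimately show ?thesis by (simp add: B_minus_def q_def Pe_def n)
  qed
  have qm: "q ^ m \<noteq> 0" using q by simp
  \<comment> \<open>Proved after multiplication by \<open>q ^ m\<close>, the shape in which
    \<open>Gs\<close> and \<open>a\<close> have closed forms. The odd product \<open>Po\<close> is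
    absorbed in \<open>a\<close>, so that \<open>B_minus\<close> carries only
    \<open>Pe\<close>.\<close>
  have BG: "Gn = a * q ^ (2 * m) * B_minus n CARD('a)"
  proof -
    have "Gn * q ^ m = (q ^ (2 * m + 1) - 1) * q ^ (2 * m) * (Gs * q ^ m)" by (simp add: Gn_def)
    also have "\<dots> = (a * q ^ m) * q ^ (2 * m) * B_minus n CARD('a)"
      unfolding Gs a B by (simp only: power2_eq_square mult_ac)
    also have "\<dots> = (a * q ^ (2 * m) * B_minus n CARD('a)) * q ^ m" by (simp only: mult_ac)
    finally show ?thesis by (rule mult_right_cancel[OF qm, THEN iffD1])
  qed
  have AG: "Gn * (q ^ ((2 * m + 1) * (m + 1)))\<^sup>2 * (a * q ^ (2 * m)) = A_minus n CARD('a) * ?H"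
  proof -
    have exps: "q ^ (2 * m) * (q ^ ((2 * m + 1) * (m + 1)))\<^sup>2 * q ^ (m * m) * q ^ (2 * m)
        = q ^ (5 * (m * m) + 5 * m + 1) * q ^ (2 * m) * q ^ (2 * m + 1) * q ^ m"
      unfolding power_mult[symmetric] power_add[symmetric]
      by (rule arg_cong[of _ _ "\<lambda>i. q ^ i"]) (simp add: algebra_simps)
    have q1: "(q ^ (2 * m + 1) - 1) / (q - 1) * (q - 1) = q ^ (2 * m + 1) - 1" using q by simp
    have "Gn * (q ^ ((2 * m + 1) * (m + 1)))\<^sup>2 * (a * q ^ (2 * m)) * q ^ m
      = (q ^ (2 * m + 1) - 1) * q ^ (2 * m) * Gs * (q ^ ((2 * m + 1) * (m + 1)))\<^sup>2 * (a * q ^ m) * q ^ (2 * m)"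
      unfolding Gn_def by (simp only: mult_ac)
    also have "\<dots> = (q ^ (2 * m + 1) - 1) * Gs * Po * (q ^ (2 * m) * (q ^ ((2 * m + 1) * (m + 1)))\<^sup>2 * q ^ (m * m) * q ^ (2 * m))"
      unfolding a by (simp only: mult_ac)
    also have "\<dots> = ((q ^ (2 * m + 1) - 1) / (q - 1) * (q - 1)) * Gs * Po * (q ^ (5 * (m * m) + 5 * m + 1) * q ^ (2 * m) * q ^ (2 * m + 1) * q ^ m)"
      unfolding exps q1 ..
    also have "\<dots> = A_minus n CARD('a) * ?H * q ^ m" unfolding A by (simp only: mult_ac)
    finally show ?thesis by (rule mult_right_cancel[OF qm, THEN iffD1])
  qed
  show ?thesis
    using solve_count[OF eq BG AG] q \<open>Gs \<noteq> 0\<close> by (simp add: q_def)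
qed

lemma card_DC_plus_trace:
  assumes "even n" "n \<ge> 2"
  shows "real (card {w \<in> DC_plus n. mat_trace w = (\<beta>::'a)}) =
    A_plus n CARD('a) / real CARD('a) * (B_plus n CARD('a) + (real CARD('a) * Kloost0 \<beta> - real CARD('a) ^ 2 - 1))"
proof -
  obtain l where "n = 2 * l" using assms by (auto elim: evenE)
  moreover obtain m where "l = m + 1" using calculation assms by (metis Suc_eq_plus1 mult_0_right not0_implies_Suc not_numeral_le_zero)
  ultimately have n: "n = 2 * m + 2" by simp
  define q where "q = real CARD('a)"
  have q: "q \<ge> 2" using card_ge_2 by (simp add: q_def)
  define Po Pe where "Po = (\<Prod>j = 1..m. q ^ (2 * j - 1) - 1)" and "Pe = (\<Prod>j = 1..m. q ^ (2 * j) - 1)"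
  define Gs a where "Gs = real (card (GLs (2 * m) :: 'a mat set))" and "a = real (card (alt_GLs (2 * m)))"
  have Gs: "Gs * q ^ m = (q ^ (m * m))\<^sup>2 * Po * Pe" using real_card_GLs_even[of m] by (simp add: Gs_def q_def Po_def Pe_def)
  have a: "a * q ^ m = q ^ (m * m) * Po" using real_card_alt_GLs_even[of m] by (simp add: a_def q_def Po_def)
  have pos: "q ^ i - 1 > 0" if "i > 0" for i using q that by (simp add: one_less_power)
  have "Po > 0" "Pe > 0" unfolding Po_def Pe_def by (auto intro!: prod_pos pos)
  then have "Gs \<noteq> 0" using Gs q by (metis less_numeral_extra(3) mult_eq_0_iff mult_zero_left not_numeral_le_zero power_not_zero zero_eq_power2)
  define Gn where "Gn = (q ^ (2 * m + 2) - 1) * q ^ (2 * m + 1) * ((q ^ (2 * m + 1) - 1) * q ^ (2 * m) * Gs)"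
  have Gn: "real (card (GLs n :: 'a mat set)) = Gn"
    using real_card_GLs_Suc[of "2 * m"] real_card_GLs_Suc[of "Suc (2 * m)"] by (simp add: n Gn_def q_def Gs_def)
  define Gk where "Gk = (q\<^sup>2 - 1) * q * (q - 1)"
  have Gk: "real (card (GLs 2 :: 'a mat set)) = Gk"
    using real_card_GLs_Suc[of 0] real_card_GLs_Suc[of 1] card_GLs_0[where 'a='a] by (simp add: q_def Gk_def numeral_2_eq_2)
  have e2: "n * (n + 1) div 2 = (m + 1) * (2 * m + 3)" by (simp add: n algebra_simps)
  have e1: "n * (n + 1) div 2 - 2 * m * (2 * m + 1) div 2 = 4 * m + 3" by (simp add: n algebra_simps)
  have ks: "2 * (2 * m) = 4 * m" by simp
  let ?N = "real (card {w \<in> DC_plus n. mat_trace w = \<beta>})"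
  let ?H = "Gs * q ^ (4 * m) * Gk * q ^ (4 * m + 3)"
  have "real_of_int (int CARD('a) * (int (card {w \<in> double_coset (2 * m + 2) (2 * m). mat_trace w = \<beta>}) *
      (int (card (GLs (2 * m) :: 'a mat set)) * int CARD('a) ^ (2 * (2 * m)) * int (card (GLs 2 :: 'a mat set)) *
       int CARD('a) ^ ((2 * m + 2) * (2 * m + 2 + 1) div 2 - 2 * m * (2 * m + 1) div 2)))) =
    real_of_int (int (card (GLs (2 * m + 2) :: 'a mat set)) * (int CARD('a) ^ ((2 * m + 2) * (2 * m + 2 + 1) div 2))\<^sup>2 *
     (int (card (GLs (2 * m + 2) :: 'a mat set)) +
        int (card (alt_GLs (2 * m))) * int CARD('a) ^ (2 * (2 * m)) * (int CARD('a) * int (trace_count 2 \<beta>) - int (card (GLs 2 :: 'a mat set)))))"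
    by (simp only: double_coset_trace_count)
  then have "q * (?N * (real (card (GLs (2 * m) :: 'a mat set)) * q ^ (2 * (2 * m)) * real (card (GLs 2 :: 'a mat set)) * q ^ (n * (n + 1) div 2 - 2 * m * (2 * m + 1) div 2)))
    = real (card (GLs n :: 'a mat set)) * (q ^ (n * (n + 1) div 2))\<^sup>2 * (real (card (GLs n :: 'a mat set)) + real (card (alt_GLs (2 * m))) * q ^ (2 * (2 * m)) * (q * real_of_int (int (trace_count 2 \<beta>)) - real (card (GLs 2 :: 'a mat set))))"
    unfolding DC_plus_def n q_def by (simp only: of_int_mult of_int_add of_int_diff of_int_power of_int_of_nat_eq add_diff_cancel_right')
  then have eq: "q * (?N * ?H) = Gn * (q ^ ((m + 1) * (2 * m + 3)))\<^sup>2 * (Gn + a * q ^ (4 * m) * (q * real_of_int (int (trace_count 2 \<beta>)) - Gk))"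
    unfolding e1 unfolding e2 ks Gn Gk Gs_def[symmetric] a_def[symmetric] .
  have tc: "real_of_int (int (trace_count 2 \<beta>)) = q ^ 3 - 2 * q\<^sup>2 - q + q * Kloost0 \<beta>"
    unfolding trace_count_2 by (simp add: Kloost0_def q_def)
  \<comment> \<open>The order of \<open>GL(2)\<close> cancels the leading terms and a factor
    \<open>q\<close> splits off; it is moved into the weight \<open>u\<close> of
    \<open>solve_count\<close>.\<close>
  have "q * real_of_int (int (trace_count 2 \<beta>)) - Gk = q * (q * Kloost0 \<beta> - q\<^sup>2 - 1)"
    unfolding tc by (simp add: Gk_def power2_eq_square power3_eq_cube algebra_simps)
  with eq have "q * (?N * ?H) = Gn * (q ^ ((m + 1) * (2 * m + 3)))\<^sup>2 * (Gn + a * q ^ (4 * m) * (q * (q * Kloost0 \<beta> - q\<^sup>2 - 1)))" by simp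
  then have eq: "q * (?N * ?H) = Gn * (q ^ ((m + 1) * (2 * m + 3)))\<^sup>2 * (Gn + a * q ^ (4 * m) * q * (q * Kloost0 \<beta> - q\<^sup>2 - 1))"
    by (simp only: mult.assoc)
  have A: "A_plus n CARD('a) = q ^ (5 * (m * m) + 9 * m + 4) * ((q ^ (2 * m + 2) - 1) / (q\<^sup>2 - 1) * ((q ^ (2 * m + 1) - 1) / (q - 1))) * Po"
  proof -
    have "(5 * n\<^sup>2 - 2 * n) div 4 = 5 * (m * m) + 9 * m + 4" by (simp add: n power2_eq_square algebra_simps)
    moreover have "(n - 2) div 2 = m" by (simp add: n)
    ultimately show ?thesis by (simp add: A_plus_def gauss_binom_def q_def Po_def n numeral_2_eq_2)
  qed
  have B: "B_plus n CARD('a) = q ^ (m * m) * (q ^ (2 * m + 2) - 1) * (q ^ (2 * m + 1) - 1) * Pe"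
  proof -
    have "(n - 2)\<^sup>2 div 4 = m * m" by (simp add: n power2_eq_square algebra_simps)
    moreover have "(n - 2) div 2 = m" by (simp add: n)
    ultimately show ?thesis by (simp add: B_plus_def q_def Pe_def n)
  qed
  have qm: "q ^ m \<noteq> 0" using q by simp
  have BG: "Gn = a * q ^ (4 * m) * q * B_plus n CARD('a)"
  proof -
    have exps: "q ^ (2 * m + 1) * q ^ (2 * m) = q ^ (4 * m) * q"
      by (simp flip: power_add power_Suc2)
    have "Gn * q ^ m = (q ^ (2 * m + 2) - 1) * (q ^ (2 * m + 1) - 1) * (q ^ (2 * m + 1) * q ^ (2 * m)) * (Gs * q ^ m)"
      unfolding Gn_def by (simp only: mult_ac)
    also have "\<dots> = (a * q ^ m) * (q ^ (4 * m) * q) * B_plus n CARD('a)"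
      unfolding Gs a B exps by (simp only: power2_eq_square mult_ac)
    also have "\<dots> = (a * q ^ (4 * m) * q * B_plus n CARD('a)) * q ^ m" by (simp only: mult_ac)
    finally show ?thesis by (rule mult_right_cancel[OF qm, THEN iffD1])
  qed
  have q2: "q\<^sup>2 - 1 > 0" using pos[of 2] by simp
  have AG: "Gn * (q ^ ((m + 1) * (2 * m + 3)))\<^sup>2 * (a * q ^ (4 * m) * q) = A_plus n CARD('a) * ?H"
  proof -
    have exps: "q ^ (2 * m + 1) * q ^ (2 * m) * (q ^ ((m + 1) * (2 * m + 3)))\<^sup>2 * q ^ (m * m) * q ^ (4 * m) * q
        = q ^ (5 * (m * m) + 9 * m + 4) * q ^ (4 * m) * q ^ (4 * m + 3) * q ^ m * q"
      unfolding power_mult[symmetric] power_add[symmetric] power_Suc2[symmetric]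
      by (rule arg_cong[of _ _ "\<lambda>i. q ^ i"]) (simp add: algebra_simps)
    have q1: "(q ^ (2 * m + 2) - 1) / (q\<^sup>2 - 1) * ((q ^ (2 * m + 1) - 1) / (q - 1)) * (q\<^sup>2 - 1) * (q - 1)
       = (q ^ (2 * m + 2) - 1) * (q ^ (2 * m + 1) - 1)"
    proof -
      have cancel: "x / c * (y / d) * c * d = x * y" if "c \<noteq> 0" "d \<noteq> 0" for x y c d :: real using that by simp
      have "q\<^sup>2 - 1 \<noteq> 0" "q - 1 \<noteq> 0" using q q2 by linarith+
      then show ?thesis by (rule cancel)
    qed
    have "Gn * (q ^ ((m + 1) * (2 * m + 3)))\<^sup>2 * (a * q ^ (4 * m) * q) * q ^ m
      = (q ^ (2 * m + 2) - 1) * q ^ (2 * m + 1) * ((q ^ (2 * m + 1) - 1) * q ^ (2 * m) * Gs) * (q ^ ((m + 1) * (2 * m + 3)))\<^sup>2 * (a * q ^ m) * q ^ (4 * m) * q"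
      unfolding Gn_def by (simp only: mult_ac)
    also have "\<dots> = (q ^ (2 * m + 2) - 1) * (q ^ (2 * m + 1) - 1) * Gs * Po *
        (q ^ (2 * m + 1) * q ^ (2 * m) * (q ^ ((m + 1) * (2 * m + 3)))\<^sup>2 * q ^ (m * m) * q ^ (4 * m) * q)"
      unfolding a by (simp only: mult_ac)
    also have "\<dots> = ((q ^ (2 * m + 2) - 1) / (q\<^sup>2 - 1) * ((q ^ (2 * m + 1) - 1) / (q - 1)) * (q\<^sup>2 - 1) * (q - 1)) * Gs * Po *
        (q ^ (5 * (m * m) + 9 * m + 4) * q ^ (4 * m) * q ^ (4 * m + 3) * q ^ m * q)"
      unfolding exps q1 ..
    also have "\<dots> = A_plus n CARD('a) * ?H * q ^ m" unfolding A Gk_def by (simp only: mult_ac)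
    finally show ?thesis by (rule mult_right_cancel[OF qm, THEN iffD1])
  qed
  have "q\<^sup>2 - 1 \<noteq> 0" using q2 by linarith
  then have "?H \<noteq> 0" using q \<open>Gs \<noteq> 0\<close> by (simp add: Gk_def)
  then show ?thesis
    using solve_count[OF eq BG AG] q by (simp add: q_def)
qed

section \<open>Fourier transforms of the trace distributions\<close>

lemma finite_double_coset: "finite (double_coset n s :: 'a mat set)"
proof (rule finite_subset)
  have "finite (sym_mats n 0 :: 'a mat set)"
    by (rule finite_subset[OF _ finite_carrier_mat[of n n]]) (auto simp: sym_mats_def)
  then show "finite ((\<lambda>(p, p'). p * sigma_mat n s * p') ` (parabolic n \<times> (parabolic n :: 'a mat set)))"
    unfolding parabolic_eq by simp
qed (auto simp: double_coset_def)

lemma sum_lam0: "(\<Sum>\<beta>\<in>UNIV. lam0 \<beta>) = -1"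
proof -
  have "(\<Sum>\<beta>\<in>UNIV. lam0 \<beta>) = (\<Sum>\<beta>\<in>UNIV - {0}. lam0 \<beta>)"
    by (rule sum.mono_neutral_right) (auto simp: lam0_def)
  also have "\<dots> = (\<Sum>\<beta>\<in>UNIV - {0}. real_of_int (lam \<beta>))"
    by (rule sum.reindex_bij_witness[of _ inverse inverse]) (auto simp: lam0_def)
  also have "\<dots> = real_of_int (\<Sum>\<beta>\<in>UNIV - {0}. lam \<beta>)" by simp
  finally show ?thesis by (simp only: sum_lam_nonzero of_int_minus of_int_1)
qed

text \<open>Multiplicativity of the character merges the two factors into one argument
  \<open>a * \<beta> + 1/\<beta>\<close>; scaling brings it to standard form.\<close>

lemma sum_lam0_lam:
  assumes "a \<noteq> 0"
  shows "(\<Sum>\<beta>\<in>UNIV. lam0 \<beta> * real_of_int (lam (a * \<beta>))) = real_of_int (Kloost r a)"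
proof -
  have "(\<Sum>\<beta>\<in>UNIV. lam0 \<beta> * real_of_int (lam (a * \<beta>))) = (\<Sum>\<beta>\<in>UNIV - {0}. lam0 \<beta> * real_of_int (lam (a * \<beta>)))"
    by (rule sum.mono_neutral_right) (auto simp: lam0_def)
  also have "\<dots> = (\<Sum>\<beta>\<in>UNIV - {0}. real_of_int (lam (a * \<beta> + 1 * inverse \<beta>)))"
    by (intro sum.cong) (auto simp: lam0_def lam_add)
  also have "\<dots> = real_of_int (\<Sum>\<beta>\<in>UNIV - {0}. lam (a * \<beta> + 1 * inverse \<beta>))" by (simp only: of_int_sum)
  also have "(\<Sum>\<beta>\<in>UNIV - {0}. lam (a * \<beta> + 1 * inverse \<beta>)) = Kloost r (1 * a)" by (rule Kloost_scale[OF assms])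
  finally show ?thesis by simp
qed

lemma sum_Kloost0: "(\<Sum>\<beta>\<in>UNIV. Kloost0 \<beta>) = real CARD('a) ^ 2 + 1"
proof -
  have "(\<Sum>\<beta>\<in>UNIV. Kloost0 \<beta>) = Kloost0 0 + (\<Sum>\<beta>\<in>UNIV - {0}. Kloost0 \<beta>)"
    by (rule sum.remove) auto
  also have "(\<Sum>\<beta>\<in>UNIV - {0}. Kloost0 \<beta>) = (\<Sum>\<beta>\<in>UNIV - {0::'a}. real_of_int (Kloost r \<beta>))"
    by (rule sum.reindex_bij_witness[of _ inverse inverse]) (auto simp: Kloost0_def)
  also have "\<dots> = real_of_int (\<Sum>\<beta>\<in>UNIV - {0::'a}. Kloost r \<beta>)" by simp
  also have "(\<Sum>\<beta>\<in>UNIV - {0::'a}. Kloost r \<beta>) = (\<Sum>x\<in>UNIV - {0}. lam x * (\<Sum>\<beta>\<in>UNIV - {0}. lam (\<beta> * inverse x)))"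
    unfolding Kloost_eq by (subst sum.swap) (simp add: lam_add sum_distrib_left)
  also have "\<dots> = (\<Sum>x\<in>UNIV - {0}. lam x * (-1))"
  proof (rule sum.cong[OF refl])
    fix x :: 'a assume x: "x \<in> UNIV - {0}"
    have "(\<Sum>\<beta>\<in>UNIV - {0}. lam (\<beta> * inverse x)) = (\<Sum>\<beta>\<in>UNIV - {0}. lam \<beta>)"
      by (rule sum.reindex_bij_witness[of _ "\<lambda>\<beta>. \<beta> * x" "\<lambda>\<beta>. \<beta> * inverse x"]) (use x in auto)
    then show "lam x * (\<Sum>\<beta>\<in>UNIV - {0}. lam (\<beta> * inverse x)) = lam x * (-1)" by (simp only: sum_lam_nonzero)
  qed
  also have "\<dots> = 1" using sum_lam_nonzero by (simp add: sum_negf)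
  finally show ?thesis by (simp add: Kloost0_def)
qed

text \<open>The term at 0 gives \<open>q^2\<close>. In the others the substitution
  \<open>y = a * \<beta>\<close> makes \<open>y\<close> the second variable of the two-dimensional
  Kloosterman sum.\<close>

lemma sum_Kloost0_lam:
  assumes a: "a \<noteq> 0"
  shows "(\<Sum>\<beta>\<in>UNIV. Kloost0 \<beta> * real_of_int (lam (a * \<beta>))) = real CARD('a) ^ 2 + real_of_int (Kloost2 r a)"
proof -
  have "(\<Sum>\<beta>\<in>UNIV. Kloost0 \<beta> * real_of_int (lam (a * \<beta>)))
      = Kloost0 0 * real_of_int (lam (a * 0)) + (\<Sum>\<beta>\<in>UNIV - {0}. Kloost0 \<beta> * real_of_int (lam (a * \<beta>)))"
    by (rule sum.remove) auto
  also have "(\<Sum>\<beta>\<in>UNIV - {0}. Kloost0 \<beta> * real_of_int (lam (a * \<beta>)))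
      = (\<Sum>y\<in>UNIV - {0}. real_of_int (Kloost r (a * inverse y) * lam y))"
    by (rule sum.reindex_bij_witness[of _ "\<lambda>y. y / a" "\<lambda>\<beta>. a * \<beta>"]) (use a in \<open>auto simp: Kloost0_def simp flip: mult.assoc\<close>)
  also have "\<dots> = real_of_int (\<Sum>y\<in>UNIV - {0}. Kloost r (a * inverse y) * lam y)" by simp
  also have "(\<Sum>y\<in>UNIV - {0}. Kloost r (a * inverse y) * lam y) = Kloost2 r a"
    unfolding Kloost2_eq Kloost_eq sum_distrib_right
    by (rule sum.cong[OF refl], rule sum.cong[OF refl]) (simp only: lam_add mult_ac)
  finally show ?thesis by (simp add: Kloost0_def)
qed

lemma sum_over_traces:
  fixes f :: "'a \<Rightarrow> real" and D :: "'a mat set"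
  assumes "finite D"
  shows "(\<Sum>w\<in>D. f (mat_trace w)) = (\<Sum>\<beta>\<in>UNIV. real (card {w \<in> D. mat_trace w = \<beta>}) * f \<beta>)"
proof -
  have "(\<Sum>w\<in>D. f (mat_trace w)) = (\<Sum>\<beta>\<in>UNIV. \<Sum>w\<in>{w \<in> D. mat_trace w = \<beta>}. f (mat_trace w))"
    using assms by (subst sum.group) auto
  also have "\<dots> = (\<Sum>\<beta>\<in>UNIV. \<Sum>w\<in>{w \<in> D. mat_trace w = \<beta>}. f \<beta>)" by (intro sum.cong) auto
  finally show ?thesis by simp
qed

text \<open>The constant \<open>c\<close> is the sum of \<open>\<kappa>\<close>, so the corrections
  cancel when the counts are added over the field and only \<open>A * B\<close> is left.\<close>

lemma card_from_trace_counts: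
  fixes D :: "'a mat set" and A B c :: real and \<kappa> :: "'a \<Rightarrow> real"
  assumes "finite D" and count: "\<And>\<beta>. real (card {w \<in> D. mat_trace w = \<beta>}) = A / real CARD('a) * (B + (real CARD('a) * \<kappa> \<beta> - c))"
    and "(\<Sum>\<beta>\<in>UNIV. \<kappa> \<beta>) = c"
  shows "real (card D) = A * B"
proof -
  have "real (card D) = (\<Sum>\<beta>\<in>(UNIV :: 'a set). A / real CARD('a) * (B + (real CARD('a) * \<kappa> \<beta> - c)))"
    using sum_over_traces[OF assms(1), of "\<lambda>_. 1"] by (simp add: count)
  also have "\<dots> = A / real CARD('a) * (\<Sum>\<beta>\<in>(UNIV :: 'a set). B + (real CARD('a) * \<kappa> \<beta> - c))"
    by (rule sum_distrib_left[symmetric])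
  also have "\<dots> = A / real CARD('a) * (real CARD('a) * B + (real CARD('a) * (\<Sum>\<beta>\<in>UNIV. \<kappa> \<beta>) - real CARD('a) * c))"
    by (simp only: sum.distrib sum_subtractf sum_distrib_left sum_constant)
  also have "\<dots> = A * B" using card_ge_2 by (simp add: assms(3))
  finally show ?thesis .
qed

text \<open>The part of the count that does not depend on \<beta> is killed by orthogonality, as
  \<open>a\<close> is nonzero; what remains is \<open>A\<close> times the Fourier transform of
  \<open>\<kappa>\<close>.\<close>

lemma trace_char_sum:
  fixes D :: "'a mat set" and A B c :: real and \<kappa> :: "'a \<Rightarrow> real"
  assumes "finite D" and count: "\<And>\<beta>. real (card {w \<in> D. mat_trace w = \<beta>}) = A / real CARD('a) * (B + (real CARD('a) * \<kappa> \<beta> - c))"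
    and gs: "ordering_of gs D" and a: "a \<noteq> 0"
  shows "(\<Sum>i<length gs. real_of_int (lam (a * mat_trace (gs ! i)))) = A * (\<Sum>\<beta>\<in>UNIV. \<kappa> \<beta> * real_of_int (lam (a * \<beta>)))"
proof -
  have "bij_betw (\<lambda>i. gs ! i) {..<length gs} D"
    using gs by (intro bij_betw_nth) (auto simp: ordering_of_def)
  then have "(\<Sum>i<length gs. real_of_int (lam (a * mat_trace (gs ! i)))) = (\<Sum>w\<in>D. real_of_int (lam (a * mat_trace w)))"
    by (rule sum.reindex_bij_betw)
  also have "\<dots> = (\<Sum>\<beta>\<in>UNIV. A / real CARD('a) * (B + (real CARD('a) * \<kappa> \<beta> - c)) * real_of_int (lam (a * \<beta>)))"
    using sum_over_traces[OF assms(1), of "\<lambda>\<beta>. real_of_int (lam (a * \<beta>))"] by (simp add: count)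
  also have "\<dots> = (\<Sum>\<beta>\<in>UNIV. A * (\<kappa> \<beta> * real_of_int (lam (a * \<beta>))) + A / real CARD('a) * (B - c) * real_of_int (lam (a * \<beta>)))"
    using card_ge_2 by (intro sum.cong refl) (simp add: field_simps)
  also have "\<dots> = A * (\<Sum>\<beta>\<in>UNIV. \<kappa> \<beta> * real_of_int (lam (a * \<beta>))) + A / real CARD('a) * (B - c) * real_of_int (\<Sum>\<beta>\<in>UNIV. lam (a * \<beta>))"
    unfolding sum.distrib sum_distrib_left of_int_sum ..
  finally show ?thesis using sum_lam_mult[of a] a by simp
qed

lemma weight_count_families:
  fixes D :: "'a mat set"
  assumes gs: "ordering_of gs D"
  shows "real (weight_count gs j) = (\<Sum>\<nu>\<in>families j. \<Prod>\<beta>\<in>UNIV. binom (real (card {w \<in> D. mat_trace w = \<beta>})) (int (\<nu> \<beta>)))"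
proof -
  have "card {i. i < length gs \<and> mat_trace (gs ! i) = \<beta>} = card {w \<in> D. mat_trace w = \<beta>}" for \<beta>
  proof (rule bij_betw_same_card)
    show "bij_betw (\<lambda>i. gs ! i) {i. i < length gs \<and> mat_trace (gs ! i) = \<beta>} {w \<in> D. mat_trace w = \<beta>}"
      using gs by (intro bij_betw_imageI)
        (auto simp: ordering_of_def inj_on_def nth_eq_iff_index_eq in_set_conv_nth image_iff)
  qed
  then show ?thesis unfolding weight_count_eq card_zero_sum_subsets by (simp add: binom_of_nat)
qed

lemma prod_UNIV_zero: "(\<Prod>\<beta>\<in>UNIV. f \<beta>) = f 0 * (\<Prod>\<beta>\<in>UNIV - {0::'a}. f \<beta> :: real)"
  by (rule prod.remove) auto

lemma A_minus_nonzero: "A_minus n CARD('a) \<noteq> 0" if "n \<ge> 1"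
proof -
  have pos: "real CARD('a) ^ i - 1 > 0" if "i > 0" for i using card_ge_2 that by (simp add: one_less_power)
  have "(\<Prod>j = 1..(n - 1) div 2. real CARD('a) ^ (2 * j - 1) - 1) > 0" by (auto intro!: prod_pos pos)
  moreover have "gauss_binom CARD('a) n 1 > 0"
    using that card_ge_2 by (auto simp: gauss_binom_def intro!: divide_pos_pos pos)
  moreover have "real CARD('a) ^ i > 0" for i by simp
  ultimately have "A_minus n CARD('a) > 0" unfolding A_minus_def by (intro mult_pos_pos)
  then show ?thesis by simp
qed

lemma A_plus_nonzero: "A_plus n CARD('a) \<noteq> 0" if "n \<ge> 2"
proof -
  have pos: "real CARD('a) ^ i - 1 > 0" if "i > 0" for i using card_ge_2 that by (simp add: one_less_power)
  have "(\<Prod>j = 1..(n - 2) div 2. real CARD('a) ^ (2 * j - 1) - 1) > 0" by (auto intro!: prod_pos pos)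
  moreover have "gauss_binom CARD('a) n 2 > 0"
    using that unfolding gauss_binom_def by (auto intro!: prod_pos divide_pos_pos pos)
  moreover have "real CARD('a) ^ i > 0" for i by simp
  ultimately have "A_plus n CARD('a) > 0" unfolding A_plus_def by (intro mult_pos_pos)
  then show ?thesis by simp
qed

text \<open>Here \<open>\<kappa>\<close> is \<open>lam0\<close>, whose sum is -1 and whose Fourier
  transform at \<open>a\<close> is \<open>K(a)\<close> without a constant. The two products in the
  weight formula come from its two values on nonzero elements.\<close>

lemma code_DC_minus:
  fixes n :: nat
  defines "D \<equiv> DC_minus n :: 'a mat set" and "A \<equiv> A_minus n CARD('a)" and "B \<equiv> B_minus n CARD('a)"
  assumes n: "odd n"
  shows "real (card D) = A * B"
    and "ordering_of gs D \<Longrightarrow> real (weight_count gs j) = (\<Sum>\<nu>\<in>families j.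
        binom (A * (B + 1) / real CARD('a)) (int (\<nu> 0))
        * (\<Prod>\<beta>\<in>{\<beta>::'a. \<beta> \<noteq> 0 \<and> abs_tr r (inverse \<beta>) = 0}. binom (A * (B + real CARD('a) + 1) / real CARD('a)) (int (\<nu> \<beta>)))
        * (\<Prod>\<beta>\<in>{\<beta>::'a. \<beta> \<noteq> 0 \<and> abs_tr r (inverse \<beta>) = 1}. binom (A * (B - real CARD('a) + 1) / real CARD('a)) (int (\<nu> \<beta>))))"
    and "ordering_of gs D \<Longrightarrow> h \<ge> 1 \<Longrightarrow> real_of_int (MK TYPE('a) r h) =
        (\<Sum>l<h. (-1) ^ (h + l + 1) * real (h choose l) * B ^ (h - l) * real_of_int (MK TYPE('a) r l))
        + moment_term CARD('a) A (card D) (weight_count gs) h"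
proof -
  let ?q = "real CARD('a)"
  have fin: "finite D" unfolding D_def DC_minus_def by (rule finite_double_coset)
  have count: "real (card {w \<in> D. mat_trace w = \<beta>}) = A / ?q * (B + (?q * lam0 \<beta> - (-1)))" for \<beta>
    using card_DC_minus_trace[OF n, of \<beta>] by (simp add: D_def A_def B_def)
  show N: "real (card D) = A * B" by (rule card_from_trace_counts[OF fin count sum_lam0])
  have A0: "A \<noteq> 0" using A_minus_nonzero[of n] n by (cases n) (auto simp: A_def)
  show "real (weight_count gs j) = (\<Sum>\<nu>\<in>families j.
        binom (A * (B + 1) / ?q) (int (\<nu> 0))
        * (\<Prod>\<beta>\<in>{\<beta>::'a. \<beta> \<noteq> 0 \<and> abs_tr r (inverse \<beta>) = 0}. binom (A * (B + ?q + 1) / ?q) (int (\<nu> \<beta>)))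
        * (\<Prod>\<beta>\<in>{\<beta>::'a. \<beta> \<noteq> 0 \<and> abs_tr r (inverse \<beta>) = 1}. binom (A * (B - ?q + 1) / ?q) (int (\<nu> \<beta>))))"
    if gs: "ordering_of gs D"
    unfolding weight_count_families[OF gs]
  proof (rule sum.cong[OF refl])
    fix \<nu> :: "'a \<Rightarrow> nat"
    let ?f = "\<lambda>\<beta>. binom (real (card {w \<in> D. mat_trace w = \<beta>})) (int (\<nu> \<beta>))"
    let ?S0 = "{\<beta>::'a. \<beta> \<noteq> 0 \<and> abs_tr r (inverse \<beta>) = 0}" and ?S1 = "{\<beta>::'a. \<beta> \<noteq> 0 \<and> abs_tr r (inverse \<beta>) = 1}"
    have U: "UNIV - {0} = ?S0 \<union> ?S1" using tr_cases by (auto simp: tr_def)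
    have "(\<Prod>\<beta>\<in>?S0 \<union> ?S1. ?f \<beta>) = (\<Prod>\<beta>\<in>?S0. ?f \<beta>) * (\<Prod>\<beta>\<in>?S1. ?f \<beta>)"
      by (rule prod.union_disjoint) auto
    then have "(\<Prod>\<beta>\<in>UNIV. ?f \<beta>) = ?f 0 * ((\<Prod>\<beta>\<in>?S0. ?f \<beta>) * (\<Prod>\<beta>\<in>?S1. ?f \<beta>))"
      unfolding prod_UNIV_zero U by (rule arg_cong)
    also have "?f 0 = binom (A * (B + 1) / ?q) (int (\<nu> 0))" by (simp add: count lam0_def)
    also have "(\<Prod>\<beta>\<in>?S0. ?f \<beta>) = (\<Prod>\<beta>\<in>?S0. binom (A * (B + ?q + 1) / ?q) (int (\<nu> \<beta>)))"
      by (intro prod.cong refl) (auto simp: count lam0_def lam_eq tr_def add_ac)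
    also have "(\<Prod>\<beta>\<in>?S1. ?f \<beta>) = (\<Prod>\<beta>\<in>?S1. binom (A * (B - ?q + 1) / ?q) (int (\<nu> \<beta>)))"
    proof (intro prod.cong refl)
      fix \<beta> assume "\<beta> \<in> ?S1"
      then have "lam0 \<beta> = -1" by (simp add: lam0_def lam_eq tr_def)
      then have "B + (?q * lam0 \<beta> - (-1)) = B - ?q + 1" by simp
      then have "real (card {w \<in> D. mat_trace w = \<beta>}) = A * (B - ?q + 1) / ?q"
        unfolding count by (simp only: times_divide_eq_left)
      then show "?f \<beta> = binom (A * (B - ?q + 1) / ?q) (int (\<nu> \<beta>))" by (simp only:)
    qed
    finally show "(\<Prod>\<beta>\<in>UNIV. ?f \<beta>) = binom (A * (B + 1) / ?q) (int (\<nu> 0))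
        * (\<Prod>\<beta>\<in>?S0. binom (A * (B + ?q + 1) / ?q) (int (\<nu> \<beta>)))
        * (\<Prod>\<beta>\<in>?S1. binom (A * (B - ?q + 1) / ?q) (int (\<nu> \<beta>)))" by (simp only: mult.assoc)
  qed
  assume gs: "ordering_of gs D" and h: "h \<ge> 1"
  have len: "length gs = card D" using gs by (auto simp: ordering_of_def distinct_card)
  have cs: "(\<Sum>i<length gs. real_of_int (lam (a * mat_trace (gs ! i)))) = A * (0 + real_of_int (Kloost r a))" if "a \<noteq> 0" for a
    using trace_char_sum[OF fin count gs that] sum_lam0_lam[OF that] by simp
  have NL: "real (length gs) = A * B" using N len by simp
  show "real_of_int (MK TYPE('a) r h) = (\<Sum>l<h. (-1) ^ (h + l + 1) * real (h choose l) * B ^ (h - l) * real_of_int (MK TYPE('a) r l))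
        + moment_term CARD('a) A (card D) (weight_count gs) h"
    using moment_recursion[OF NL A0 h cs] unfolding len MK_def by simp
qed

text \<open>Here \<open>\<kappa>\<close> is \<open>Kloost0\<close>, with sum \<open>q^2 + 1\<close>
  and Fourier transform \<open>q^2 + K_2(a)\<close>. The two recursions come from the same code,
  read once with \<open>K_2\<close> and once with the square of \<open>K\<close>.\<close>

lemma code_DC_plus:
  fixes n :: nat
  defines "D \<equiv> DC_plus n :: 'a mat set" and "A \<equiv> A_plus n CARD('a)" and "B \<equiv> B_plus n CARD('a)"
  assumes n: "even n" "n \<ge> 2"
  shows "real (card D) = A * B"
    and "r \<ge> 2 \<Longrightarrow> ordering_of gs D \<Longrightarrow> real (weight_count gs j) = (\<Sum>\<nu>\<in>families j.
        binom (A * (B + real CARD('a) ^ 3 - real CARD('a) ^ 2 - 1) / real CARD('a)) (int (\<nu> 0))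
        * (\<Prod>\<tau>\<in>{\<tau>::int. \<bar>of_int \<tau>\<bar> < 2 * sqrt (real CARD('a)) \<and> [\<tau> = -1] (mod 4)}.
             \<Prod>\<beta>\<in>{\<beta>::'a. \<beta> \<noteq> 0 \<and> Kloost r (inverse \<beta>) = \<tau>}.
               binom (A * (B + real CARD('a) * of_int \<tau> - real CARD('a) ^ 2 - 1) / real CARD('a)) (int (\<nu> \<beta>))))"
    and "ordering_of gs D \<Longrightarrow> h \<ge> 1 \<Longrightarrow> real_of_int (MK2 TYPE('a) r h) =
        (\<Sum>l<h. (-1) ^ (h + l + 1) * real (h choose l) * (B - real CARD('a) ^ 2) ^ (h - l) * real_of_int (MK2 TYPE('a) r l))
        + moment_term CARD('a) A (card D) (weight_count gs) h"
    and "ordering_of gs D \<Longrightarrow> h \<ge> 1 \<Longrightarrow> real_of_int (MK TYPE('a) r (2 * h)) =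
        (\<Sum>l<h. (-1) ^ (h + l + 1) * real (h choose l) * (B - real CARD('a) ^ 2 + real CARD('a)) ^ (h - l) * real_of_int (MK TYPE('a) r (2 * l)))
        + moment_term CARD('a) A (card D) (weight_count gs) h"
proof -
  let ?q = "real CARD('a)"
  have fin: "finite D" unfolding D_def DC_plus_def by (rule finite_double_coset)
  have count: "real (card {w \<in> D. mat_trace w = \<beta>}) = A / ?q * (B + (?q * Kloost0 \<beta> - (?q ^ 2 + 1)))" for \<beta>
    using card_DC_plus_trace[OF n, of \<beta>] by (simp add: D_def A_def B_def diff_diff_eq)
  show N: "real (card D) = A * B" by (rule card_from_trace_counts[OF fin count sum_Kloost0])
  have A0: "A \<noteq> 0" using A_plus_nonzero[of n] n by (auto simp: A_def)
  {
    assume r2: "r \<ge> 2" and gs: "ordering_of gs D"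
    let ?T = "{\<tau>::int. \<bar>of_int \<tau>\<bar> < 2 * sqrt ?q \<and> [\<tau> = -1] (mod 4)}"
    \<comment> \<open>The Weil bound and the congruence modulo 4 ensure that every nonzero \<beta>
      occurs in one of the inner products, so the double product is a regrouping of the product over
      all nonzero \<beta>.\<close>
    have in_T: "Kloost r (inverse \<beta>) \<in> ?T" if "\<beta> \<noteq> 0" for \<beta> :: 'a
    proof -
      have b: "inverse \<beta> \<noteq> 0" using that by simp
      have "real_of_int ((Kloost r (inverse \<beta>))\<^sup>2) < real_of_int (4 * int CARD('a))"
        using Kloost_Weil_bound[OF b r2] by (simp only: of_int_less_iff)
      then have "(real_of_int (Kloost r (inverse \<beta>)))\<^sup>2 < (2 * sqrt ?q)\<^sup>2" by (simp add: power_mult_distrib)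
      then have "\<bar>real_of_int (Kloost r (inverse \<beta>))\<bar> < 2 * sqrt ?q" using power2_less_imp_less[of "\<bar>real_of_int (Kloost r (inverse \<beta>))\<bar>" "2 * sqrt (real CARD('a))"] by simp
      then show ?thesis using Kloost_mod_4[OF b r2] by simp
    qed
    have finT: "finite ?T"
    proof (rule finite_subset)
      show "?T \<subseteq> {- \<lceil>2 * sqrt ?q\<rceil>..\<lceil>2 * sqrt ?q\<rceil>}" by (auto simp: abs_less_iff) linarith+
    qed simp
    show "real (weight_count gs j) = (\<Sum>\<nu>\<in>families j.
        binom (A * (B + ?q ^ 3 - ?q ^ 2 - 1) / ?q) (int (\<nu> 0))
        * (\<Prod>\<tau>\<in>?T. \<Prod>\<beta>\<in>{\<beta>::'a. \<beta> \<noteq> 0 \<and> Kloost r (inverse \<beta>) = \<tau>}.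
               binom (A * (B + ?q * of_int \<tau> - ?q ^ 2 - 1) / ?q) (int (\<nu> \<beta>))))"
      unfolding weight_count_families[OF gs]
    proof (rule sum.cong[OF refl])
      fix \<nu> :: "'a \<Rightarrow> nat"
      let ?f = "\<lambda>\<beta>. binom (real (card {w \<in> D. mat_trace w = \<beta>})) (int (\<nu> \<beta>))"
      have "real (card {w \<in> D. mat_trace w = 0}) = A * (B + ?q ^ 3 - ?q ^ 2 - 1) / ?q"
      proof -
        have "B + (?q * ?q ^ 2 - (?q ^ 2 + 1)) = B + ?q ^ 3 - ?q ^ 2 - 1"
          by (simp add: power2_eq_square power3_eq_cube)
        then show ?thesis unfolding count by (simp add: Kloost0_def)
      qed
      then have f0: "?f 0 = binom (A * (B + ?q ^ 3 - ?q ^ 2 - 1) / ?q) (int (\<nu> 0))" by (simp only:)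
      have "(\<Prod>\<beta>\<in>UNIV - {0}. ?f \<beta>) = (\<Prod>\<tau>\<in>?T. \<Prod>\<beta>\<in>{\<beta> \<in> UNIV - {0}. Kloost r (inverse \<beta>) = \<tau>}. ?f \<beta>)"
        by (rule prod.group[symmetric]) (use finT in_T in auto)
      also have "\<dots> = (\<Prod>\<tau>\<in>?T. \<Prod>\<beta>\<in>{\<beta>::'a. \<beta> \<noteq> 0 \<and> Kloost r (inverse \<beta>) = \<tau>}.
               binom (A * (B + ?q * of_int \<tau> - ?q ^ 2 - 1) / ?q) (int (\<nu> \<beta>)))"
      proof (intro prod.cong)
        fix \<tau> and \<beta> :: 'a assume "\<beta> \<in> {\<beta>. \<beta> \<noteq> 0 \<and> Kloost r (inverse \<beta>) = \<tau>}"
        then have "real (card {w \<in> D. mat_trace w = \<beta>}) = A * (B + ?q * of_int \<tau> - ?q ^ 2 - 1) / ?q"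
          unfolding count by (auto simp: Kloost0_def diff_diff_eq add_diff_eq)
        then show "?f \<beta> = binom (A * (B + ?q * of_int \<tau> - ?q ^ 2 - 1) / ?q) (int (\<nu> \<beta>))" by (simp only:)
      qed auto
      finally show "(\<Prod>\<beta>\<in>UNIV. ?f \<beta>) = binom (A * (B + ?q ^ 3 - ?q ^ 2 - 1) / ?q) (int (\<nu> 0))
        * (\<Prod>\<tau>\<in>?T. \<Prod>\<beta>\<in>{\<beta>::'a. \<beta> \<noteq> 0 \<and> Kloost r (inverse \<beta>) = \<tau>}.
               binom (A * (B + ?q * of_int \<tau> - ?q ^ 2 - 1) / ?q) (int (\<nu> \<beta>)))"
        unfolding prod_UNIV_zero f0 by (simp only:)
    qed
  }
  assume gs: "ordering_of gs D" and h: "h \<ge> 1"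
  have len: "length gs = card D" using gs by (auto simp: ordering_of_def distinct_card)
  have cs: "(\<Sum>i<length gs. real_of_int (lam (a * mat_trace (gs ! i)))) = A * (?q ^ 2 + real_of_int (Kloost2 r a))" if "a \<noteq> 0" for a
    using trace_char_sum[OF fin count gs that] sum_Kloost0_lam[OF that] by simp
  have NL: "real (length gs) = A * B" using N len by simp
  show "real_of_int (MK2 TYPE('a) r h) =
        (\<Sum>l<h. (-1) ^ (h + l + 1) * real (h choose l) * (B - ?q ^ 2) ^ (h - l) * real_of_int (MK2 TYPE('a) r l))
        + moment_term CARD('a) A (card D) (weight_count gs) h"
    using moment_recursion[OF NL A0 h cs] unfolding len MK2_def by simp
  \<comment> \<open>Replacing \<open>K_2\<close> by the square of \<open>K\<close> minus
    \<open>q\<close> changes only the constant, from \<open>q^2\<close> to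
    \<open>q^2 - q\<close>.\<close>
  have cs': "(\<Sum>i<length gs. real_of_int (lam (a * mat_trace (gs ! i)))) = A * ((?q ^ 2 - ?q) + (real_of_int (Kloost r a))\<^sup>2)" if "a \<noteq> 0" for a
  proof -
    have "real_of_int ((Kloost r a)\<^sup>2) = real_of_int (Kloost2 r a + int CARD('a))" by (simp only: Kloost_sq_eq_Kloost2[OF that])
    then have "real_of_int (Kloost2 r a) = (real_of_int (Kloost r a))\<^sup>2 - ?q" by simp
    then show ?thesis unfolding cs[OF that] by (intro arg_cong[of _ _ "\<lambda>x. A * x"]) simp
  qed
  show "real_of_int (MK TYPE('a) r (2 * h)) =
        (\<Sum>l<h. (-1) ^ (h + l + 1) * real (h choose l) * (B - ?q ^ 2 + ?q) ^ (h - l) * real_of_int (MK TYPE('a) r (2 * l)))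
        + moment_term CARD('a) A (card D) (weight_count gs) h"
    using moment_recursion[OF NL A0 h cs'] unfolding len MK_def by (simp add: power_mult diff_diff_eq2 diff_add_eq)
qed

end

theorem theorem1:
  fixes q r n :: nat
  assumes "r \<ge> 1" and "q = 2 ^ r" and "CARD('a::{finite,field}) = q"
  shows
    "(odd n \<and> (n \<ge> 3 \<or> n = 1 \<and> q \<ge> 8) \<longrightarrow>
      (let N = card (DC_minus n :: 'a mat set); A = A_minus n q; B = B_minus n q
       in real N = A * B \<and>
          (\<forall>gs :: 'a mat list. ordering_of gs (DC_minus n) \<longrightarrow>
           (let C = weight_count gs in
            (\<forall>j\<le>N. real (C j) =
              (\<Sum>\<nu>\<in>families j.
                 binom (A * (B + 1) / real q) (int (\<nu> 0))
                 * (\<Prod>\<beta>\<in>{\<beta>::'a. \<beta> \<noteq> 0 \<and> abs_tr r (inverse \<beta>) = 0}.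
                      binom (A * (B + real q + 1) / real q) (int (\<nu> \<beta>)))
                 * (\<Prod>\<beta>\<in>{\<beta>::'a. \<beta> \<noteq> 0 \<and> abs_tr r (inverse \<beta>) = 1}.
                      binom (A * (B - real q + 1) / real q) (int (\<nu> \<beta>))))) \<and>
            (\<forall>h\<ge>1. of_int (MK TYPE('a) r h) =
              (\<Sum>l<h. (-1) ^ (h + l + 1) * real (h choose l) * B ^ (h - l)
                 * of_int (MK TYPE('a) r l))
              + moment_term q A N C h)))))
     \<and>
     (even n \<and> n \<ge> 2 \<and> q \<ge> 4 \<longrightarrow>
      (let N = card (DC_plus n :: 'a mat set); A = A_plus n q; B = B_plus n q
       in real N = A * B \<and>
          (\<forall>gs :: 'a mat list. ordering_of gs (DC_plus n) \<longrightarrow>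
           (let C = weight_count gs in
            (\<forall>j\<le>N. real (C j) =
              (\<Sum>\<nu>\<in>families j.
                 binom (A * (B + real q ^ 3 - real q ^ 2 - 1) / real q) (int (\<nu> 0))
                 * (\<Prod>\<tau>\<in>{\<tau>::int. \<bar>of_int \<tau>\<bar> < 2 * sqrt (real q) \<and> [\<tau> = -1] (mod 4)}.
                      \<Prod>\<beta>\<in>{\<beta>::'a. \<beta> \<noteq> 0 \<and> Kloost r (inverse \<beta>) = \<tau>}.
                        binom (A * (B + real q * of_int \<tau> - real q ^ 2 - 1) / real q)
                          (int (\<nu> \<beta>))))) \<and>
            (\<forall>h\<ge>1. of_int (MK2 TYPE('a) r h) =
              (\<Sum>l<h. (-1) ^ (h + l + 1) * real (h choose l) * (B - real q ^ 2) ^ (h - l)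
                 * of_int (MK2 TYPE('a) r l))
              + moment_term q A N C h) \<and>
            (\<forall>h\<ge>1. of_int (MK TYPE('a) r (2 * h)) =
              (\<Sum>l<h. (-1) ^ (h + l + 1) * real (h choose l)
                 * (B - real q ^ 2 + real q) ^ (h - l) * of_int (MK TYPE('a) r (2 * l)))
              + moment_term q A N C h)))))"
proof -
  interpret char2_field "TYPE('a)" r
    using assms by unfold_locales auto
  have q: "q = CARD('a)" using assms(3) by simp
  have r2: "r \<ge> 2" if "q \<ge> 4"
  proof (rule ccontr)
    assume "\<not> r \<ge> 2"
    then have "q \<le> 2 ^ 1" unfolding assms(2) by (intro power_increasing) auto
    then show False using that by simp
  qed
  show ?thesis
    unfolding Let_def q
    using code_DC_minus[of n] code_DC_plus[of n] r2 unfolding q by blast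
qed

end
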